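(* Assume that the Hamiltonian $X$ is irreducible. Then there exists $\beta_*<\infty$ such that for all $\beta>\beta_*$ $$\lim_{N\to\infty}\mathbb E\Big[\big\langle \mathbf 1\{d(\sigma,\sigma')\le \max\{d(\sigma,\sigma''),\,d(\sigma',\sigma'')\}\}\big\rangle^{\otimes 3}_{\beta,N}\Big]=1,$$ where $\langle\cdot\rangle_{\beta,N}^{\otimes 3}$ denotes the average over three configurations $\sigma,\sigma',\sigma''\in\Sigma_N$ drawn independently from the (quenched) Gibbs measure $\mathcal G_{\beta,N}$, and $d(\sigma,\sigma')=\sqrt{\mathbb E[(X_\sigma-X_{\sigma'})^2]}$.
   Context: Fix $n\in\mathbb N$, $I=\{1,\dots,n\}$, real numbers $a_J\ge 0$ ($J\subset I$) with $a_\emptyset=0$ and $\sum_{J\subset I}a_J=1$, and real numbers $\gamma_i>0$ ($i\in I$) with $\sum_i\gamma_i=1$. For $A\subset I$ put $\mathcal P_A=\{J\subset A:a_J>0\}$, $\mathcal P=\mathcal P_I$, $\alpha(A)=\sum_{J\in\mathcal P_A}a_J$, $\gamma(A)=\sum_{i\in A}\gamma_i$. It is assumed that every $i\in I$ belongs to some $J\in\mathcal P$. For $N\in\mathbb N$ (for notational convenience all $2^{\gamma_iN}$ are assumed to be integers) let $\Sigma_N^i=\{1,\dots,2^{\gamma_iN}\}$, $\Sigma_{N,A}=\prod_{i\in A}\Sigma_N^i$ and $\Sigma_N=\Sigma_{N,I}$. For a configuration $\tau$ and a set $J$ of indices, $\tau_J=(\tau_i)_{i\in J}$. Hamiltonian: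 $X_\sigma=\sum_{J\in\mathcal P}X^J_{\sigma_J}$, $\sigma\in\Sigma_N$, where the $X^J_{\tau}$ ($J\in\mathcal P$, $\tau\in\Sigma_{N,J}$) are independent centered Gaussian random variables with variance $a_JN$; $\mathbb P,\mathbb E$ refer to these variables. The Gibbs measure is the random probability measure $\mathcal G_{\beta,N}(\sigma)=e^{\beta X_\sigma}/\sum_{\tau\in\Sigma_N}e^{\beta X_\tau}$ on $\Sigma_N$. Chain: for $B\subsetneq A\subset I$ let $\rho(B,A)=\sqrt{2\log 2\,\frac{\gamma(A)-\gamma(B)}{\alpha(A)-\alpha(B)}}$ ($=\infty$ if the denominator vanishes). Set $A_0=\emptyset$, $\beta_0=0$; recursively, while $A_{j-1}\ne I$, let $\beta_j=\min_{A\supsetneq A_{j-1}}\rho(A_{j-1},A)$ and let $A_j$ be the largest (for inclusion) $A\supsetneq A_{j-1}$ with $\rho(A_{j-1},A)=\beta_j$. The recursion ends at $A_K=I$, and $0<\beta_1<\dots<\beta_K<\beta_{K+1}:=\infty$. The Hamiltonian is called irreducible if the following two conditions hold. (c) For every $j=1,\dots,K$ and every $A\subsetneq A_j\setminus A_{j-1}$ with $\mathcal P_{A\cup A_{j-1}}\setminus\mathcal P_{A_{j-1}}\neq\emptyset$ there exist $J\in\mathcal P_{A_j}\setminus\mathcal P_{A\cup A_{j-1}}$ and $J'\in\mathcal P_{A\cup A_{j-1}}\setminus\mathcal P_{A_{j-1}}$ with $(J\cap J')\setminus A_{j-1}\ne\emptyset$. (c') For every $j=2,\dots,K$ there exist $s\in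 A_{j-1}\setminus A_{j-2}$ and $J\in\mathcal P_{A_j}\setminus\mathcal P_{A_{j-1}}$ with $s\in J$. *)

theory Defs
  imports "HOL-Probability.Probability"
begin

text \<open>
  Throughout, the index set is \<open>I = {1..n}\<close>, \<open>a J\<close> is the variance weight of \<open>J \<subseteq> I\<close> and
  \<open>\<gamma> i\<close> is the entropy weight of the coordinate \<open>i\<close>.
\<close>

definition active :: "(nat set \<Rightarrow> real) \<Rightarrow> nat set \<Rightarrow> nat set set" where
  "active a A = {J. J \<subseteq> A \<and> a J > 0}"

definition alpha :: "(nat set \<Rightarrow> real) \<Rightarrow> nat set \<Rightarrow> real" where
  "alpha a A = (\<Sum>J\<in>active a A. a J)"

definition gam :: "(nat \<Rightarrow> real) \<Rightarrow> nat set \<Rightarrow> real" where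
  "gam \<gamma> A = (\<Sum>i\<in>A. \<gamma> i)"

text \<open>
  The number of values of coordinate \<open>i\<close> is the integer part of \<open>2 powr (\<gamma> i * N)\<close>, which is
  \<open>2 powr (\<gamma> i * N)\<close> itself whenever this is an integer.
\<close>

definition spins :: "(nat \<Rightarrow> real) \<Rightarrow> nat \<Rightarrow> nat \<Rightarrow> nat set" where
  "spins \<gamma> N i = {1..nat \<lfloor>2 powr (\<gamma> i * real N)\<rfloor>}"

definition configs :: "(nat \<Rightarrow> real) \<Rightarrow> nat \<Rightarrow> nat set \<Rightarrow> (nat \<Rightarrow> nat) set" where
  "configs \<gamma> N A = (\<Pi>\<^sub>E i\<in>A. spins \<gamma> N i)"

text \<open>
  \<open>X N J \<tau>\<close> is the Gaussian variable attached to \<open>\<tau> \<in> configs \<gamma> N J\<close> in the system of size \<open>N\<close>,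
  living on the probability space \<open>M N\<close>; nothing is assumed about the joint law for different
  \<open>N\<close>.  The size \<open>N = 0\<close> is left out because \<^const>\<open>normal_density\<close> is no density
  for variance zero.
\<close>

definition gaussian_disorder ::
  "nat \<Rightarrow> (nat set \<Rightarrow> real) \<Rightarrow> (nat \<Rightarrow> real) \<Rightarrow> (nat \<Rightarrow> 'w measure) \<Rightarrow>
   (nat \<Rightarrow> nat set \<Rightarrow> (nat \<Rightarrow> nat) \<Rightarrow> 'w \<Rightarrow> real) \<Rightarrow> bool" where
  "gaussian_disorder n a \<gamma> M X \<longleftrightarrow>
     (\<forall>N>0. prob_space (M N) \<and>
        prob_space.indep_vars (M N) (\<lambda>_. borel) (\<lambda>(J, \<tau>). X N J \<tau>)
          (SIGMA J:active a {1..n}. configs \<gamma> N J) \<and>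
        (\<forall>J\<in>active a {1..n}. \<forall>\<tau>\<in>configs \<gamma> N J.
           distributed (M N) lborel (X N J \<tau>)
             (\<lambda>x. ennreal (normal_density 0 (sqrt (a J * real N)) x))))"

text \<open>In the following four definitions \<open>Y\<close> is the disorder \<open>X N\<close> for one fixed \<open>N\<close>.\<close>

definition hamiltonian ::
  "nat \<Rightarrow> (nat set \<Rightarrow> real) \<Rightarrow> (nat set \<Rightarrow> (nat \<Rightarrow> nat) \<Rightarrow> 'w \<Rightarrow> real) \<Rightarrow>
   (nat \<Rightarrow> nat) \<Rightarrow> 'w \<Rightarrow> real" where
  "hamiltonian n a Y \<sigma> \<omega> = (\<Sum>J\<in>active a {1..n}. Y J (restrict \<sigma> J) \<omega>)"

definition gibbs ::
  "nat \<Rightarrow> (nat set \<Rightarrow> real) \<Rightarrow> (nat \<Rightarrow> real) \<Rightarrow> nat \<Rightarrow>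
   (nat set \<Rightarrow> (nat \<Rightarrow> nat) \<Rightarrow> 'w \<Rightarrow> real) \<Rightarrow> real \<Rightarrow> 'w \<Rightarrow> (nat \<Rightarrow> nat) \<Rightarrow> real" where
  "gibbs n a \<gamma> N Y \<beta> \<omega> \<sigma> =
     exp (\<beta> * hamiltonian n a Y \<sigma> \<omega>) /
     (\<Sum>\<tau>\<in>configs \<gamma> N {1..n}. exp (\<beta> * hamiltonian n a Y \<tau> \<omega>))"

definition gibbs_avg3 ::
  "nat \<Rightarrow> (nat set \<Rightarrow> real) \<Rightarrow> (nat \<Rightarrow> real) \<Rightarrow> nat \<Rightarrow>
   (nat set \<Rightarrow> (nat \<Rightarrow> nat) \<Rightarrow> 'w \<Rightarrow> real) \<Rightarrow> real \<Rightarrow> 'w \<Rightarrow>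
   ((nat \<Rightarrow> nat) \<Rightarrow> (nat \<Rightarrow> nat) \<Rightarrow> (nat \<Rightarrow> nat) \<Rightarrow> real) \<Rightarrow> real" where
  "gibbs_avg3 n a \<gamma> N Y \<beta> \<omega> f =
     (\<Sum>\<sigma>\<in>configs \<gamma> N {1..n}. \<Sum>\<sigma>'\<in>configs \<gamma> N {1..n}. \<Sum>\<sigma>''\<in>configs \<gamma> N {1..n}.
        gibbs n a \<gamma> N Y \<beta> \<omega> \<sigma> * gibbs n a \<gamma> N Y \<beta> \<omega> \<sigma>' * gibbs n a \<gamma> N Y \<beta> \<omega> \<sigma>'' * f \<sigma> \<sigma>' \<sigma>'')"

definition cdist ::
  "nat \<Rightarrow> (nat set \<Rightarrow> real) \<Rightarrow> 'w measure \<Rightarrow> (nat set \<Rightarrow> (nat \<Rightarrow> nat) \<Rightarrow> 'w \<Rightarrow> real) \<Rightarrow>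
   (nat \<Rightarrow> nat) \<Rightarrow> (nat \<Rightarrow> nat) \<Rightarrow> real" where
  "cdist n a P Y \<sigma> \<sigma>' =
     sqrt (\<integral>\<omega>. (hamiltonian n a Y \<sigma> \<omega> - hamiltonian n a Y \<sigma>' \<omega>)\<^sup>2 \<partial>P)"

definition rho :: "(nat set \<Rightarrow> real) \<Rightarrow> (nat \<Rightarrow> real) \<Rightarrow> nat set \<Rightarrow> nat set \<Rightarrow> ereal" where
  "rho a \<gamma> B A =
     (if alpha a A - alpha a B = 0 then \<infinity>
      else ereal (sqrt (2 * ln 2 * ((gam \<gamma> A - gam \<gamma> B) / (alpha a A - alpha a B)))))"

definition next_beta ::
  "nat \<Rightarrow> (nat set \<Rightarrow> real) \<Rightarrow> (nat \<Rightarrow> real) \<Rightarrow> nat set \<Rightarrow> ereal" where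
  "next_beta n a \<gamma> B = Min (rho a \<gamma> B ` {A. B \<subset> A \<and> A \<subseteq> {1..n}})"

text \<open>
  Since \<open>\<le>\<close> on sets is inclusion, \<open>GREATEST\<close> picks the largest minimizer for inclusion.  Once the
  chain has reached \<open>{1..n}\<close> it is continued as a constant.
\<close>

primrec chain :: "nat \<Rightarrow> (nat set \<Rightarrow> real) \<Rightarrow> (nat \<Rightarrow> real) \<Rightarrow> nat \<Rightarrow> nat set" where
  "chain n a \<gamma> 0 = {}"
| "chain n a \<gamma> (Suc j) =
     (if chain n a \<gamma> j = {1..n} then {1..n}
      else (GREATEST A. chain n a \<gamma> j \<subset> A \<and> A \<subseteq> {1..n} \<and>
              rho a \<gamma> (chain n a \<gamma> j) A = next_beta n a \<gamma> (chain n a \<gamma> j)))"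

definition chain_length :: "nat \<Rightarrow> (nat set \<Rightarrow> real) \<Rightarrow> (nat \<Rightarrow> real) \<Rightarrow> nat" where
  "chain_length n a \<gamma> = (LEAST k. chain n a \<gamma> k = {1..n})"

definition irreducible_hamiltonian ::
  "nat \<Rightarrow> (nat set \<Rightarrow> real) \<Rightarrow> (nat \<Rightarrow> real) \<Rightarrow> bool" where
  "irreducible_hamiltonian n a \<gamma> \<longleftrightarrow>
     (\<forall>j\<in>{1..chain_length n a \<gamma>}. \<forall>A.
        A \<subset> chain n a \<gamma> j - chain n a \<gamma> (j - 1) \<and>
        active a (A \<union> chain n a \<gamma> (j - 1)) - active a (chain n a \<gamma> (j - 1)) \<noteq> {} \<longrightarrow>
        (\<exists>J \<in> active a (chain n a \<gamma> j) - active a (A \<union> chain n a \<gamma> (j - 1)).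
         \<exists>J' \<in> active a (A \<union> chain n a \<gamma> (j - 1)) - active a (chain n a \<gamma> (j - 1)).
           (J \<inter> J') - chain n a \<gamma> (j - 1) \<noteq> {})) \<and>
     (\<forall>j\<in>{2..chain_length n a \<gamma>}.
        \<exists>s \<in> chain n a \<gamma> (j - 1) - chain n a \<gamma> (j - 2).
        \<exists>J \<in> active a (chain n a \<gamma> j) - active a (chain n a \<gamma> (j - 1)). s \<in> J)"

end

theory Submission
  imports Defs "HOL-Real_Asymp.Real_Asymp"
begin

text \<open>
  Give a bond \<open>J\<close> with \<open>J \<subseteq> A\<^sub>j\<close> but not \<open>J \<subseteq> A\<^sub>j\<^sub>-\<^sub>1\<close> the weight \<open>b J = \<beta>\<^sub>j\<close>, and put
  \<open>h A = 2 ln 2 \<gamma>(A) - (\<Sum>J \<subseteq> A. a J b J\<^sup>2)\<close>.  This function is nonnegative and submodular and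
  vanishes along the chain.

  First moments with the linear functionals \<open>\<Sum>J \<subseteq> A\<^sub>k. b J X\<^sup>J\<close>, together with a second moment lower
  bound for the partition function, show that under the Gibbs measure every \<open>X\<^sup>J / N\<close> concentrates at
  \<open>a J b J\<close> as soon as \<open>\<beta> \<ge> \<beta>\<^sub>K\<close>.  Counting pairs then forces the overlap set
  \<open>{i. \<sigma> i = \<sigma>' i}\<close> into the zeros of \<open>h\<close>.  This cannot decide between the zeros of \<open>h\<close>, which may
  differ in polynomial orders only.  Gaussian integration by parts does: it turns the concentration of
  \<open>X\<^sup>J / N\<close> into \<open>P(J \<subseteq> overlap) \<rightarrow> 1 - b J / \<beta>\<close>, so all bonds and sites of one level have the same
  asymptotic overlap probability.  Hence a site of the overlap takes with it every bond of its own
  level through it, and irreducibility leaves only the sets of the chain as overlap sets.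
\<close>

section \<open>The chain and its critical function\<close>

text \<open>The slopes of the chain balance entropy against Gaussian cost. This makes tilting every
  bond by its own \<open>bcrit\<close> exactly critical: the tilted weights, summed over all
  configurations, have mean at most one. Once \<beta> reaches the last critical value, a Gibbs
  weight is at most the tilted weight up to a factor that is subexponential in \<open>N\<close>.
  Gibbs averages are then bounded by plain Gaussian first moments, without any description of the
  ground states. The price is that factor: only events of exponentially small tilted mass are
  excluded, and for pairs whose overlap set is a zero of \<open>h\<close> the bound gives no decay
  at all. Integration by parts is exact at fixed size and needs only the mean of
  \<open>X\<^sup>J / N\<close>, so the lost factor does no harm there. It yields an identity for
  bonds, not for sites. Sites are reached through the lattice of zeros of \<open>h\<close>: the
  smallest zero around a site contains a bond through it of the same level, as otherwise removing
  the site would make \<open>h\<close> negative.\<close>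

lemma gam_modular:
  "finite A \<Longrightarrow> finite B \<Longrightarrow> gam \<gamma> (A \<union> B) + gam \<gamma> (A \<inter> B) = gam \<gamma> A + gam \<gamma> B"
  unfolding gam_def by (rule sum.union_inter)

lemma finite_active: "finite A \<Longrightarrow> finite (active a A)"
  unfolding active_def by (rule finite_subset[of _ "Pow A"]) auto

lemma active_mono: "A \<subseteq> B \<Longrightarrow> active a A \<subseteq> active a B"
  unfolding active_def by auto

text \<open>A bond inside \<open>A\<close> or inside \<open>B\<close> is inside the union, and it is
  inside both exactly when it is inside the intersection. The union can only gain bonds that
  straddle the two sets.\<close>

lemma sum_active_supermodular:
  assumes "finite A" "finite B" "\<And>J. J \<in> active a (A \<union> B) \<Longrightarrow> c J \<ge> (0::real)"
  shows "sum c (active a A) + sum c (active a B)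
    \<le> sum c (active a (A \<union> B)) + sum c (active a (A \<inter> B))"
proof -
  have "active a A \<inter> active a B = active a (A \<inter> B)" by (auto simp: active_def)
  then have "sum c (active a A \<union> active a B) + sum c (active a (A \<inter> B))
      = sum c (active a A) + sum c (active a B)"
    using sum.union_inter[of "active a A" "active a B" c] assms by (simp add: finite_active)
  moreover have "sum c (active a A \<union> active a B) \<le> sum c (active a (A \<union> B))"
    by (rule sum_mono2) (use assms in \<open>auto simp: active_def\<close>)
  ultimately show ?thesis by linarith
qed

lemma alpha_supermodular:
  "finite A \<Longrightarrow> finite B \<Longrightarrow> alpha a A + alpha a B \<le> alpha a (A \<union> B) + alpha a (A \<inter> B)"
  unfolding alpha_def by (rule sum_active_supermodular) (auto simp: active_def)

lemma alpha_mono: "A \<subseteq> B \<Longrightarrow> finite B \<Longrightarrow> alpha a A \<le> alpha a B"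
  unfolding alpha_def by (rule sum_mono2) (auto simp: active_def finite_active)

lemma union_closed_has_greatest:
  assumes "finite \<A>" "\<A> \<noteq> {}" "\<And>A B. A \<in> \<A> \<Longrightarrow> B \<in> \<A> \<Longrightarrow> A \<union> B \<in> \<A>"
  shows "\<exists>G\<in>\<A>. \<forall>A\<in>\<A>. A \<subseteq> G"
proof -
  obtain G where G: "G \<in> \<A>" "\<And>A. A \<in> \<A> \<Longrightarrow> G \<subseteq> A \<Longrightarrow> A = G"
    using finite_has_maximal[OF assms(1,2)] by (metis (no_types, lifting))
  have "A \<subseteq> G" if "A \<in> \<A>" for A
    using G(2)[OF assms(3)[OF that G(1)]] by auto
  with G show ?thesis by blast
qed

section \<open>The recursion step and the slopes of the chain\<close>

locale weights =
  fixes n :: nat and a :: "nat set \<Rightarrow> real" and \<gamma> :: "nat \<Rightarrow> real"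
  assumes \<gamma>_pos: "\<And>i. i \<in> {1..n} \<Longrightarrow> \<gamma> i > 0"
    and a_empty: "a {} = 0"
    and covered: "\<And>i. i \<in> {1..n} \<Longrightarrow> \<exists>J\<in>active a {1..n}. i \<in> J"
begin

abbreviation I :: "nat set" where "I \<equiv> {1..n}"

declare One_nat_def [simp del] chain.simps(2) [simp del]

abbreviation Ch :: "nat \<Rightarrow> nat set" where "Ch \<equiv> chain n a \<gamma>"

lemma gam_strict_mono:
  assumes "B \<subset> A" "A \<subseteq> I" shows "gam \<gamma> B < gam \<gamma> A"
proof -
  from assms obtain i where i: "i \<in> A - B" by auto
  have pos: "\<gamma> x > 0" if "x \<in> A" for x using \<gamma>_pos that assms(2) by blast
  show ?thesis
    unfolding gam_def
    by (rule sum_strict_mono2[where b = i])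
      (use assms i pos in \<open>auto intro: less_imp_le finite_subset\<close>)
qed

lemma alpha_less_top:
  assumes "B \<subset> I" shows "alpha a B < alpha a I"
proof -
  obtain i where i: "i \<in> I" "i \<notin> B" using assms by blast
  obtain J where J: "J \<in> active a I" "i \<in> J" using covered[OF i(1)] by auto
  show ?thesis unfolding alpha_def
    by (rule sum_strict_mono2[where b = J])
      (use i J assms in \<open>auto simp: active_def finite_active\<close>)
qed

text \<open>This is \<open>rho\<close> squared and divided by \<open>2 * ln 2\<close>, for a
  nonvanishing denominator. It keeps square roots and infinite values out of the arguments about the
  chain.\<close>

definition slope :: "nat set \<Rightarrow> nat set \<Rightarrow> real" where
  "slope B A = (gam \<gamma> A - gam \<gamma> B) / (alpha a A - alpha a B)"

text \<open>With \<open>s\<close> the minimal slope, \<open>gam - s * alpha\<close> measured from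
  \<open>B\<close> is nonnegative on the sets containing \<open>B\<close>, and it is submodular
  because \<open>gam\<close> is modular and \<open>alpha\<close> supermodular. Its zeros other than
  \<open>B\<close> are the minimizers; they are closed under union, so a largest one exists and
  \<open>GREATEST\<close> denotes it. The last inequality is strict because any set attaining
  equality lies inside \<open>G\<close>.\<close>

lemma next_set:
  assumes "B \<subset> I"
  defines "G \<equiv> GREATEST A. B \<subset> A \<and> A \<subseteq> I \<and> rho a \<gamma> B A = next_beta n a \<gamma> B"
  shows "B \<subset> G" "G \<subseteq> I" "alpha a B < alpha a G"
    and "\<And>A. B \<subseteq> A \<Longrightarrow> A \<subseteq> I \<Longrightarrow>
      slope B G * (alpha a A - alpha a B) \<le> gam \<gamma> A - gam \<gamma> B"
    and "\<And>A. B \<subseteq> A \<Longrightarrow> A \<subseteq> I \<Longrightarrow> \<not> A \<subseteq> G \<Longrightarrow>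
      slope B G * (alpha a A - alpha a B) < gam \<gamma> A - gam \<gamma> B"
proof -
  define S where "S = {A. B \<subset> A \<and> A \<subseteq> I}"
  have S: "finite S" "I \<in> S" using assms(1) by (auto simp: S_def)
  define m where "m = next_beta n a \<gamma> B"
  have m_Min: "m = Min (rho a \<gamma> B ` S)" by (simp add: m_def next_beta_def S_def)
  have "m \<in> rho a \<gamma> B ` S" unfolding m_Min by (rule Min_in) (use S in auto)
  then obtain A0 where A0: "A0 \<in> S" "rho a \<gamma> B A0 = m" by auto
  have le: "m \<le> rho a \<gamma> B A" if "A \<in> S" for A
    unfolding m_Min by (rule Min_le) (use S that in auto)
  have alpha_ge: "alpha a B \<le> alpha a A" if "A \<in> S" for A
    using that by (intro alpha_mono) (auto simp: S_def finite_subset)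
  have g_pos: "gam \<gamma> B < gam \<gamma> A" if "A \<in> S" for A
    using that by (auto simp: S_def intro: gam_strict_mono)
  \<comment> \<open>Covering makes \<open>alpha\<close> strictly larger at \<open>I\<close>, so the
    minimum of \<open>rho\<close> is finite and no minimizer has a vanishing denominator.\<close>
  have "rho a \<gamma> B I < \<infinity>" using alpha_less_top[OF assms(1)] by (simp add: rho_def)
  then have "rho a \<gamma> B A0 < \<infinity>" using le[OF S(2)] A0(2) by auto
  then have A0_alpha: "alpha a B < alpha a A0"
    using alpha_ge[OF A0(1)] by (auto simp: rho_def split: if_splits)
  define s where "s = slope B A0"
  have s_pos: "s > 0" using A0_alpha g_pos[OF A0(1)] by (simp add: s_def slope_def)
  have m_s: "m = ereal (sqrt (2 * ln 2 * s))"
    using A0 A0_alpha by (simp add: rho_def s_def slope_def)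
  have ineq: "s * (alpha a A - alpha a B) \<le> gam \<gamma> A - gam \<gamma> B" if "A \<in> S" for A
  proof (cases "alpha a A = alpha a B")
    case True then show ?thesis using g_pos[OF that] by simp
  next
    case False
    then have pos: "alpha a A - alpha a B > 0" using alpha_ge[OF that] by simp
    have "sqrt (2 * ln 2 * s) \<le> sqrt (2 * ln 2 * ((gam \<gamma> A - gam \<gamma> B) / (alpha a A - alpha a B)))"
      using le[OF that] False by (simp add: m_s rho_def)
    then have "2 * ln 2 * s \<le> 2 * ln 2 * ((gam \<gamma> A - gam \<gamma> B) / (alpha a A - alpha a B))"
      by (simp only: real_sqrt_le_iff)
    then have "s \<le> (gam \<gamma> A - gam \<gamma> B) / (alpha a A - alpha a B)"
      by (rule mult_left_le_imp_le) simp
    then show ?thesis using pos by (simp add: pos_le_divide_eq)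
  qed
  have eq: "rho a \<gamma> B A = m \<longleftrightarrow> s * (alpha a A - alpha a B) = gam \<gamma> A - gam \<gamma> B" if "A \<in> S" for A
  proof (cases "alpha a A = alpha a B")
    case True then show ?thesis using g_pos[OF that] by (auto simp: m_s rho_def)
  next
    case False
    then have "rho a \<gamma> B A = m \<longleftrightarrow>
        2 * ln 2 * ((gam \<gamma> A - gam \<gamma> B) / (alpha a A - alpha a B)) = 2 * ln 2 * s"
      by (simp only: m_s rho_def real_sqrt_eq_iff ereal.inject if_False right_minus_eq)
    also have "\<dots> \<longleftrightarrow> (gam \<gamma> A - gam \<gamma> B) / (alpha a A - alpha a B) = s"
      by (subst mult_cancel_left) simp
    finally show ?thesis using False by (auto simp: field_simps)
  qed
  define Z where "Z = {A\<in>S. rho a \<gamma> B A = m}"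
  have union: "A \<union> A' \<in> Z" if "A \<in> Z" "A' \<in> Z" for A A'
  proof -
    have fin: "finite A" "finite A'" "B \<subseteq> A \<inter> A'" "A \<inter> A' \<subseteq> I"
      using that by (auto simp: Z_def S_def finite_subset)
    have un: "A \<union> A' \<in> S" using that by (auto simp: Z_def S_def)
    \<comment> \<open>The intersection may be \<open>B\<close> itself, which is not in
      \<open>S\<close>; both sides are then zero.\<close>
    have i: "s * (alpha a (A \<inter> A') - alpha a B) \<le> gam \<gamma> (A \<inter> A') - gam \<gamma> B"
    proof (cases "A \<inter> A' = B")
      case False
      then have "A \<inter> A' \<in> S" using fin by (auto simp: S_def)
      then show ?thesis by (rule ineq)
    qed simp
    have "s * (alpha a A - alpha a B) = gam \<gamma> A - gam \<gamma> B"
      "s * (alpha a A' - alpha a B) = gam \<gamma> A' - gam \<gamma> B" using that eq by (auto simp: Z_def)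
    moreover have "s * (alpha a A + alpha a A') \<le> s * (alpha a (A \<union> A') + alpha a (A \<inter> A'))"
      using s_pos alpha_supermodular[OF fin(1,2)] by (intro mult_left_mono) auto
    ultimately have "s * (alpha a (A \<union> A') - alpha a B) \<ge> gam \<gamma> (A \<union> A') - gam \<gamma> B"
      using i gam_modular[OF fin(1,2), of \<gamma>] by (simp add: algebra_simps)
    with ineq[OF un] eq[OF un] un show ?thesis by (auto simp: Z_def)
  qed
  have "\<exists>G\<in>Z. \<forall>A\<in>Z. A \<subseteq> G"
    by (rule union_closed_has_greatest) (use S A0 union in \<open>auto simp: Z_def\<close>)
  then obtain G' where G': "G' \<in> Z" "\<And>A. A \<in> Z \<Longrightarrow> A \<subseteq> G'" by blast
  have "G = G'" unfolding G_def
    by (rule Greatest_equality) (use G' in \<open>auto simp: Z_def S_def m_def\<close>)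
  then have G: "G \<in> S" "\<And>A. A \<in> Z \<Longrightarrow> A \<subseteq> G"
      "s * (alpha a G - alpha a B) = gam \<gamma> G - gam \<gamma> B"
    using G' eq by (auto simp: Z_def)
  then show "B \<subset> G" "G \<subseteq> I" by (auto simp: S_def)
  have "alpha a G \<noteq> alpha a B" using G g_pos[OF G(1)] by auto
  then show aG: "alpha a B < alpha a G" using alpha_ge[OF G(1)] by simp
  have s: "slope B G = s" using G(3) aG by (simp add: slope_def field_simps)
  show "slope B G * (alpha a A - alpha a B) \<le> gam \<gamma> A - gam \<gamma> B" if "B \<subseteq> A" "A \<subseteq> I" for A
    by (cases "A = B") (use ineq that in \<open>auto simp: S_def s\<close>)
  show "slope B G * (alpha a A - alpha a B) < gam \<gamma> A - gam \<gamma> B"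
    if "B \<subseteq> A" "A \<subseteq> I" "\<not> A \<subseteq> G" for A
  proof -
    have "A \<in> S" using that \<open>B \<subset> G\<close> by (auto simp: S_def)
    then show ?thesis using ineq[of A] eq[of A] G(2)[of A] that
      by (force simp: s Z_def)
  qed
qed

abbreviation K :: nat where "K \<equiv> chain_length n a \<gamma>"

lemma Ch_subset: "Ch j \<subseteq> I"
proof (induction j)
  case (Suc j)
  show ?case
    by (cases "Ch j = I") (use next_set(2)[of "Ch j"] Suc in \<open>auto simp: chain.simps(2)\<close>)
qed auto

lemma Ch_step: "Ch j \<noteq> I \<Longrightarrow> Ch j \<subset> Ch (Suc j)"
  using next_set(1)[of "Ch j"] Ch_subset[of j] by (auto simp: chain.simps(2))

lemma Ch_mono: "j \<le> k \<Longrightarrow> Ch j \<subseteq> Ch k"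
proof (induction rule: dec_induct)
  case (step m)
  then show ?case using Ch_step[of m] by (cases "Ch m = I") (auto simp: chain.simps(2))
qed auto

lemma finite_Ch [simp]: "finite (Ch j)"
  using Ch_subset finite_subset by blast

text \<open>Every step adds an index until the chain reaches \<open>I\<close>, so cardinality forces
  termination within \<open>Suc n\<close> steps.\<close>

lemma Ch_K: "Ch K = I"
  and Ch_less_K: "j < K \<Longrightarrow> Ch j \<subset> I"
proof -
  have "card (Ch j) \<ge> j \<or> Ch j = I" for j
  proof (induction j)
    case (Suc j)
    show ?case
    proof (cases "Ch j = I")
      case False
      then show ?thesis using Suc psubset_card_mono[OF _ Ch_step[of j]] by auto
    qed (simp add: chain.simps(2))
  qed auto
  moreover have "card (Ch (Suc n)) \<le> n"
    using card_mono[OF _ Ch_subset[of "Suc n"]] by auto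
  ultimately have ex: "Ch (Suc n) = I" by (metis Suc_n_not_le_n order_trans)
  show "Ch K = I" unfolding chain_length_def using ex by (rule LeastI)
  show "Ch j \<subset> I" if "j < K" for j
    using not_less_Least[OF that[unfolded chain_length_def]] Ch_subset[of j] by auto
qed

text \<open>The critical inverse temperature of step \<open>j\<close> is \<open>sqrt (2 * ln 2 * sl j)\<close>.\<close>

definition sl :: "nat \<Rightarrow> real" where "sl j = slope (Ch (j - 1)) (Ch j)"

lemma sl_step:
  assumes "j \<in> {1..K}"
  shows "Ch (j - 1) \<subset> Ch j" "alpha a (Ch (j - 1)) < alpha a (Ch j)"
    and "sl j * (alpha a (Ch j) - alpha a (Ch (j - 1))) = gam \<gamma> (Ch j) - gam \<gamma> (Ch (j - 1))"
    and "\<And>A. Ch (j - 1) \<subseteq> A \<Longrightarrow> A \<subseteq> I \<Longrightarrow>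
      sl j * (alpha a A - alpha a (Ch (j - 1))) \<le> gam \<gamma> A - gam \<gamma> (Ch (j - 1))"
    and "\<And>A. Ch (j - 1) \<subseteq> A \<Longrightarrow> A \<subseteq> I \<Longrightarrow> \<not> A \<subseteq> Ch j \<Longrightarrow>
      sl j * (alpha a A - alpha a (Ch (j - 1))) < gam \<gamma> A - gam \<gamma> (Ch (j - 1))"
proof -
  have lt: "Ch (j - 1) \<subset> I" using assms by (intro Ch_less_K) auto
  have eq: "Ch j = (GREATEST A. Ch (j - 1) \<subset> A \<and> A \<subseteq> I \<and>
      rho a \<gamma> (Ch (j - 1)) A = next_beta n a \<gamma> (Ch (j - 1)))"
    using assms lt by (cases j) (auto simp: chain.simps(2))
  note ns = next_set[OF lt, folded eq]
  show "Ch (j - 1) \<subset> Ch j" "alpha a (Ch (j - 1)) < alpha a (Ch j)" by fact+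
  then show "sl j * (alpha a (Ch j) - alpha a (Ch (j - 1))) = gam \<gamma> (Ch j) - gam \<gamma> (Ch (j - 1))"
    by (simp add: sl_def slope_def)
  show "\<And>A. Ch (j - 1) \<subseteq> A \<Longrightarrow> A \<subseteq> I \<Longrightarrow>
      sl j * (alpha a A - alpha a (Ch (j - 1))) \<le> gam \<gamma> A - gam \<gamma> (Ch (j - 1))"
    unfolding sl_def by fact
  show "\<And>A. Ch (j - 1) \<subseteq> A \<Longrightarrow> A \<subseteq> I \<Longrightarrow> \<not> A \<subseteq> Ch j \<Longrightarrow>
      sl j * (alpha a A - alpha a (Ch (j - 1))) < gam \<gamma> A - gam \<gamma> (Ch (j - 1))"
    unfolding sl_def by fact
qed

lemma sl_pos: "j \<in> {1..K} \<Longrightarrow> sl j > 0"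
  using sl_step(1,2)[of j] gam_strict_mono[of "Ch (j - 1)" "Ch j"] Ch_subset[of j]
  by (auto simp: sl_def slope_def)

text \<open>The set \<open>Ch (Suc j)\<close> competes at step \<open>j\<close> and loses strictly,
  since the largest minimizer \<open>Ch j\<close> does not contain it. Subtracting the equality for
  \<open>Ch j\<close> leaves the comparison of the two slopes.\<close>

lemma sl_less_Suc:
  assumes "j \<in> {1..<K}" shows "sl j < sl (Suc j)"
proof -
  have j: "j \<in> {1..K}" "Suc j \<in> {1..K}" using assms by auto
  note s1 = sl_step[OF j(1)] and s2 = sl_step[OF j(2), simplified]
  have "sl j * (alpha a (Ch (Suc j)) - alpha a (Ch (j - 1))) < gam \<gamma> (Ch (Suc j)) - gam \<gamma> (Ch (j - 1))"
    by (rule s1(5)) (use s1(1) s2(1) Ch_subset[of "Suc j"] in \<open>auto\<close>)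
  then have "sl j * (alpha a (Ch (Suc j)) - alpha a (Ch j)) < gam \<gamma> (Ch (Suc j)) - gam \<gamma> (Ch j)"
    using s1(3) by (simp add: algebra_simps)
  also have "\<dots> = sl (Suc j) * (alpha a (Ch (Suc j)) - alpha a (Ch j))"
    using sl_step(3)[OF j(2)] by simp
  finally show ?thesis using sl_step(2)[OF j(2)] by simp
qed

section \<open>Levels of bonds and sites, and the zeros of the critical function\<close>

definition level :: "nat set \<Rightarrow> nat" where "level J = (LEAST j. J \<subseteq> Ch j)"

lemma level_le_iff: "J \<subseteq> I \<Longrightarrow> level J \<le> k \<longleftrightarrow> J \<subseteq> Ch k"
proof
  assume "J \<subseteq> I"
  then have "J \<subseteq> Ch K" by (simp add: Ch_K)
  then have "J \<subseteq> Ch (level J)" unfolding level_def by (rule LeastI)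
  then show "J \<subseteq> Ch k" if "level J \<le> k" using Ch_mono[OF that] by auto
  show "level J \<le> k" if "J \<subseteq> Ch k" unfolding level_def using that by (rule Least_le)
qed

lemma level_active:
  assumes "J \<in> active a I" shows "level J \<in> {1..K}" "J \<subseteq> Ch (level J)"
proof -
  have "J \<subseteq> I" "J \<noteq> {}" using assms a_empty by (auto simp: active_def)
  then show "level J \<in> {1..K}" "J \<subseteq> Ch (level J)"
    using level_le_iff[of J K] level_le_iff[of J 0] level_le_iff[of J "level J"] Ch_K
    by auto
qed

definition bcrit :: "nat set \<Rightarrow> real" where "bcrit J = sqrt (2 * ln 2 * sl (level J))"

text \<open>\<open>N * V A\<close> is the variance of the sum of \<open>bcrit J\<close> times the
  bond variable over the bonds inside \<open>A\<close>.\<close>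

definition V :: "nat set \<Rightarrow> real" where "V A = (\<Sum>J\<in>active a A. a J * (bcrit J)\<^sup>2)"

lemma V_eq:
  assumes "A \<subseteq> I" shows "V A = 2 * ln 2 * (\<Sum>J\<in>active a A. a J * sl (level J))"
proof -
  have "a J * (bcrit J)\<^sup>2 = 2 * ln 2 * (a J * sl (level J))" if "J \<in> active a A" for J
  proof -
    have "sl (level J) > 0" using sl_pos[OF level_active(1)] that active_mono[OF assms] by blast
    then show ?thesis by (simp add: bcrit_def)
  qed
  then show ?thesis unfolding V_def sum_distrib_left by (intro sum.cong) auto
qed

text \<open>\<open>h A / 2\<close> is the exponential rate of the mean number of partial
  configurations on \<open>A\<close> whose bonds all reach the energy
  \<open>N * a J * bcrit J\<close>: the entropy \<open>ln 2 * gam \<gamma> A\<close> minus the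
  Gaussian cost \<open>V A / 2\<close>.\<close>

definition h :: "nat set \<Rightarrow> real" where "h A = 2 * ln 2 * gam \<gamma> A - V A"

text \<open>Passing from \<open>Ch (j - 1)\<close> to \<open>Ch j\<close> adds only bonds of level
  exactly \<open>j\<close>, all carrying the factor \<open>sl j\<close>. For the inequality, a bond
  gained inside \<open>A \<inter> Ch j\<close> is also gained when this set is joined to the whole
  of \<open>Ch (j - 1)\<close>.\<close>

lemma level_sum_step:
  assumes "A \<subseteq> I" "j \<in> {1..K}"
  defines "U \<equiv> \<lambda>A. \<Sum>J\<in>active a A. a J * sl (level J)"
  shows "U (A \<inter> Ch j) \<le> U (A \<inter> Ch (j - 1))
      + sl j * (alpha a (A \<inter> Ch j \<union> Ch (j - 1)) - alpha a (Ch (j - 1)))"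
    and "U (Ch j) = U (Ch (j - 1)) + sl j * (alpha a (Ch j) - alpha a (Ch (j - 1)))"
proof -
  have fin [simp]: "finite (active a (B \<inter> Ch k))" "finite (active a (Ch k))"
    "finite (active a (B \<inter> Ch k \<union> Ch l))" for B k l
    by (auto simp: finite_active)
  have sub: "active a (B \<inter> Ch (j - 1)) \<subseteq> active a (B \<inter> Ch j)" for B
    using Ch_mono[of "j - 1" j] by (intro active_mono) auto
  have lev: "level J = j" if "J \<in> active a (B \<inter> Ch j) - active a (B \<inter> Ch (j - 1))" for B J
  proof -
    have "J \<subseteq> Ch j" "\<not> J \<subseteq> Ch (j - 1)" "J \<subseteq> I"
      using that Ch_subset[of j] by (auto simp: active_def)
    then show ?thesis using level_le_iff[of J j] level_le_iff[of J "j - 1"] assms(2) by auto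
  qed
  have diff: "U (B \<inter> Ch j) = U (B \<inter> Ch (j - 1))
      + sl j * sum a (active a (B \<inter> Ch j) - active a (B \<inter> Ch (j - 1)))" for B
  proof -
    have "(\<Sum>J\<in>active a (B \<inter> Ch j) - active a (B \<inter> Ch (j - 1)). a J * sl (level J))
        = (\<Sum>J\<in>active a (B \<inter> Ch j) - active a (B \<inter> Ch (j - 1)). sl j * a J)"
      by (rule sum.cong) (simp_all add: lev[of _ B])
    then show ?thesis
      unfolding U_def sum.subset_diff[OF sub fin(1)] by (simp add: sum_distrib_left)
  qed
  have "sum a (active a (A \<inter> Ch j) - active a (A \<inter> Ch (j - 1)))
      \<le> sum a (active a (A \<inter> Ch j \<union> Ch (j - 1)) - active a (Ch (j - 1)))"
    by (rule sum_mono2) (auto simp: active_def)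
  also have "\<dots> = alpha a (A \<inter> Ch j \<union> Ch (j - 1)) - alpha a (Ch (j - 1))"
    unfolding alpha_def by (rule sum_diff) (auto simp: active_def)
  finally show "U (A \<inter> Ch j) \<le> U (A \<inter> Ch (j - 1))
      + sl j * (alpha a (A \<inter> Ch j \<union> Ch (j - 1)) - alpha a (Ch (j - 1)))"
    unfolding diff using sl_pos[OF assms(2)] by (simp add: mult_left_mono)
  have "sum a (active a (Ch j) - active a (Ch (j - 1))) = alpha a (Ch j) - alpha a (Ch (j - 1))"
    unfolding alpha_def using sub[of UNIV] by (intro sum_diff) auto
  with diff[of UNIV] show "U (Ch j) = U (Ch (j - 1)) + sl j * (alpha a (Ch j) - alpha a (Ch (j - 1)))"
    by simp
qed

text \<open>Each step of the chain adds equal amounts to the two terms of \<open>h\<close>; this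
  balance is what defines \<open>sl\<close>.\<close>

lemma h_Ch: "k \<le> K \<Longrightarrow> h (Ch k) = 0"
proof (induction k)
  case 0
  then show ?case using a_empty by (simp add: h_def V_def active_def gam_def)
next
  case (Suc k)
  then show ?case
    using level_sum_step(2)[of "Ch k" "Suc k"] sl_step(3)[of "Suc k"] Ch_subset[of k]
    by (simp add: h_def V_eq Ch_subset algebra_simps)
qed

text \<open>Up to \<open>K\<close>, \<open>h (A \<inter> Ch k)\<close> is nondecreasing in
  \<open>k\<close>. Minimality of the slope bounds the bonds gained when the next slice of
  \<open>A\<close> is joined to all of \<open>Ch k\<close>. Modularity gives the same entropy when
  the slice is joined to \<open>A \<inter> Ch k\<close> only, and then no more bonds are
  gained.\<close>

lemma h_nonneg:
  assumes "A \<subseteq> I" shows "h A \<ge> 0"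
proof -
  have "h (A \<inter> Ch k) \<ge> 0" if "k \<le> K" for k
    using that
  proof (induction k)
    case 0
    then show ?case using a_empty by (simp add: h_def V_def active_def gam_def)
  next
    case (Suc k)
    define B where "B = A \<inter> Ch (Suc k)"
    have k: "Suc k \<in> {1..K}" using Suc.prems by auto
    have B: "B \<inter> Ch k = A \<inter> Ch k" "finite B"
      using Ch_mono[of k "Suc k"] by (auto simp: B_def)
    have le: "sl (Suc k) * (alpha a (B \<union> Ch k) - alpha a (Ch k)) \<le> gam \<gamma> (B \<union> Ch k) - gam \<gamma> (Ch k)"
      using sl_step(4)[OF k, of "B \<union> Ch k"] Ch_subset[of k] assms
      by (auto simp: B_def)
    have "gam \<gamma> (B \<union> Ch k) + gam \<gamma> (A \<inter> Ch k) = gam \<gamma> B + gam \<gamma> (Ch k)"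
      using gam_modular[of B "Ch k" \<gamma>] B by simp
    then have "sl (Suc k) * (alpha a (B \<union> Ch k) - alpha a (Ch k)) \<le> gam \<gamma> B - gam \<gamma> (A \<inter> Ch k)"
      using le by linarith
    then have "(\<Sum>J\<in>active a B. a J * sl (level J)) \<le> (\<Sum>J\<in>active a (A \<inter> Ch k). a J * sl (level J))
        + (gam \<gamma> B - gam \<gamma> (A \<inter> Ch k))"
      using level_sum_step(1)[OF assms k] by (simp add: B_def)
    then have "2 * ln 2 * (\<Sum>J\<in>active a B. a J * sl (level J))
      \<le> 2 * ln 2 * ((\<Sum>J\<in>active a (A \<inter> Ch k). a J * sl (level J)) + (gam \<gamma> B - gam \<gamma> (A \<inter> Ch k)))"
      by (intro mult_left_mono) auto
    moreover have "B \<subseteq> I" "A \<inter> Ch k \<subseteq> I" using assms by (auto simp: B_def)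
    ultimately have "h (A \<inter> Ch k) \<le> h B"
      by (simp add: h_def V_eq algebra_simps)
    then show ?case using Suc by (simp add: B_def)
  qed
  from this[of K] show ?thesis using assms by (simp add: Ch_K Int_absorb2)
qed

lemma h_submodular:
  assumes "A \<subseteq> I" "B \<subseteq> I" shows "h (A \<union> B) + h (A \<inter> B) \<le> h A + h B"
proof -
  have fin: "finite A" "finite B" using assms finite_subset by blast+
  have "V A + V B \<le> V (A \<union> B) + V (A \<inter> B)"
    unfolding V_def by (rule sum_active_supermodular[OF fin]) (auto simp: active_def)
  with gam_modular[OF fin, of \<gamma>] show ?thesis
    by (simp add: h_def algebra_simps flip: distrib_left)
qed

text \<open>Zeros are the minimizers of a submodular function, and such minimizers form a
  lattice.\<close>

lemma h_zero_lattice: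
  assumes "A \<subseteq> I" "B \<subseteq> I" "h A = 0" "h B = 0"
  shows "h (A \<union> B) = 0" "h (A \<inter> B) = 0"
  using h_submodular[OF assms(1,2)] h_nonneg[of "A \<union> B"] h_nonneg[OF le_infI1[OF assms(1)], of B] assms
  by auto

lemma bcrit_pos: "J \<in> active a I \<Longrightarrow> bcrit J > 0"
  using sl_pos[OF level_active(1)] by (simp add: bcrit_def)

text \<open>
  With \<open>\<beta>\<^sub>K\<^sub>+\<^sub>1 = \<infinity>\<close>, the differences \<open>1 / \<beta>\<^sub>k - 1 / \<beta>\<^sub>k\<^sub>+\<^sub>1\<close> express the total energy as a positive
  combination of the functionals \<open>\<Sum>J \<subseteq> A\<^sub>k. b J X\<^sup>J\<close>, each of which is bounded by a first moment.
\<close>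

definition wt :: "nat \<Rightarrow> real" where
  "wt k = 1 / sqrt (2 * ln 2 * sl k) - (if k = K then 0 else 1 / sqrt (2 * ln 2 * sl (Suc k)))"

lemma wt_nonneg:
  assumes "k \<in> {1..K}" shows "wt k \<ge> 0"
proof (cases "k = K")
  case True then show ?thesis using sl_pos[of k] assms by (simp add: wt_def)
next
  case False
  then have "sl k < sl (Suc k)" "sl k > 0" using sl_less_Suc[of k] sl_pos[of k] assms by auto
  then show ?thesis using False by (auto simp: wt_def intro!: divide_left_mono mult_pos_pos)
qed

text \<open>The chain sets around \<open>J\<close> are those of index at least
  \<open>level J\<close>, and over these indices \<open>wt\<close> telescopes to
  \<open>1 / bcrit J\<close>.\<close>

lemma bcrit_wt:
  assumes "J \<in> active a I" shows "bcrit J * (\<Sum>k | k \<in> {1..K} \<and> J \<subseteq> Ch k. wt k) = 1"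
proof -
  have tele: "(\<Sum>k\<in>{l..K}. wt k) = 1 / sqrt (2 * ln 2 * sl l)" if "l \<le> K" for l
    using that
  proof (induction rule: inc_induct)
    case base show ?case by (simp add: wt_def)
  next
    case (step m)
    have "(\<Sum>k\<in>{m..K}. wt k) = wt m + (\<Sum>k\<in>{Suc m..K}. wt k)"
      using step by (intro sum.atLeast_Suc_atMost) auto
    then show ?case using step by (simp add: wt_def)
  qed
  have J: "J \<subseteq> I" using assms by (simp add: active_def)
  have "{k. k \<in> {1..K} \<and> J \<subseteq> Ch k} = {level J..K}"
    using level_active(1)[OF assms] unfolding level_le_iff[OF J, symmetric] by auto
  then show ?thesis
    using tele[of "level J"] level_active(1)[OF assms] sl_pos[OF level_active(1)[OF assms]]
    by (simp add: bcrit_def)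
qed

text \<open>Zeros of \<open>h\<close> are closed under intersection, so there is a smallest one,
  \<open>D\<close>, around \<open>i\<close>. Some bond inside \<open>D\<close> passes through
  \<open>i\<close>: otherwise deleting \<open>i\<close> from \<open>D\<close> lowers
  \<open>gam\<close> but not \<open>V\<close>, and \<open>h\<close> becomes negative. Every zero
  around \<open>i\<close> contains \<open>D\<close> and with it this bond.\<close>

lemma active_within_minimal_zero:
  assumes "i \<in> I"
  obtains J where "J \<in> active a I" "i \<in> J" "level J = level {i}"
    "\<And>A. A \<subseteq> I \<Longrightarrow> h A = 0 \<Longrightarrow> i \<in> A \<Longrightarrow> J \<subseteq> A"
proof -
  define \<D> where "\<D> = {A. A \<subseteq> I \<and> h A = 0 \<and> i \<in> A}"
  define D where "D = \<Inter>\<D>"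
  have I_zero: "I \<in> \<D>" using h_Ch[of K] assms by (simp add: \<D>_def Ch_K)
  have "finite \<D>" by (rule finite_subset[of _ "Pow I"]) (auto simp: \<D>_def)
  have "\<Inter>\<F> \<in> \<D>" if "finite \<F>" "\<F> \<noteq> {}" "\<F> \<subseteq> \<D>" for \<F>
    using that
  proof (induction rule: finite_ne_induct)
    case (insert F \<F>)
    then show ?case using h_zero_lattice(2)[of F "\<Inter>\<F>"] by (auto simp: \<D>_def)
  qed auto
  then have "D \<in> \<D>" using I_zero \<open>finite \<D>\<close> unfolding D_def by blast
  then have D: "D \<subseteq> I" "h D = 0" "i \<in> D" by (auto simp: \<D>_def)
  have min: "D \<subseteq> A" if "A \<subseteq> I" "h A = 0" "i \<in> A" for A using that by (auto simp: D_def \<D>_def)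
  have "\<exists>J\<in>active a D. i \<in> J"
  proof (rule ccontr)
    assume "\<not> ?thesis"
    then have "active a (D - {i}) = active a D" by (auto simp: active_def)
    then have "V (D - {i}) = V D" by (simp add: V_def)
    moreover have "gam \<gamma> (D - {i}) < gam \<gamma> D" using D by (intro gam_strict_mono) auto
    ultimately have "h (D - {i}) < h D" by (simp add: h_def)
    moreover have "h (D - {i}) \<ge> 0" using D by (intro h_nonneg) auto
    ultimately show False using D by simp
  qed
  then obtain J where J: "J \<in> active a D" "i \<in> J" by blast
  have JI: "J \<in> active a I" "J \<subseteq> D" using J D by (auto simp: active_def)
  have "J \<subseteq> I" using JI D by auto
  \<comment> \<open>Up to \<open>K\<close> the sets of the chain are zeros of \<open>h\<close>, so
    one that contains \<open>i\<close> contains \<open>D\<close> and hence \<open>J\<close>; beyond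
    \<open>K\<close> the chain is \<open>I\<close>.\<close>
  have lev: "level J \<le> k \<longleftrightarrow> level {i} \<le> k" for k
  proof -
    have "{i} \<subseteq> Ch k \<Longrightarrow> J \<subseteq> Ch k"
    proof (cases "k \<le> K")
      case True
      then show "{i} \<subseteq> Ch k \<Longrightarrow> J \<subseteq> Ch k"
        using min[of "Ch k"] h_Ch[of k] Ch_subset[of k] JI(2) by auto
    next
      case False
      then show "J \<subseteq> Ch k" using Ch_mono[of K k] Ch_K \<open>J \<subseteq> I\<close> by auto
    qed
    then show ?thesis using level_le_iff[of J k] level_le_iff[of "{i}" k] assms J(2) \<open>J \<subseteq> I\<close> by auto
  qed
  have "level J = level {i}" using lev[of "level J"] lev[of "level {i}"] by auto
  then show ?thesis using that[of J] JI J(2) min by blast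
qed

text \<open>A set outside the chain meets some slice \<open>Ch k - Ch (k - 1)\<close> without
  containing \<open>Ch k\<close>. Condition (c) treats a slice that is met only in part, condition
  (c') a full slice above a gap. Either way a bond leaves \<open>A\<close> although it passes
  through a site of \<open>A\<close> of its own level; equality of the overlap probabilities later
  rules this out.\<close>

lemma zero_outside_chain:
  assumes irr: "irreducible_hamiltonian n a \<gamma>" and A: "A \<subseteq> I" "h A = 0" "A \<notin> Ch ` {0..K}"
  obtains J i where "J \<in> active a I" "i \<in> J" "level J = level {i}" "i \<in> A" "\<not> J \<subseteq> A"
proof -
  define Q where "Q k \<longleftrightarrow> k \<in> {1..K} \<and> \<not> A \<inter> Ch k \<subseteq> Ch (k - 1) \<and> \<not> Ch k \<subseteq> A" for k
  have "\<exists>k. Q k"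
  proof (rule ccontr)
    assume none: "\<nexists>k. Q k"
    have "A \<inter> Ch k \<in> Ch ` {0..K}" if "k \<le> K" for k
      using that
    proof (induction k)
      case (Suc k)
      have "A \<inter> Ch (Suc k) \<subseteq> Ch k \<or> Ch (Suc k) \<subseteq> A"
        using none[unfolded not_ex, rule_format, of "Suc k"] Suc.prems by (auto simp: Q_def)
      then show ?case
      proof
        assume "A \<inter> Ch (Suc k) \<subseteq> Ch k"
        then have "A \<inter> Ch (Suc k) = A \<inter> Ch k" using Ch_mono[of k "Suc k"] by auto
        then show ?thesis using Suc by simp
      next
        assume "Ch (Suc k) \<subseteq> A"
        then have "A \<inter> Ch (Suc k) = Ch (Suc k)" by auto
        then show ?thesis using Suc.prems by simp
      qed
    qed (auto intro!: image_eqI[where x = 0])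
    from this[of K] show False using A by (auto simp: Ch_K Int_absorb2)
  qed
  define k where "k = (LEAST k. Q k)"
  have "Q k" unfolding k_def using \<open>\<exists>k. Q k\<close> by (rule LeastI_ex)
  then have k: "k \<in> {1..K}" "\<not> A \<inter> Ch k \<subseteq> Ch (k - 1)" "\<not> Ch k \<subseteq> A" by (auto simp: Q_def)
  have lev: "level J = k" if "J \<subseteq> Ch k" "\<not> J \<subseteq> Ch (k - 1)" for J
  proof -
    have "J \<subseteq> I" using that(1) Ch_subset[of k] by blast
    then show ?thesis using that level_le_iff[of J k] level_le_iff[of J "k - 1"] by auto
  qed
  define B where "B = A \<inter> Ch k - Ch (k - 1)"
  have B_un: "B \<union> Ch (k - 1) = (A \<inter> Ch k) \<union> Ch (k - 1)" by (auto simp: B_def)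
  show ?thesis
  proof (cases "Ch k - Ch (k - 1) \<subseteq> A")
    case False
    \<comment> \<open>Joining \<open>A \<inter> Ch k\<close> with \<open>Ch (k - 1)\<close> stays in
      the lattice of zeros. The join exceeds \<open>Ch (k - 1)\<close> in entropy, so
      \<open>h = 0\<close> for both forces it to contain a further bond, as the premise of (c)
      demands.\<close>
    have "h (B \<union> Ch (k - 1)) = 0" unfolding B_un
      using h_zero_lattice[OF A(1) Ch_subset, of k] h_Ch A k(1) Ch_subset
      by (intro h_zero_lattice(1)) auto
    moreover have "h (Ch (k - 1)) = 0" using k(1) by (intro h_Ch) auto
    moreover
    have "gam \<gamma> (Ch (k - 1)) < gam \<gamma> (B \<union> Ch (k - 1))"
      using k(2) Ch_subset A by (intro gam_strict_mono) (auto simp: B_def)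
    then have "2 * ln 2 * gam \<gamma> (Ch (k - 1)) < 2 * ln 2 * gam \<gamma> (B \<union> Ch (k - 1))" by simp
    ultimately have "V (Ch (k - 1)) \<noteq> V (B \<union> Ch (k - 1))" unfolding h_def by linarith
    then have "active a (B \<union> Ch (k - 1)) \<noteq> active a (Ch (k - 1))" by (auto simp: V_def)
    moreover have "active a (Ch (k - 1)) \<subseteq> active a (B \<union> Ch (k - 1))" by (intro active_mono) auto
    ultimately have "active a (B \<union> Ch (k - 1)) - active a (Ch (k - 1)) \<noteq> {}" by auto
    moreover have "B \<subset> Ch k - Ch (k - 1)" using False by (auto simp: B_def)
    ultimately obtain J J' where J: "J \<in> active a (Ch k) - active a (B \<union> Ch (k - 1))"
        and J': "J' \<in> active a (B \<union> Ch (k - 1)) - active a (Ch (k - 1))"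
        and "(J \<inter> J') - Ch (k - 1) \<noteq> {}"
      using irr k(1) unfolding irreducible_hamiltonian_def by meson
    then obtain s where s: "s \<in> J" "s \<in> J'" "s \<notin> Ch (k - 1)" by auto
    show ?thesis
    proof (rule that)
      show "J \<in> active a I" using J Ch_subset[of k] by (auto simp: active_def)
      show "s \<in> J" by fact
      have "level J = k" "level {s} = k" using J s by (auto intro!: lev simp: active_def)
      then show "level J = level {s}" by simp
      show "s \<in> A" using J' s by (auto simp: active_def B_def)
      show "\<not> J \<subseteq> A" using J by (auto simp: active_def B_def)
    qed
  next
    case True
    then have not_sub: "\<not> Ch (k - 1) \<subseteq> A" using k(3) by auto
    then have k2: "k - 1 \<noteq> 0" by (intro notI) simp
    \<comment> \<open>Because \<open>k\<close> is least and \<open>A\<close> does not contain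
      \<open>Ch (k - 1)\<close>, the failure of \<open>Q (k - 1)\<close> means that \<open>A\<close>
      has no site in the slice below. The bond given by (c') passes through a site of that slice and
      so leaves \<open>A\<close>.\<close>
    have "\<not> Q (k - 1)" using not_less_Least[of "k - 1" Q] k(1) by (auto simp: k_def)
    then have sub: "A \<inter> Ch (k - 1) \<subseteq> Ch (k - 2)"
      using not_sub k2 k(1) by (auto simp: Q_def numeral_2_eq_2)
    have "k \<in> {2..K}" using k(1) k2 by auto
    then obtain s J where sJ: "s \<in> Ch (k - 1) - Ch (k - 2)"
        "J \<in> active a (Ch k) - active a (Ch (k - 1))" "s \<in> J"
      using irr unfolding irreducible_hamiltonian_def by blast
    then obtain i where i: "i \<in> J" "i \<notin> Ch (k - 1)" "i \<in> Ch k" by (auto simp: active_def)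
    show ?thesis
    proof (rule that)
      show "J \<in> active a I" using sJ Ch_subset[of k] by (auto simp: active_def)
      show "i \<in> J" by fact
      have "level J = k" "level {i} = k" using sJ i by (auto intro!: lev simp: active_def)
      then show "level J = level {i}" by simp
      show "i \<in> A" using True i by auto
      show "\<not> J \<subseteq> A" using sJ sub by auto
    qed
  qed
qed

end

section \<open>Independent Gaussian families\<close>

lemma normal_density_exp:
  assumes "v > 0"
  shows "normal_density 0 (sqrt v) x * exp (\<theta> * x)
    = exp (\<theta>\<^sup>2 * v / 2) * normal_density (\<theta> * v) (sqrt v) x"
proof -
  \<comment> \<open>Completing the square: an exponential tilt shifts the mean and multiplies by the
    moment generating function.\<close>
  have "- (x - 0)\<^sup>2 / (2 * v) + \<theta> * x = \<theta>\<^sup>2 * v / 2 + - (x - \<theta> * v)\<^sup>2 / (2 * v)"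
    using assms by (simp add: field_simps power2_eq_square)
  then have "exp (- (x - 0)\<^sup>2 / (2 * v)) * exp (\<theta> * x)
      = exp (\<theta>\<^sup>2 * v / 2) * exp (- (x - \<theta> * v)\<^sup>2 / (2 * v))"
    by (simp only: flip: exp_add)
  then show ?thesis using assms by (simp add: normal_density_def field_simps)
qed

lemma normal_density_has_deriv:
  assumes "v > 0"
  shows "(normal_density 0 (sqrt v) has_real_derivative - x / v * normal_density 0 (sqrt v) x) (at x)"
  unfolding normal_density_def using assms
  by (auto intro!: derivative_eq_intros simp: field_simps power2_eq_square)

lemma normal_density_tendsto:
  assumes "v > 0"
  shows "(normal_density 0 (sqrt v) \<longlongrightarrow> 0) at_top" "(normal_density 0 (sqrt v) \<longlongrightarrow> 0) at_bot"
proof -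
  have c: "1 / (2 * v) > 0" using assms by simp
  have "((\<lambda>x::real. exp (- (1 / (2 * v) * x\<^sup>2))) \<longlongrightarrow> 0) F" if "F = at_top \<or> F = at_bot" for F
  proof (rule filterlim_compose[OF exp_at_bot])
    have "filterlim (\<lambda>x::real. x\<^sup>2) at_top F"
      using that filterlim_pow_at_top[OF _ filterlim_ident, of 2]
        filterlim_pow_at_bot_even[OF _ filterlim_ident, of 2] by auto
    then have "filterlim (\<lambda>x::real. 1 / (2 * v) * x\<^sup>2) at_top F"
      by (rule filterlim_tendsto_pos_mult_at_top[OF tendsto_const c])
    then show "LIM x F. - (1 / (2 * v) * x\<^sup>2) :> at_bot"
      by (simp add: filterlim_uminus_at_top)
  qed
  then have *: "((\<lambda>x. 1 / sqrt (2 * pi * v) * exp (- (1 / (2 * v) * x\<^sup>2))) \<longlongrightarrow> 1 / sqrt (2 * pi * v) * 0) F"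
    if "F = at_top \<or> F = at_bot" for F
    using that by (intro tendsto_mult tendsto_const)
  have eq: "normal_density 0 (sqrt v) = (\<lambda>x. 1 / sqrt (2 * pi * v) * exp (- (1 / (2 * v) * x\<^sup>2)))"
    using assms by (simp add: normal_density_def fun_eq_iff)
  show "(normal_density 0 (sqrt v) \<longlongrightarrow> 0) at_top" "(normal_density 0 (sqrt v) \<longlongrightarrow> 0) at_bot"
    using *[of at_top] *[of at_bot] unfolding eq by auto
qed

text \<open>Integration by parts. The logistic function has derivative
  \<open>\<beta> * (q x * (1 - q x))\<close> and the density has derivative \<open>- x / v\<close>
  times itself, so the difference of the two integrands is the derivative of \<open>F\<close>, which
  vanishes at both ends because \<open>q\<close> is bounded.\<close>

lemma stein_logistic:
  fixes r \<beta> v :: real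
  assumes v: "v > 0" and r: "r \<ge> 0"
  defines "q \<equiv> \<lambda>x. 1 / (1 + r * exp (- \<beta> * x))"
  shows "(\<integral>x. normal_density 0 (sqrt v) x * (x * q x) \<partial>lborel)
    = v * \<beta> * (\<integral>x. normal_density 0 (sqrt v) x * (q x * (1 - q x)) \<partial>lborel)"
proof -
  let ?\<phi> = "normal_density 0 (sqrt v)"
  have den: "1 + r * exp (- \<beta> * x) > 0" for x using r by (simp add: add_pos_nonneg)
  have q01: "0 \<le> q x" "q x \<le> 1" for x using den[of x] r by (auto simp: q_def field_simps)
  have q_meas [measurable]: "q \<in> borel_measurable borel" unfolding q_def by measurable
  have dq: "(q has_real_derivative \<beta> * (q x * (1 - q x))) (at x)" for x
    unfolding q_def using den[of x]
    by (auto intro!: derivative_eq_intros simp: field_simps power2_eq_square)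
  define F where "F x = - v * (?\<phi> x * q x)" for x
  define f where "f x = ?\<phi> x * (x * q x) - v * \<beta> * (?\<phi> x * (q x * (1 - q x)))" for x
  have dF: "(F has_real_derivative f x) (at x)" for x
    unfolding F_def f_def
    by (rule derivative_eq_intros normal_density_has_deriv[OF v] dq refl)+
      (use v in \<open>simp add: field_simps\<close>)
  have i1: "integrable lborel (\<lambda>x. ?\<phi> x * (x * q x))"
  proof (rule Bochner_Integration.integrable_bound)
    show "integrable lborel (\<lambda>x. ?\<phi> x * \<bar>x\<bar>)"
      using integrable_normal_moment_abs[of "sqrt v" 0 1] v by simp
    show "AE x in lborel. norm (?\<phi> x * (x * q x)) \<le> norm (?\<phi> x * \<bar>x\<bar>)"
      using q01 by (intro AE_I2) (auto simp: abs_mult intro!: mult_left_mono mult_left_le)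
  qed measurable
  have i2: "integrable lborel (\<lambda>x. ?\<phi> x * (q x * (1 - q x)))"
  proof (rule Bochner_Integration.integrable_bound)
    show "integrable lborel ?\<phi>" using v by (intro integrable_normal_density) auto
    have "\<bar>q x * (1 - q x)\<bar> \<le> 1" for x using q01[of x] by (auto simp: abs_mult intro!: mult_le_one)
    then show "AE x in lborel. norm (?\<phi> x * (q x * (1 - q x))) \<le> norm (?\<phi> x)"
      by (intro AE_I2) (simp add: abs_mult[of "?\<phi> _"] mult_left_le)
  qed measurable
  have cont: "isCont f x" for x
  proof -
    have "isCont ?\<phi> x" "isCont q x"
      using normal_density_has_deriv[OF v, of x] dq[of x] by (auto dest: DERIV_isCont)
    then show ?thesis unfolding f_def by (intro continuous_intros)
  qed
  have lim: "(F \<longlongrightarrow> 0) G" if "(?\<phi> \<longlongrightarrow> 0) G" for G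
  proof (rule Lim_null_comparison)
    show "\<forall>\<^sub>F x in G. norm (F x) \<le> v * ?\<phi> x"
      using q01 v by (intro always_eventually) (auto simp: F_def abs_mult intro!: mult_left_le)
    show "((\<lambda>x. v * ?\<phi> x) \<longlongrightarrow> 0) G" using tendsto_mult[OF tendsto_const that, of v] by simp
  qed
  have "(LBINT x=-\<infinity>..\<infinity>. f x) = 0 - 0"
  proof (rule interval_integral_FTC_integrable)
    show "(F has_vector_derivative f x) (at x)" for x
      using dF by (simp add: has_real_derivative_iff_has_vector_derivative)
    show "set_integrable lborel (einterval (- \<infinity>) \<infinity>) f"
      using i1 i2 by (auto simp: set_integrable_def f_def)
    show "((F \<circ> real_of_ereal) \<longlongrightarrow> 0) (at_right (- \<infinity>))"
      using lim[OF normal_density_tendsto(2)[OF v]] by (simp add: ereal_tendsto_simps)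
    show "((F \<circ> real_of_ereal) \<longlongrightarrow> 0) (at_left \<infinity>)"
      using lim[OF normal_density_tendsto(1)[OF v]] by (simp add: ereal_tendsto_simps)
  qed (use cont in auto)
  then have "(\<integral>x. f x \<partial>lborel) = 0"
    by (simp add: interval_lebesgue_integral_def set_lebesgue_integral_def)
  then show ?thesis
    unfolding f_def using i1 i2 by simp
qed

text \<open>The density decreases on the nonnegative half line, so on a unit interval it is at least
  its value at the right end. Discarding the rest of the tail is harmless at exponential
  scale.\<close>

lemma normal_tail_lower:
  assumes "v > 0" "x \<ge> 0"
  shows "measure (density lborel (\<lambda>x. ennreal (normal_density 0 (sqrt v) x))) {x..}
    \<ge> normal_density 0 (sqrt v) (x + 1)"
proof -
  let ?\<phi> = "normal_density 0 (sqrt v)"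
  interpret D: prob_space "density lborel (\<lambda>x. ennreal (?\<phi> x))"
    using assms by (intro prob_space_normal_density) auto
  have "ennreal (?\<phi> (x + 1)) = (\<integral>\<^sup>+y. ennreal (?\<phi> (x + 1)) * indicator {x..x + 1} y \<partial>lborel)"
    by (subst nn_integral_cmult_indicator) auto
  also have "\<dots> \<le> (\<integral>\<^sup>+y. ennreal (?\<phi> y) * indicator {x..} y \<partial>lborel)"
  proof (rule nn_integral_mono)
    fix y
    have "?\<phi> (x + 1) \<le> ?\<phi> y" if "x \<le> y" "y \<le> x + 1"
    proof -
      have "y\<^sup>2 \<le> (x + 1)\<^sup>2" using that assms by (intro power_mono) auto
      then show ?thesis using assms
        by (auto simp: normal_density_def intro!: divide_right_mono)
    qed
    then show "ennreal (?\<phi> (x + 1)) * indicator {x..x + 1} y \<le> ennreal (?\<phi> y) * indicator {x..} y"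
      by (auto split: split_indicator intro!: ennreal_leI)
  qed
  also have "\<dots> = emeasure (density lborel (\<lambda>x. ennreal (?\<phi> x))) {x..}"
    by (subst emeasure_density) auto
  finally show ?thesis by (simp add: D.emeasure_eq_measure)
qed

section \<open>Moments and integration by parts for a finite independent field\<close>

locale gauss_field = prob_space M for M :: "'w measure" +
  fixes T :: "'i set" and Y :: "'i \<Rightarrow> 'w \<Rightarrow> real" and v :: "'i \<Rightarrow> real"
  assumes finite_T: "finite T" and v_pos: "\<And>t. t \<in> T \<Longrightarrow> v t > 0"
    and indep: "indep_vars (\<lambda>_. borel) Y T"
    and normal: "\<And>t. t \<in> T \<Longrightarrow>
      distributed M lborel (Y t) (\<lambda>x. ennreal (normal_density 0 (sqrt (v t)) x))"
begin

lemma Y_meas: "t \<in> T \<Longrightarrow> Y t \<in> borel_measurable M"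
  using normal[of t] by (auto simp: distributed_def)

lemma expectation_prod:
  fixes f :: "'i \<Rightarrow> real \<Rightarrow> real"
  assumes S: "S \<subseteq> T" and f: "\<And>t. t \<in> S \<Longrightarrow> f t \<in> borel_measurable borel"
    and int: "\<And>t. t \<in> S \<Longrightarrow> integrable M (\<lambda>\<omega>. f t (Y t \<omega>))"
  shows "expectation (\<lambda>\<omega>. \<Prod>t\<in>S. f t (Y t \<omega>)) = (\<Prod>t\<in>S. expectation (\<lambda>\<omega>. f t (Y t \<omega>)))"
    and "integrable M (\<lambda>\<omega>. \<Prod>t\<in>S. f t (Y t \<omega>))"
proof -
  have S_fin: "finite S" using S finite_T finite_subset by blast
  have "indep_vars (\<lambda>_. borel) (\<lambda>t \<omega>. f t (Y t \<omega>)) S"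
    by (rule indep_vars_compose2[OF indep_vars_subset[OF indep S]]) (use f in auto)
  note * = S_fin this int
  show "expectation (\<lambda>\<omega>. \<Prod>t\<in>S. f t (Y t \<omega>)) = (\<Prod>t\<in>S. expectation (\<lambda>\<omega>. f t (Y t \<omega>)))"
    by (rule indep_vars_lebesgue_integral[OF *])
  show "integrable M (\<lambda>\<omega>. \<Prod>t\<in>S. f t (Y t \<omega>))" by (rule indep_vars_integrable[OF *])
qed

lemma mgf_single:
  assumes "t \<in> T"
  shows "expectation (\<lambda>\<omega>. exp (\<theta> * Y t \<omega>)) = exp (\<theta>\<^sup>2 * v t / 2)"
    and "integrable M (\<lambda>\<omega>. exp (\<theta> * Y t \<omega>))"
proof -
  note D = normal[OF assms] and v = v_pos[OF assms]
  have sq: "sqrt (v t) > 0" using v by simp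
  have "integrable lborel (\<lambda>x. normal_density 0 (sqrt (v t)) x * exp (\<theta> * x))"
    unfolding normal_density_exp[OF v] using sq by (intro integrable_mult_right integrable_normal_density)
  then show "integrable M (\<lambda>\<omega>. exp (\<theta> * Y t \<omega>))"
    using distributed_integrable[OF D, of "\<lambda>x. exp (\<theta> * x)"] by simp
  have "expectation (\<lambda>\<omega>. exp (\<theta> * Y t \<omega>)) = (\<integral>x. normal_density 0 (sqrt (v t)) x * exp (\<theta> * x) \<partial>lborel)"
    using distributed_integral[OF D, of "\<lambda>x. exp (\<theta> * x)"] by simp
  also have "\<dots> = exp (\<theta>\<^sup>2 * v t / 2)"
    unfolding normal_density_exp[OF v] using sq by simp
  finally show "expectation (\<lambda>\<omega>. exp (\<theta> * Y t \<omega>)) = exp (\<theta>\<^sup>2 * v t / 2)" .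
qed

lemma mgf:
  assumes "S \<subseteq> T"
  shows "expectation (\<lambda>\<omega>. exp (\<Sum>t\<in>S. \<theta> t * Y t \<omega>)) = exp (\<Sum>t\<in>S. (\<theta> t)\<^sup>2 * v t / 2)"
    and "integrable M (\<lambda>\<omega>. exp (\<Sum>t\<in>S. \<theta> t * Y t \<omega>))"
proof -
  have fin: "finite S" using assms finite_T finite_subset by blast
  have *: "\<And>t. t \<in> S \<Longrightarrow> (\<lambda>x. exp (\<theta> t * x)) \<in> borel_measurable borel"
    "\<And>t. t \<in> S \<Longrightarrow> integrable M (\<lambda>\<omega>. exp (\<theta> t * Y t \<omega>))"
    using mgf_single(2) assms by auto
  show "expectation (\<lambda>\<omega>. exp (\<Sum>t\<in>S. \<theta> t * Y t \<omega>)) = exp (\<Sum>t\<in>S. (\<theta> t)\<^sup>2 * v t / 2)"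
    unfolding exp_sum[OF fin]
    using expectation_prod(1)[OF assms, of "\<lambda>t x. exp (\<theta> t * x)", OF *] mgf_single(1) assms
    by (simp add: subset_iff)
  show "integrable M (\<lambda>\<omega>. exp (\<Sum>t\<in>S. \<theta> t * Y t \<omega>))"
    unfolding exp_sum[OF fin] by (rule expectation_prod(2)[OF assms, of "\<lambda>t x. exp (\<theta> t * x)", OF *])
qed

lemma integrable_moments:
  assumes "t \<in> T"
  shows "integrable M (Y t)" "integrable M (\<lambda>\<omega>. (Y t \<omega>)\<^sup>2)"
    "expectation (Y t) = 0" "expectation (\<lambda>\<omega>. (Y t \<omega>)\<^sup>2) = v t"
proof -
  note D = normal[OF assms]
  have sq: "sqrt (v t) > 0" using v_pos[OF assms] by simp
  show "integrable M (Y t)"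
    using distributed_integrable[OF D, of "\<lambda>x. x"] integrable_normal_moment_nz_1[OF sq, of 0] by simp
  show "integrable M (\<lambda>\<omega>. (Y t \<omega>)\<^sup>2)"
    using distributed_integrable[OF D, of "\<lambda>x. x\<^sup>2"] integrable_normal_moment[OF sq, of 0 2] by simp
  show e: "expectation (Y t) = 0" by (rule normal_distributed_expectation[OF sq D])
  show "expectation (\<lambda>\<omega>. (Y t \<omega>)\<^sup>2) = v t"
    using normal_distributed_variance[OF sq D] v_pos[OF assms] by (simp add: e)
qed

lemma second_moment_sum:
  assumes "S \<subseteq> T"
  shows "expectation (\<lambda>\<omega>. (\<Sum>t\<in>S. c t * Y t \<omega>)\<^sup>2) = (\<Sum>t\<in>S. (c t)\<^sup>2 * v t)"
proof -
  have fin: "finite S" using assms finite_T finite_subset by blast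
  have iv: "indep_var borel (Y s) borel (Y t)" if "s \<in> S" "t \<in> S" "s \<noteq> t" for s t
  proof -
    have "indep_var borel ((\<lambda>z. z s) \<circ> (\<lambda>\<omega>. \<lambda>i\<in>{s}. Y i \<omega>)) borel ((\<lambda>z. z t) \<circ> (\<lambda>\<omega>. \<lambda>i\<in>{t}. Y i \<omega>))"
      by (rule indep_var_compose[OF indep_var_restrict[OF indep]]) (use that assms in auto)
    then show ?thesis by (simp add: comp_def)
  qed
  have int: "integrable M (\<lambda>\<omega>. Y s \<omega> * Y t \<omega>)" if "s \<in> S" "t \<in> S" for s t
    using integrable_moments(1)[of s] integrable_moments(1)[of t] integrable_moments(2)[of s]
      indep_var_integrable[OF iv[OF that]] that assms
    by (cases "s = t") (auto simp: power2_eq_square)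
  have E: "expectation (\<lambda>\<omega>. Y s \<omega> * Y t \<omega>) = (if s = t then v t else 0)" if "s \<in> S" "t \<in> S" for s t
  proof (cases "s = t")
    case True
    then show ?thesis using integrable_moments(4)[of t] that assms by (auto simp: power2_eq_square)
  next
    case False
    have "s \<in> T" "t \<in> T" using that assms by auto
    then show ?thesis
      using indep_var_lebesgue_integral[OF iv[OF that False]] integrable_moments(1,3) False by simp
  qed
  have "(\<Sum>t\<in>S. c t * Y t \<omega>)\<^sup>2 = (\<Sum>s\<in>S. \<Sum>t\<in>S. c s * c t * (Y s \<omega> * Y t \<omega>))" for \<omega>
    by (simp add: power2_eq_square sum_product mult_ac)
  then have "expectation (\<lambda>\<omega>. (\<Sum>t\<in>S. c t * Y t \<omega>)\<^sup>2)
      = (\<Sum>s\<in>S. \<Sum>t\<in>S. c s * c t * (if s = t then v t else 0))"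
    using int E by (simp add: integral_sum' cong: sum.cong)
  also have "\<dots> = (\<Sum>t\<in>S. (c t)\<^sup>2 * v t)"
    using fin by (simp add: if_distrib sum.delta' power2_eq_square cong: if_cong)
  finally show ?thesis .
qed

text \<open>Given the other variables, \<open>q\<close> is a logistic function of \<open>Y t\<close>
  with a frozen coefficient. Independence and Fubini reduce the identity to
  \<open>stein_logistic\<close> for each value of that coefficient.\<close>

lemma stein_field:
  fixes \<beta> :: real
  assumes t: "t \<in> T" and R: "R \<in> borel_measurable (PiM (T - {t}) (\<lambda>_. borel))" "\<And>z. R z \<ge> 0"
  defines "q \<equiv> \<lambda>\<omega>. 1 / (1 + R (\<lambda>s\<in>T - {t}. Y s \<omega>) * exp (- \<beta> * Y t \<omega>))"
  shows "expectation (\<lambda>\<omega>. Y t \<omega> * q \<omega>) = v t * \<beta> * expectation (\<lambda>\<omega>. q \<omega> * (1 - q \<omega>))"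
proof -
  let ?D = "density lborel (\<lambda>x. ennreal (normal_density 0 (sqrt (v t)) x))"
  define W where "W \<omega> = R (\<lambda>s\<in>T - {t}. Y s \<omega>)" for \<omega>
  have "indep_var borel ((\<lambda>z. z t) \<circ> (\<lambda>\<omega>. \<lambda>s\<in>{t}. Y s \<omega>)) borel (R \<circ> (\<lambda>\<omega>. \<lambda>s\<in>T - {t}. Y s \<omega>))"
    by (rule indep_var_compose[OF indep_var_restrict[OF indep]]) (use t R in auto)
  then have iv: "indep_var borel (Y t) borel W" by (simp add: comp_def W_def[abs_def])
  then have W_meas [measurable]: "W \<in> borel_measurable M" and Yt [measurable]: "Y t \<in> borel_measurable M"
    by (auto dest: indep_var_rv1 indep_var_rv2)
  have dY: "distr M borel (Y t) = ?D"
    using normal[OF t] by (simp add: distributed_def cong: distr_cong)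
  interpret DY: prob_space ?D using v_pos[OF t] by (intro prob_space_normal_density) auto
  interpret DW: prob_space "distr M borel W" by (intro prob_space_distr) auto
  interpret P: pair_prob_space ?D "distr M borel W" ..
  have joint: "?D \<Otimes>\<^sub>M distr M borel W = distr M (borel \<Otimes>\<^sub>M borel) (\<lambda>\<omega>. (Y t \<omega>, W \<omega>))"
    using iv dY by (simp add: indep_var_distribution_eq)
  \<comment> \<open>The absolute value makes the coefficient nonnegative for every real
    \<open>w\<close>; on the values of \<open>W\<close> it changes nothing, because \<open>R\<close>
    is nonnegative.\<close>
  define Q where "Q x w = 1 / (1 + \<bar>w\<bar> * exp (- \<beta> * x))" for x w :: real
  have Q01: "0 \<le> Q x w" "Q x w \<le> 1" for x w
    by (auto simp: Q_def divide_le_eq add_pos_nonneg intro!: divide_nonneg_pos)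
  have Q_meas [measurable]: "(\<lambda>(x, w). Q x w) \<in> borel_measurable (borel \<Otimes>\<^sub>M borel)"
    unfolding Q_def by measurable
  have fubini: "expectation (\<lambda>\<omega>. f (Y t \<omega>) (W \<omega>))
      = (\<integral>w. (\<integral>x. normal_density 0 (sqrt (v t)) x * f x w \<partial>lborel) \<partial>distr M borel W)"
    if f [measurable]: "(\<lambda>(x, w). f x w) \<in> borel_measurable (borel \<Otimes>\<^sub>M borel)"
      and int: "integrable M (\<lambda>\<omega>. f (Y t \<omega>) (W \<omega>))" for f :: "real \<Rightarrow> real \<Rightarrow> real"
  proof -
    have i: "integrable (?D \<Otimes>\<^sub>M distr M borel W) (\<lambda>(x, w). f x w)"
      unfolding joint by (subst integrable_distr_eq) (use int in \<open>auto simp: case_prod_beta\<close>)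
    have "expectation (\<lambda>\<omega>. f (Y t \<omega>) (W \<omega>)) = (\<integral>p. (case p of (x, w) \<Rightarrow> f x w) \<partial>(?D \<Otimes>\<^sub>M distr M borel W))"
      unfolding joint by (subst integral_distr) auto
    also have "\<dots> = (\<integral>w. (\<integral>x. f x w \<partial>?D) \<partial>distr M borel W)"
      using P.integral_snd[OF i] by simp
    also have "\<dots> = (\<integral>w. (\<integral>x. normal_density 0 (sqrt (v t)) x * f x w \<partial>lborel) \<partial>distr M borel W)"
      by (rule Bochner_Integration.integral_cong[OF refl], subst integral_density) auto
    finally show ?thesis .
  qed
  have q: "q \<omega> = Q (Y t \<omega>) (W \<omega>)" for \<omega> using R(2) by (simp add: q_def Q_def W_def)
  have "expectation (\<lambda>\<omega>. Y t \<omega> * Q (Y t \<omega>) (W \<omega>))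
      = (\<integral>w. (\<integral>x. normal_density 0 (sqrt (v t)) x * (x * Q x w) \<partial>lborel) \<partial>distr M borel W)"
  proof (rule fubini)
    show "integrable M (\<lambda>\<omega>. Y t \<omega> * Q (Y t \<omega>) (W \<omega>))"
      by (rule Bochner_Integration.integrable_bound[OF integrable_moments(1)[OF t]])
        (use Q01 in \<open>auto simp: abs_mult intro!: mult_left_le\<close>)
  qed measurable
  also have "\<dots> = (\<integral>w. v t * \<beta> * (\<integral>x. normal_density 0 (sqrt (v t)) x * (Q x w * (1 - Q x w)) \<partial>lborel) \<partial>distr M borel W)"
    unfolding Q_def by (intro Bochner_Integration.integral_cong refl stein_logistic v_pos t) auto
  also have "\<dots> = v t * \<beta> * expectation (\<lambda>\<omega>. Q (Y t \<omega>) (W \<omega>) * (1 - Q (Y t \<omega>) (W \<omega>)))"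
  proof (subst fubini)
    have "\<bar>Q x w * (1 - Q x w)\<bar> \<le> 1" for x w using Q01[of x w] by (auto simp: abs_mult intro!: mult_le_one)
    then show "integrable M (\<lambda>\<omega>. Q (Y t \<omega>) (W \<omega>) * (1 - Q (Y t \<omega>) (W \<omega>)))"
      by (intro integrable_const_bound[where B = 1]) auto
  qed auto
  finally show ?thesis by (simp add: q)
qed

end

lemma exp_decay_tendsto:
  "c > 0 \<Longrightarrow> (\<lambda>N. exp (- (real N * c))) \<longlonglongrightarrow> 0"
  by real_asymp

text \<open>The density at this point decays at the rate
  \<open>c\<^sup>2 * (v * b\<^sup>2) / 2\<close>, up to a power of \<open>N\<close>. Since
  \<open>c\<^sup>2 < c\<close>, replacing one square by \<open>c\<close> leaves exponential room
  that absorbs the power, the shift by one and all constants.\<close>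

lemma eventually_normal_density_ge:
  fixes v b c :: real
  assumes "v > 0" "b > 0" "0 < c" "c < 1"
  shows "\<forall>\<^sub>F N in sequentially. normal_density 0 (sqrt (v * real N)) (c * (v * b) * real N + 1)
    \<ge> exp (- (real N * (c * (v * b\<^sup>2) / 2)))"
proof -
  \<comment> \<open>\<open>k\<close> is the gap between the two rates. The constant \<open>D\<close>
    below collects what does not depend on \<open>N\<close>: the cross term of the square, the
    squared shift and the normalization.\<close>
  define k where "k = (c - c\<^sup>2) * (v * b\<^sup>2) / 2"
  have "c\<^sup>2 < c" using assms by (simp add: power2_eq_square)
  then have k: "k > 0" using assms by (simp add: k_def)
  define D where "D = exp (- (c * b) - 1 / (2 * v)) / sqrt (2 * pi * v)"
  have D: "D > 0" using assms by (simp add: D_def)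
  have "filterlim (\<lambda>N. exp (k * real N) / sqrt (real N)) at_top sequentially"
    using k by real_asymp
  then have "filterlim (\<lambda>N. D * (exp (k * real N) / sqrt (real N))) at_top sequentially"
    by (rule filterlim_tendsto_pos_mult_at_top[OF tendsto_const D])
  then have "\<forall>\<^sub>F N in sequentially. D * (exp (k * real N) / sqrt (real N)) \<ge> 1"
    by (simp add: filterlim_at_top)
  with eventually_gt_at_top[of 0] show ?thesis
  proof eventually_elim
    case (elim N)
    define r where "r = real N"
    have r: "r \<ge> 1" using elim by (simp add: r_def)
    have "(c * (v * b) * r + 1)\<^sup>2 / (2 * (v * r)) = r * (c\<^sup>2 * (v * b\<^sup>2) / 2) + c * b + 1 / (2 * v) / r"
      using r assms by (simp add: field_simps power2_eq_square)
    also have "1 / (2 * v) / r \<le> 1 / (2 * v)"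
      using r assms by (simp add: divide_le_eq_1 divide_simps)
    finally have le: "(c * (v * b) * r + 1)\<^sup>2 / (2 * (v * r)) \<le> r * (c\<^sup>2 * (v * b\<^sup>2) / 2) + c * b + 1 / (2 * v)"
      by simp
    have "- (r * (c * (v * b\<^sup>2) / 2)) + k * r + (- (c * b) - 1 / (2 * v)) \<le> - (c * (v * b) * r + 1)\<^sup>2 / (2 * (v * r))"
    proof -
      have "r * (c\<^sup>2 * (v * b\<^sup>2) / 2) = r * (c * (v * b\<^sup>2) / 2) - k * r"
        by (simp add: k_def field_simps)
      with le show ?thesis unfolding minus_divide_left[symmetric] by linarith
    qed
    then have e: "exp (- (r * (c * (v * b\<^sup>2) / 2))) * exp (k * r) * exp (- (c * b) - 1 / (2 * v))
        \<le> exp (- (c * (v * b) * r + 1)\<^sup>2 / (2 * (v * r)))"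
      by (simp flip: exp_add)
    have "exp (- (r * (c * (v * b\<^sup>2) / 2))) \<le> exp (- (r * (c * (v * b\<^sup>2) / 2))) * (D * (exp (k * r) / sqrt r))"
      using mult_left_mono[OF elim(2), of "exp (- (r * (c * (v * b\<^sup>2) / 2)))"]
      unfolding r_def by (simp only: mult_1_right exp_ge_zero simp_thms)
    also have "\<dots> = exp (- (r * (c * (v * b\<^sup>2) / 2))) * exp (k * r) * exp (- (c * b) - 1 / (2 * v)) / sqrt (2 * pi * (v * r))"
      by (simp add: D_def real_sqrt_mult mult_ac)
    also have "\<dots> \<le> exp (- (c * (v * b) * r + 1)\<^sup>2 / (2 * (v * r))) / sqrt (2 * pi * (v * r))"
      using e r assms by (intro divide_right_mono) auto
    also have "\<dots> = normal_density 0 (sqrt (v * r)) (c * (v * b) * r + 1)"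
      using r assms by (simp add: normal_density_def)
    finally show ?case by (simp add: r_def)
  qed
qed

section \<open>Estimates at fixed size\<close>

text \<open>The last assumption places \<beta> at or above the last critical inverse temperature:
  the convention of \<open>wt\<close> at the final index gives
  \<open>wt K = 1 / sqrt (2 * ln 2 * sl K)\<close>.\<close>

locale gibbs_model = weights n a \<gamma> + prob_space M
  for n a \<gamma> and M :: "'w measure" +
  fixes N :: nat and X :: "nat set \<Rightarrow> (nat \<Rightarrow> nat) \<Rightarrow> 'w \<Rightarrow> real" and \<beta> :: real
  assumes n_pos: "n > 0" and N_pos: "N > 0"
    and indep_X: "indep_vars (\<lambda>_. borel) (\<lambda>(J, \<tau>). X J \<tau>)
      (SIGMA J:active a {1..n}. configs \<gamma> N J)"
    and normal_X: "\<And>J \<tau>. J \<in> active a {1..n} \<Longrightarrow> \<tau> \<in> configs \<gamma> N J \<Longrightarrow>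
      distributed M lborel (X J \<tau>) (\<lambda>x. ennreal (normal_density 0 (sqrt (a J * real N)) x))"
    and \<beta>_wt: "\<beta> * wt (chain_length n a \<gamma>) \<ge> 1"
begin

abbreviation P :: "nat set set" where "P \<equiv> active a I"

abbreviation cfg :: "nat set \<Rightarrow> (nat \<Rightarrow> nat) set" where "cfg \<equiv> configs \<gamma> N"

abbreviation C :: "(nat \<Rightarrow> nat) set" where "C \<equiv> configs \<gamma> N I"

abbreviation y :: "nat set \<Rightarrow> (nat \<Rightarrow> nat) \<Rightarrow> 'w \<Rightarrow> real" where
  "y J \<sigma> \<omega> \<equiv> X J (restrict \<sigma> J) \<omega>"

abbreviation H :: "(nat \<Rightarrow> nat) \<Rightarrow> 'w \<Rightarrow> real" where "H \<equiv> hamiltonian n a X"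

definition Z :: "'w \<Rightarrow> real" where "Z \<omega> = (\<Sum>\<tau>\<in>C. exp (\<beta> * H \<tau> \<omega>))"

definition G :: "(nat \<Rightarrow> nat) \<Rightarrow> 'w \<Rightarrow> real" where "G \<sigma> \<omega> = gibbs n a \<gamma> N X \<beta> \<omega> \<sigma>"

definition ov :: "(nat \<Rightarrow> nat) \<Rightarrow> (nat \<Rightarrow> nat) \<Rightarrow> nat set" where "ov \<sigma> \<tau> = {i\<in>I. \<sigma> i = \<tau> i}"

section \<open>Configurations and counting by overlap\<close>

lemma finite_P [simp]: "finite P" by (simp add: finite_active)

lemma finite_spins [simp]: "finite (spins \<gamma> N i)" by (simp add: spins_def)

lemma finite_cfg [simp]: "A \<subseteq> I \<Longrightarrow> finite (cfg A)"
  unfolding configs_def by (rule finite_PiE) (auto intro: finite_subset)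

lemma finite_C [simp]: "finite C" by simp

lemma K_pos: "K \<ge> 1"
proof -
  have "Ch 0 \<noteq> I" using n_pos by auto
  then show ?thesis using Ch_K by (cases "K = 0") auto
qed

lemma \<beta>_pos: "\<beta> > 0"
proof -
  have "wt K \<ge> 0" using K_pos by (intro wt_nonneg) auto
  then show ?thesis using \<beta>_wt by (smt (verit, best) mult_nonpos_nonneg)
qed

text \<open>Rounding down loses at most a factor two, because the unrounded number is at least
  one.\<close>

lemma card_spins:
  assumes "i \<in> I"
  shows "real (card (spins \<gamma> N i)) \<le> exp (real N * (ln 2 * \<gamma> i))"
    and "real (card (spins \<gamma> N i)) \<ge> exp (real N * (ln 2 * \<gamma> i)) / 2"
    and "1 \<in> spins \<gamma> N i"
proof -
  define x where "x = 2 powr (\<gamma> i * real N)"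
  have x: "x = exp (real N * (ln 2 * \<gamma> i))" by (simp add: x_def powr_def mult_ac)
  have "x \<ge> 1" using \<gamma>_pos[OF assms] by (simp add: x_def ge_one_powr_ge_zero)
  have card: "real (card (spins \<gamma> N i)) = of_int \<lfloor>x\<rfloor>"
    using \<open>x \<ge> 1\<close> by (simp add: spins_def x_def)
  show "real (card (spins \<gamma> N i)) \<le> exp (real N * (ln 2 * \<gamma> i))" unfolding card x[symmetric] by simp
  have "\<lfloor>x\<rfloor> \<ge> 1" using \<open>x \<ge> 1\<close> by simp
  then have "real_of_int \<lfloor>x\<rfloor> \<ge> 1" by simp
  then show "real (card (spins \<gamma> N i)) \<ge> exp (real N * (ln 2 * \<gamma> i)) / 2"
    unfolding card x[symmetric] using floor_correct[of x] by linarith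
  show "1 \<in> spins \<gamma> N i" using \<open>\<lfloor>x\<rfloor> \<ge> 1\<close> by (simp add: spins_def x_def nat_le_iff le_nat_iff)
qed

lemma card_cfg:
  assumes "A \<subseteq> I"
  shows "real (card (cfg A)) = (\<Prod>i\<in>A. real (card (spins \<gamma> N i)))"
  unfolding configs_def using assms by (subst card_PiE) (auto intro: finite_subset)

lemma card_cfg_upper:
  assumes "A \<subseteq> I" shows "real (card (cfg A)) \<le> exp (real N * (ln 2 * gam \<gamma> A))"
proof -
  have "(\<Prod>i\<in>A. real (card (spins \<gamma> N i))) \<le> (\<Prod>i\<in>A. exp (real N * (ln 2 * \<gamma> i)))"
    by (rule prod_mono) (use card_spins(1) assms in auto)
  also have "\<dots> = exp (real N * (ln 2 * gam \<gamma> A))"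
    using assms by (simp add: gam_def sum_distrib_left exp_sum[symmetric] finite_subset[of A I])
  finally show ?thesis using card_cfg[OF assms] by simp
qed

lemma card_cfg_lower:
  assumes "A \<subseteq> I" shows "real (card (cfg A)) \<ge> exp (real N * (ln 2 * gam \<gamma> A)) / 2 ^ n"
proof -
  have fin: "finite A" using assms finite_subset by blast
  have "card A \<le> n" using card_mono[OF _ assms] by simp
  then have "(2::real) ^ card A \<le> 2 ^ n" by (intro power_increasing) auto
  then have "exp (real N * (ln 2 * gam \<gamma> A)) / 2 ^ n \<le> exp (real N * (ln 2 * gam \<gamma> A)) / 2 ^ card A"
    by (intro divide_left_mono) auto
  also have "\<dots> = (\<Prod>i\<in>A. exp (real N * (ln 2 * \<gamma> i)) / 2)"
    using fin by (simp add: gam_def sum_distrib_left exp_sum prod_dividef)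
  also have "\<dots> \<le> (\<Prod>i\<in>A. real (card (spins \<gamma> N i)))"
    by (rule prod_mono) (use card_spins(2) assms in auto)
  finally show ?thesis using card_cfg[OF assms] by simp
qed

lemma card_cfg_pos: "A \<subseteq> I \<Longrightarrow> real (card (cfg A)) > 0"
  by (rule less_le_trans[OF _ card_cfg_lower]) auto

lemma cfg_split: "A \<subseteq> I \<Longrightarrow> real (card C) = real (card (cfg A)) * real (card (cfg (I - A)))"
  using card_cfg[of I] card_cfg[of A] card_cfg[of "I - A"]
  by (simp add: prod.subset_diff[of A I])

lemma C_nonempty: "C \<noteq> {}" using card_cfg_pos[of I] by auto

lemma restrict_cfg: "\<sigma> \<in> cfg A \<Longrightarrow> J \<subseteq> A \<Longrightarrow> restrict \<sigma> J \<in> cfg J"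
  unfolding configs_def by auto

lemma restrict_eq_iff: "J \<subseteq> I \<Longrightarrow> restrict \<sigma> J = restrict \<tau> J \<longleftrightarrow> J \<subseteq> ov \<sigma> \<tau>"
  by (auto simp: ov_def restrict_def fun_eq_iff subset_iff)

lemma ov_subset: "ov \<sigma> \<tau> \<subseteq> I" by (auto simp: ov_def)

text \<open>With \<sigma> fixed, a configuration \<tau> whose overlap set is \<open>A\<close> is
  determined by its values off \<open>A\<close>.\<close>

lemma sum_ov_le:
  assumes \<sigma>: "\<sigma> \<in> C" and g: "\<And>A. A \<subseteq> I \<Longrightarrow> g A \<ge> (0::real)"
  shows "(\<Sum>\<tau>\<in>C. g (ov \<sigma> \<tau>)) \<le> (\<Sum>A\<in>Pow I. real (card (cfg (I - A))) * g A)"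
proof -
  have "(\<Sum>\<tau>\<in>C. g (ov \<sigma> \<tau>)) = (\<Sum>A\<in>Pow I. \<Sum>\<tau>\<in>{\<tau>\<in>C. ov \<sigma> \<tau> = A}. g (ov \<sigma> \<tau>))"
    by (rule sum.group[symmetric]) (auto simp: ov_def)
  also have "\<dots> = (\<Sum>A\<in>Pow I. real (card {\<tau>\<in>C. ov \<sigma> \<tau> = A}) * g A)"
    by (intro sum.cong refl) simp
  also have "\<dots> \<le> (\<Sum>A\<in>Pow I. real (card (cfg (I - A))) * g A)"
  proof (intro sum_mono mult_right_mono g)
    fix A assume "A \<in> Pow I"
    have "inj_on (\<lambda>\<tau>. restrict \<tau> (I - A)) {\<tau>\<in>C. ov \<sigma> \<tau> = A}"
    proof (rule inj_onI)
      fix \<tau> \<tau>' assume \<tau>: "\<tau> \<in> {\<tau>\<in>C. ov \<sigma> \<tau> = A}" "\<tau>' \<in> {\<tau>\<in>C. ov \<sigma> \<tau> = A}"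
        and eq: "restrict \<tau> (I - A) = restrict \<tau>' (I - A)"
      show "\<tau> = \<tau>'"
      proof (rule PiE_ext[of _ I])
        show "\<tau> \<in> PiE I (spins \<gamma> N)" "\<tau>' \<in> PiE I (spins \<gamma> N)" using \<tau> by (auto simp: configs_def)
        fix i assume "i \<in> I"
        show "\<tau> i = \<tau>' i"
        proof (cases "i \<in> A")
          case True
          then have "i \<in> ov \<sigma> \<tau>" "i \<in> ov \<sigma> \<tau>'" using \<tau> by auto
          then show ?thesis by (auto simp: ov_def)
        next
          case False
          then show ?thesis using fun_cong[OF eq, of i] \<open>i \<in> I\<close> by simp
        qed
      qed
    qed
    then have "card {\<tau>\<in>C. ov \<sigma> \<tau> = A} \<le> card (cfg (I - A))"
      by (rule card_inj_on_le) (auto intro: restrict_cfg)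
    then show "real (card {\<tau>\<in>C. ov \<sigma> \<tau> = A}) \<le> real (card (cfg (I - A)))" by simp
  qed auto
  finally show ?thesis .
qed

section \<open>The disorder as a Gaussian field\<close>

abbreviation T :: "(nat set \<times> (nat \<Rightarrow> nat)) set" where "T \<equiv> SIGMA J:P. cfg J"

lemma P_subset: "J \<in> P \<Longrightarrow> J \<subseteq> I" and a_pos: "J \<in> P \<Longrightarrow> a J > 0"
  by (auto simp: active_def)

sublocale F: gauss_field M T "\<lambda>(J, \<tau>). X J \<tau>" "\<lambda>(J, \<tau>). a J * real N"
proof
  show "finite T" using P_subset by (intro finite_SigmaI) auto
  show "indep_vars (\<lambda>_. borel) (\<lambda>(J, \<tau>). X J \<tau>) T" by (rule indep_X)
qed (use N_pos a_pos normal_X in auto)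

lemma y_in_T: "J \<in> P \<Longrightarrow> \<sigma> \<in> C \<Longrightarrow> (J, restrict \<sigma> J) \<in> T"
  using P_subset restrict_cfg[of \<sigma> I J] by auto

lemma X_meas [measurable]: "J \<in> P \<Longrightarrow> \<tau> \<in> cfg J \<Longrightarrow> X J \<tau> \<in> borel_measurable M"
  using F.Y_meas[of "(J, \<tau>)"] by simp

lemma y_meas [measurable]: "J \<in> P \<Longrightarrow> \<sigma> \<in> C \<Longrightarrow> y J \<sigma> \<in> borel_measurable M"
  using X_meas restrict_cfg P_subset by blast

lemma H_meas [measurable]: "\<sigma> \<in> C \<Longrightarrow> H \<sigma> \<in> borel_measurable M"
  unfolding hamiltonian_def by (intro borel_measurable_sum y_meas) auto

lemma Z_meas [measurable]: "Z \<in> borel_measurable M"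
  unfolding Z_def by measurable

lemma G_eq: "G \<sigma> \<omega> = exp (\<beta> * H \<sigma> \<omega>) / Z \<omega>" by (simp add: G_def gibbs_def Z_def)

lemma G_meas [measurable]: "\<sigma> \<in> C \<Longrightarrow> G \<sigma> \<in> borel_measurable M"
  unfolding G_eq by measurable

lemma Z_pos: "Z \<omega> > 0" unfolding Z_def by (rule sum_pos) (use C_nonempty in auto)

lemma G_nonneg: "G \<sigma> \<omega> \<ge> 0" using Z_pos[of \<omega>] by (simp add: G_eq)

lemma sum_G: "(\<Sum>\<sigma>\<in>C. G \<sigma> \<omega>) = 1"
  using Z_pos[of \<omega>] unfolding G_eq by (simp add: Z_def flip: sum_divide_distrib)

lemma G_le_1: "\<sigma> \<in> C \<Longrightarrow> G \<sigma> \<omega> \<le> 1"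
  using member_le_sum[of \<sigma> C "\<lambda>\<sigma>. G \<sigma> \<omega>"] sum_G G_nonneg by auto

lemma mgf_one:
  assumes "A \<subseteq> I" "\<sigma> \<in> cfg A"
  shows "expectation (\<lambda>\<omega>. exp (\<Sum>J\<in>active a A. \<theta> J * y J \<sigma> \<omega>))
      = exp (real N * (\<Sum>J\<in>active a A. (\<theta> J)\<^sup>2 * a J / 2))"
    and "integrable M (\<lambda>\<omega>. exp (\<Sum>J\<in>active a A. \<theta> J * y J \<sigma> \<omega>))"
proof -
  define S where "S = (\<lambda>J. (J, restrict \<sigma> J)) ` active a A"
  have "J \<in> P" "restrict \<sigma> J \<in> cfg J" if "J \<in> active a A" for J
    using that assms(1) restrict_cfg[OF assms(2), of J] by (auto simp: active_def)
  then have "S \<subseteq> T" unfolding S_def by blast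
  note mgf = F.mgf[OF this, of "\<lambda>(J, \<tau>). \<theta> J"]
  have inj: "inj_on (\<lambda>J. (J, restrict \<sigma> J)) (active a A)" by (auto intro: inj_onI)
  show "expectation (\<lambda>\<omega>. exp (\<Sum>J\<in>active a A. \<theta> J * y J \<sigma> \<omega>))
      = exp (real N * (\<Sum>J\<in>active a A. (\<theta> J)\<^sup>2 * a J / 2))"
    using mgf(1) unfolding S_def sum.reindex[OF inj] by (simp add: sum_distrib_left mult_ac)
  show "integrable M (\<lambda>\<omega>. exp (\<Sum>J\<in>active a A. \<theta> J * y J \<sigma> \<omega>))"
    using mgf(2) unfolding S_def sum.reindex[OF inj] by simp
qed

text \<open>On a bond inside the overlap both configurations read the same Gaussian variable.
  Keeping the second copy only for the bonds in \<open>D\<close> makes all indices in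
  \<open>S\<close> distinct, so that independence applies to the pair.\<close>

lemma pair_index:
  assumes "\<sigma> \<in> C" "\<tau> \<in> C"
  defines "D \<equiv> {J\<in>P. \<not> J \<subseteq> ov \<sigma> \<tau>}"
  defines "S \<equiv> (\<lambda>J. (J, restrict \<sigma> J)) ` P \<union> (\<lambda>J. (J, restrict \<tau> J)) ` D"
  shows "S \<subseteq> T" "finite S"
    and "\<And>f :: nat set \<Rightarrow> (nat \<Rightarrow> nat) \<Rightarrow> real.
      (\<Sum>(J, \<rho>)\<in>S. f J \<rho>) = (\<Sum>J\<in>P. f J (restrict \<sigma> J)) + (\<Sum>J\<in>D. f J (restrict \<tau> J))"
    and "\<And>f :: nat set \<Rightarrow> (nat \<Rightarrow> nat) \<Rightarrow> real.
      (\<Prod>(J, \<rho>)\<in>S. f J \<rho>) = (\<Prod>J\<in>P. f J (restrict \<sigma> J)) * (\<Prod>J\<in>D. f J (restrict \<tau> J))"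
proof -
  show S: "S \<subseteq> T" using assms(1,2) y_in_T unfolding S_def D_def by blast
  show "finite S" by (rule finite_subset[OF S F.finite_T])
  have inj: "inj_on (\<lambda>J. (J, restrict \<rho> J)) \<J>" for \<rho> :: "nat \<Rightarrow> nat" and \<J> by (auto intro: inj_onI)
  have disj: "(\<lambda>J. (J, restrict \<sigma> J)) ` P \<inter> (\<lambda>J. (J, restrict \<tau> J)) ` D = {}"
    using restrict_eq_iff[OF P_subset] by (auto simp: D_def)
  have fin: "finite D" by (simp add: D_def)
  show "(\<Sum>(J, \<rho>)\<in>S. f J \<rho>) = (\<Sum>J\<in>P. f J (restrict \<sigma> J)) + (\<Sum>J\<in>D. f J (restrict \<tau> J))"
    for f :: "nat set \<Rightarrow> (nat \<Rightarrow> nat) \<Rightarrow> real"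
    unfolding S_def using disj fin by (subst sum.union_disjoint) (auto simp: sum.reindex[OF inj])
  show "(\<Prod>(J, \<rho>)\<in>S. f J \<rho>) = (\<Prod>J\<in>P. f J (restrict \<sigma> J)) * (\<Prod>J\<in>D. f J (restrict \<tau> J))"
    for f :: "nat set \<Rightarrow> (nat \<Rightarrow> nat) \<Rightarrow> real"
    unfolding S_def using disj fin by (subst prod.union_disjoint) (auto simp: prod.reindex[OF inj])
qed

lemma mgf_pair:
  assumes "\<sigma> \<in> C" "\<tau> \<in> C"
  defines "D \<equiv> {J\<in>P. \<not> J \<subseteq> ov \<sigma> \<tau>}"
  shows "expectation (\<lambda>\<omega>. exp ((\<Sum>J\<in>P. \<theta> J * y J \<sigma> \<omega>) + (\<Sum>J\<in>D. \<theta> J * y J \<tau> \<omega>)))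
      = exp (real N * ((\<Sum>J\<in>P. (\<theta> J)\<^sup>2 * a J / 2) + (\<Sum>J\<in>D. (\<theta> J)\<^sup>2 * a J / 2)))"
    and "integrable M (\<lambda>\<omega>. exp ((\<Sum>J\<in>P. \<theta> J * y J \<sigma> \<omega>) + (\<Sum>J\<in>D. \<theta> J * y J \<tau> \<omega>)))"
proof -
  note PI = pair_index[OF assms(1,2), folded D_def]
  note mgf = F.mgf[OF PI(1), of "\<lambda>(J, \<tau>). \<theta> J"]
  have *: "(\<Sum>t\<in>S. (case t of (J, \<tau>) \<Rightarrow> \<theta> J) * (case t of (J, \<tau>) \<Rightarrow> X J \<tau>) \<omega>)
      = (\<Sum>(J, \<tau>)\<in>S. \<theta> J * X J \<tau> \<omega>)"
    "(\<Sum>t\<in>S. (case t of (J, \<tau>) \<Rightarrow> \<theta> J)\<^sup>2 * (case t of (J, \<tau>) \<Rightarrow> a J * real N) / 2)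
      = (\<Sum>(J, \<tau>)\<in>S. (\<theta> J)\<^sup>2 * (a J * real N) / 2)" for S \<omega>
    by (auto intro!: sum.cong)
  show "expectation (\<lambda>\<omega>. exp ((\<Sum>J\<in>P. \<theta> J * y J \<sigma> \<omega>) + (\<Sum>J\<in>D. \<theta> J * y J \<tau> \<omega>)))
      = exp (real N * ((\<Sum>J\<in>P. (\<theta> J)\<^sup>2 * a J / 2) + (\<Sum>J\<in>D. (\<theta> J)\<^sup>2 * a J / 2)))"
    using mgf(1) unfolding * PI(3) by (simp add: sum_distrib_left distrib_left mult_ac)
  show "integrable M (\<lambda>\<omega>. exp ((\<Sum>J\<in>P. \<theta> J * y J \<sigma> \<omega>) + (\<Sum>J\<in>D. \<theta> J * y J \<tau> \<omega>)))"
    using mgf(2) unfolding * PI(3) .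
qed

text \<open>Bonds inside the overlap cancel, and every other bond contributes two independent
  variables of variance \<open>a J * N\<close>. In particular, a larger overlap set means a distance
  that is no larger.\<close>

lemma cdist_eq:
  assumes "\<sigma> \<in> C" "\<tau> \<in> C"
  shows "cdist n a M X \<sigma> \<tau> = sqrt (2 * real N * (\<Sum>J | J \<in> P \<and> \<not> J \<subseteq> ov \<sigma> \<tau>. a J))"
proof -
  define D where "D = {J\<in>P. \<not> J \<subseteq> ov \<sigma> \<tau>}"
  define S where "S = (\<lambda>J. (J, restrict \<sigma> J)) ` D \<union> (\<lambda>J. (J, restrict \<tau> J)) ` D"
  \<comment> \<open>The sign is read off the configuration, unambiguously, because the two
    restrictions differ on every bond of \<open>D\<close>.\<close>
  define c where "c = (\<lambda>(J, \<rho>). if \<rho> = restrict \<sigma> J then 1 else - 1 :: real)"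
  have inj: "inj_on (\<lambda>J. (J, restrict \<rho> J)) \<J>" for \<rho> :: "nat \<Rightarrow> nat" and \<J> by (auto intro: inj_onI)
  have ne: "restrict \<tau> J \<noteq> restrict \<sigma> J" if "J \<in> D" for J
    using that restrict_eq_iff[OF P_subset, of J \<sigma> \<tau>] by (auto simp: D_def)
  have disj: "(\<lambda>J. (J, restrict \<sigma> J)) ` D \<inter> (\<lambda>J. (J, restrict \<tau> J)) ` D = {}"
    using ne by force
  have fin: "finite D" by (simp add: D_def)
  have S: "S \<subseteq> T" using assms y_in_T unfolding S_def D_def by blast
  have sum: "(\<Sum>t\<in>S. f t) = (\<Sum>J\<in>D. f (J, restrict \<sigma> J)) + (\<Sum>J\<in>D. f (J, restrict \<tau> J))"
    for f :: "_ \<Rightarrow> real"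
    unfolding S_def using disj fin by (subst sum.union_disjoint) (auto simp: sum.reindex[OF inj])
  have "H \<sigma> \<omega> - H \<tau> \<omega> = (\<Sum>J\<in>P. y J \<sigma> \<omega> - y J \<tau> \<omega>)" for \<omega>
    by (simp add: hamiltonian_def sum_subtractf)
  also have "\<And>\<omega>. (\<Sum>J\<in>P. y J \<sigma> \<omega> - y J \<tau> \<omega>) = (\<Sum>J\<in>D. y J \<sigma> \<omega> - y J \<tau> \<omega>)"
    by (rule sum.mono_neutral_right)
      (auto simp: D_def restrict_eq_iff[OF P_subset, of _ \<sigma> \<tau>, symmetric] P_subset)
  also have "\<And>\<omega>. (\<Sum>J\<in>D. y J \<sigma> \<omega> - y J \<tau> \<omega>) = (\<Sum>t\<in>S. c t * (case t of (J, \<tau>) \<Rightarrow> X J \<tau>) \<omega>)"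
    unfolding sum using ne by (simp add: c_def sum_subtractf sum_negf)
  finally have "(\<integral>\<omega>. (H \<sigma> \<omega> - H \<tau> \<omega>)\<^sup>2 \<partial>M)
      = (\<Sum>t\<in>S. (c t)\<^sup>2 * (case t of (J, \<tau>) \<Rightarrow> a J * real N))"
    using F.second_moment_sum[OF S, of c] by simp
  also have "\<dots> = 2 * real N * (\<Sum>J\<in>D. a J)"
    unfolding sum using ne by (simp add: c_def flip: sum_distrib_right)
  finally show ?thesis unfolding cdist_def D_def by simp
qed

section \<open>Gibbs weights against critically tilted weights\<close>

abbreviation b :: "nat set \<Rightarrow> real" where "b \<equiv> bcrit"

definition E0 :: real where "E0 = (\<Sum>J\<in>P. a J * b J)"

text \<open>Centred so that the sum of \<open>exp (tilt \<sigma> \<omega>)\<close> over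
  \<open>C\<close> has mean at most one: the generating function contributes
  \<open>N * V I / 2\<close>, and the number of configurations at most another
  \<open>N * V I / 2\<close>.\<close>

definition tilt :: "(nat \<Rightarrow> nat) \<Rightarrow> 'w \<Rightarrow> real" where
  "tilt \<sigma> \<omega> = (\<Sum>J\<in>P. b J * y J \<sigma> \<omega>) - real N * V I"

definition overshoot :: "real \<Rightarrow> 'w set" where
  "overshoot \<epsilon> = (\<Union>k\<in>{1..K}. \<Union>\<tau>\<in>cfg (Ch k). {\<omega>\<in>space M.
     (\<Sum>J\<in>active a (Ch k). b J * y J \<tau> \<omega>) > real N * (V (Ch k) + \<epsilon>)})"

definition small_Z :: "real \<Rightarrow> 'w set" where
  "small_Z \<epsilon> = {\<omega>\<in>space M. Z \<omega> < exp (\<beta> * (real N * ((1 - \<epsilon>) * E0)))}"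

definition bad :: "real \<Rightarrow> 'w set" where "bad \<epsilon> = overshoot \<epsilon> \<union> small_Z \<epsilon>"

text \<open>The exponential rate lost per unit of \<epsilon> in \<open>G_upper\<close>: the first
  term comes from the lower bound on \<open>Z\<close>, the second from the allowed excess of the
  chain functionals.\<close>

definition loss :: real where "loss = \<beta> * E0 + \<beta> * (\<Sum>k\<in>{1..K}. wt k)"

lemma V_I: "V I = 2 * ln 2 * gam \<gamma> I"
  using h_Ch[of K] by (simp add: Ch_K h_def)

lemma E0_nonneg: "E0 \<ge> 0"
  unfolding E0_def using a_pos bcrit_pos by (intro sum_nonneg mult_nonneg_nonneg less_imp_le) auto

text \<open>After swapping the sums, each bond collects \<open>b J\<close> times the weights of the
  chain sets around it, which is one by \<open>bcrit_wt\<close>.\<close>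

lemma sum_by_chain:
  "(\<Sum>J\<in>P. z J) = (\<Sum>k\<in>{1..K}. wt k * (\<Sum>J\<in>active a (Ch k). b J * z J))"
proof -
  have "(\<Sum>k\<in>{1..K}. wt k * (\<Sum>J\<in>active a (Ch k). b J * z J))
      = (\<Sum>k\<in>{1..K}. \<Sum>J\<in>P. if J \<subseteq> Ch k then wt k * (b J * z J) else 0)"
  proof (intro sum.cong refl)
    fix k
    have "active a (Ch k) = {J\<in>P. J \<subseteq> Ch k}" using Ch_subset[of k] by (auto simp: active_def)
    then show "wt k * (\<Sum>J\<in>active a (Ch k). b J * z J)
        = (\<Sum>J\<in>P. if J \<subseteq> Ch k then wt k * (b J * z J) else 0)"
      by (auto simp: sum_distrib_left sum.inter_filter intro!: sum.cong)
  qed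
  also have "\<dots> = (\<Sum>J\<in>P. \<Sum>k\<in>{1..K}. if J \<subseteq> Ch k then wt k * (b J * z J) else 0)"
    by (rule sum.swap)
  also have "\<dots> = (\<Sum>J\<in>P. z J)"
  proof (intro sum.cong refl)
    fix J assume J: "J \<in> P"
    have "(\<Sum>k\<in>{1..K}. if J \<subseteq> Ch k then wt k * (b J * z J) else 0)
        = (\<Sum>k | k \<in> {1..K} \<and> J \<subseteq> Ch k. wt k * (b J * z J))"
      by (rule sum.inter_filter[symmetric]) simp
    also have "\<dots> = (b J * (\<Sum>k | k \<in> {1..K} \<and> J \<subseteq> Ch k. wt k)) * z J"
      by (simp add: sum_distrib_left sum_distrib_right mult_ac)
    finally show "(\<Sum>k\<in>{1..K}. if J \<subseteq> Ch k then wt k * (b J * z J) else 0) = z J"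
      using bcrit_wt[OF J] by simp
  qed
  finally show ?thesis by simp
qed

lemma integrable_ind: "A \<in> events \<Longrightarrow> integrable M (indicator A :: 'w \<Rightarrow> real)"
  by (rule integrable_real_indicator) (auto simp: less_top[symmetric])

lemma chernoff:
  assumes "S \<in> borel_measurable M" "integrable M (\<lambda>\<omega>. exp (S \<omega>))"
  shows "prob {\<omega>\<in>space M. S \<omega> > c} \<le> exp (- c) * expectation (\<lambda>\<omega>. exp (S \<omega>))"
proof -
  have [measurable]: "S \<in> borel_measurable M" by fact
  have "prob {\<omega>\<in>space M. S \<omega> > c} = expectation (indicator {\<omega>\<in>space M. S \<omega> > c})" by simp
  also have "\<dots> \<le> expectation (\<lambda>\<omega>. exp (- c) * exp (S \<omega>))"
  proof (rule integral_mono)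
    fix \<omega>
    show "indicator {\<omega>\<in>space M. S \<omega> > c} \<omega> \<le> exp (- c) * exp (S \<omega>)"
      by (auto split: split_indicator simp flip: exp_add)
  qed (use assms in \<open>auto intro: integrable_ind\<close>)
  finally show ?thesis by simp
qed

text \<open>A Chernoff bound with parameter one gives each partial configuration on
  \<open>Ch k\<close> the rate \<open>V (Ch k) / 2 + \<epsilon>\<close>. As \<open>h\<close>
  vanishes on the chain, the entropy in the union bound cancels \<open>V (Ch k) / 2\<close> and
  leaves \<epsilon>.\<close>

lemma overshoot_meas [measurable]: "overshoot \<epsilon> \<in> events"
  and prob_overshoot: "prob (overshoot \<epsilon>) \<le> real K * exp (- (real N * \<epsilon>))"
proof -
  define B where "B k \<tau> = {\<omega>\<in>space M.
     (\<Sum>J\<in>active a (Ch k). b J * y J \<tau> \<omega>) > real N * (V (Ch k) + \<epsilon>)}" for k \<tau>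
  have meas: "(\<lambda>\<omega>. \<Sum>J\<in>active a (Ch k). b J * y J \<tau> \<omega>) \<in> borel_measurable M"
    if \<tau>: "\<tau> \<in> cfg (Ch k)" for k \<tau>
  proof (rule borel_measurable_sum)
    fix J assume "J \<in> active a (Ch k)"
    then have "J \<in> P" "J \<subseteq> Ch k" using Ch_subset[of k] by (auto simp: active_def)
    then show "(\<lambda>\<omega>. b J * y J \<tau> \<omega>) \<in> borel_measurable M"
      using restrict_cfg[OF \<tau>] by (intro borel_measurable_times X_meas borel_measurable_const) auto
  qed
  have B_meas: "B k \<tau> \<in> events" if "\<tau> \<in> cfg (Ch k)" for k \<tau>
    unfolding B_def using meas[OF that] by measurable
  have prob_B: "prob (B k \<tau>) \<le> exp (- (real N * (V (Ch k) / 2 + \<epsilon>)))"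
    if k: "k \<in> {1..K}" and \<tau>: "\<tau> \<in> cfg (Ch k)" for k \<tau>
  proof -
    have "prob (B k \<tau>) \<le> exp (- (real N * (V (Ch k) + \<epsilon>)))
        * exp (real N * (\<Sum>J\<in>active a (Ch k). (b J)\<^sup>2 * a J / 2))"
      unfolding B_def mgf_one(1)[OF Ch_subset \<tau>, symmetric]
      by (rule chernoff[OF meas[OF \<tau>] mgf_one(2)[OF Ch_subset \<tau>]])
    also have "(\<Sum>J\<in>active a (Ch k). (b J)\<^sup>2 * a J / 2) = V (Ch k) / 2"
      by (simp add: V_def sum_divide_distrib mult_ac)
    finally show ?thesis by (simp add: algebra_simps flip: exp_add)
  qed
  have ov: "overshoot \<epsilon> = (\<Union>k\<in>{1..K}. \<Union>\<tau>\<in>cfg (Ch k). B k \<tau>)"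
    by (simp add: overshoot_def B_def)
  show "overshoot \<epsilon> \<in> events"
    unfolding ov using B_meas Ch_subset by (intro sets.finite_UN finite_cfg) auto
  have "prob (overshoot \<epsilon>) \<le> (\<Sum>k\<in>{1..K}. prob (\<Union>\<tau>\<in>cfg (Ch k). B k \<tau>))"
    unfolding ov using B_meas Ch_subset
    by (intro finite_measure_subadditive_finite) (auto intro!: sets.finite_UN finite_cfg)
  also have "\<dots> \<le> (\<Sum>k\<in>{1..K}. exp (- (real N * \<epsilon>)))"
  proof (rule sum_mono)
    fix k assume k: "k \<in> {1..K}"
    have "prob (\<Union>\<tau>\<in>cfg (Ch k). B k \<tau>) \<le> (\<Sum>\<tau>\<in>cfg (Ch k). prob (B k \<tau>))"
      using B_meas Ch_subset by (intro finite_measure_subadditive_finite finite_cfg) auto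
    also have "\<dots> \<le> (\<Sum>\<tau>\<in>cfg (Ch k). exp (- (real N * (V (Ch k) / 2 + \<epsilon>))))"
      by (intro sum_mono prob_B k)
    also have "\<dots> = real (card (cfg (Ch k))) * exp (- (real N * (V (Ch k) / 2 + \<epsilon>)))" by simp
    also have "\<dots> \<le> exp (real N * (ln 2 * gam \<gamma> (Ch k))) * exp (- (real N * (V (Ch k) / 2 + \<epsilon>)))"
      by (intro mult_right_mono card_cfg_upper Ch_subset) auto
    also have "ln 2 * gam \<gamma> (Ch k) = V (Ch k) / 2"
      using h_Ch[of k] k by (simp add: h_def)
    finally show "prob (\<Union>\<tau>\<in>cfg (Ch k). B k \<tau>) \<le> exp (- (real N * \<epsilon>))"
      by (simp add: algebra_simps flip: exp_add)
  qed
  finally show "prob (overshoot \<epsilon>) \<le> real K * exp (- (real N * \<epsilon>))" by simp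
qed

lemma small_Z_meas [measurable]: "small_Z \<epsilon> \<in> events"
  unfolding small_Z_def by measurable

lemma bad_meas [measurable]: "bad \<epsilon> \<in> events"
  unfolding bad_def by measurable

text \<open>Outside \<open>bad\<close>, the energy in excess of \<open>N * E0\<close> is the sum of
  the \<open>S k\<close> with weights \<open>wt k\<close>, each \<open>S k\<close> is at most
  \<open>N * \<epsilon>\<close>, and \<open>Z\<close> is not much below
  \<open>exp (\<beta> * N * E0)\<close>. This alone would give a bound without any dependence on
  \<sigma>. The point is to retain \<open>S K\<close>, which is the tilt, since its exponential has
  bounded total mean over \<open>C\<close>.\<close>

lemma G_upper:
  assumes "\<epsilon> \<ge> 0" "\<omega> \<in> space M" "\<omega> \<notin> bad \<epsilon>" "\<sigma> \<in> C"
  shows "G \<sigma> \<omega> \<le> exp (real N * (loss * \<epsilon>)) * exp (tilt \<sigma> \<omega>)"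
proof -
  define S where "S k = (\<Sum>J\<in>active a (Ch k). b J * y J \<sigma> \<omega>) - real N * V (Ch k)" for k
  have S_le: "S k \<le> real N * \<epsilon>" if k: "k \<in> {1..K}" for k
  proof -
    have "restrict \<sigma> (Ch k) \<in> cfg (Ch k)" by (rule restrict_cfg[OF assms(4) Ch_subset])
    then have "(\<Sum>J\<in>active a (Ch k). b J * y J (restrict \<sigma> (Ch k)) \<omega>) \<le> real N * (V (Ch k) + \<epsilon>)"
      using assms(2,3) k unfolding bad_def overshoot_def by force
    moreover have "(\<Sum>J\<in>active a (Ch k). b J * y J (restrict \<sigma> (Ch k)) \<omega>)
        = (\<Sum>J\<in>active a (Ch k). b J * y J \<sigma> \<omega>)"
      by (intro sum.cong refl) (auto simp: active_def Int_absorb1)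
    ultimately show ?thesis by (simp add: S_def algebra_simps)
  qed
  have "H \<sigma> \<omega> = (\<Sum>k\<in>{1..K}. wt k * (\<Sum>J\<in>active a (Ch k). b J * y J \<sigma> \<omega>))"
    unfolding hamiltonian_def by (rule sum_by_chain)
  moreover have "E0 = (\<Sum>k\<in>{1..K}. wt k * V (Ch k))"
    unfolding E0_def V_def by (subst sum_by_chain) (simp add: power2_eq_square mult_ac)
  ultimately have HE: "H \<sigma> \<omega> - real N * E0 = (\<Sum>k\<in>{1..K}. wt k * S k)"
    by (simp add: S_def right_diff_distrib sum_subtractf sum_distrib_left mult_ac)
  have "\<beta> * (H \<sigma> \<omega> - real N * E0) = (\<Sum>k\<in>{1..K}. \<beta> * wt k * S k)"
    unfolding HE by (simp add: sum_distrib_left mult_ac)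
  also have "\<dots> = (\<Sum>k\<in>{1..<K}. \<beta> * wt k * S k) + \<beta> * wt K * S K"
    using K_pos by (simp add: sum.last_plus atLeastLessThanSuc_atLeastAtMost[symmetric] flip: Suc_eq_plus1)
  also have "(\<Sum>k\<in>{1..<K}. \<beta> * wt k * S k) \<le> (\<Sum>k\<in>{1..<K}. \<beta> * wt k * (real N * \<epsilon>))"
    using \<beta>_pos wt_nonneg S_le by (intro sum_mono mult_left_mono) auto
  \<comment> \<open>One copy of \<open>S K\<close> is kept, which is possible because
    \<open>\<beta> * wt K \<ge> 1\<close>; only the surplus is estimated by
    \<open>N * \<epsilon>\<close>.\<close>
  also have "\<beta> * wt K * S K \<le> \<beta> * wt K * (real N * \<epsilon>) + S K"
  proof -
    have "(\<beta> * wt K - 1) * S K \<le> (\<beta> * wt K - 1) * (real N * \<epsilon>)"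
      using \<beta>_wt S_le[of K] K_pos by (intro mult_left_mono) auto
    also have "\<dots> \<le> \<beta> * wt K * (real N * \<epsilon>)" using assms(1) by (simp add: left_diff_distrib)
    finally show ?thesis by (simp add: left_diff_distrib)
  qed
  also have "(\<Sum>k\<in>{1..<K}. \<beta> * wt k * (real N * \<epsilon>)) + (\<beta> * wt K * (real N * \<epsilon>) + S K)
      = (\<Sum>k\<in>{1..K}. \<beta> * wt k * (real N * \<epsilon>)) + S K"
    using K_pos by (simp add: sum.last_plus atLeastLessThanSuc_atLeastAtMost[symmetric] flip: Suc_eq_plus1)
  also have "S K = tilt \<sigma> \<omega>" by (simp add: S_def tilt_def Ch_K)
  finally have "\<beta> * (H \<sigma> \<omega> - real N * E0) \<le> (\<Sum>k\<in>{1..K}. \<beta> * wt k * (real N * \<epsilon>)) + tilt \<sigma> \<omega>" by simp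
  then have exponent: "\<beta> * H \<sigma> \<omega> - \<beta> * (real N * ((1 - \<epsilon>) * E0)) \<le> real N * (loss * \<epsilon>) + tilt \<sigma> \<omega>"
    by (simp add: loss_def algebra_simps sum_distrib_left sum_distrib_right)
  have "Z \<omega> \<ge> exp (\<beta> * (real N * ((1 - \<epsilon>) * E0)))"
    using assms(2,3) by (auto simp: bad_def small_Z_def)
  then have "G \<sigma> \<omega> \<le> exp (\<beta> * H \<sigma> \<omega>) / exp (\<beta> * (real N * ((1 - \<epsilon>) * E0)))"
    unfolding G_eq by (intro divide_left_mono mult_pos_pos Z_pos) auto
  also have "\<dots> \<le> exp (real N * (loss * \<epsilon>) + tilt \<sigma> \<omega>)"
    using exponent by (simp flip: exp_diff)
  finally show ?thesis by (simp add: exp_add)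
qed

section \<open>Deviations of single bonds and overlaps of pairs\<close>

definition dev :: "nat set \<Rightarrow> real \<Rightarrow> real" where
  "dev J \<delta> = expectation (\<lambda>\<omega>. \<Sum>\<sigma>\<in>C. G \<sigma> \<omega> *
     indicator {\<omega>\<in>space M. \<bar>y J \<sigma> \<omega> - real N * (a J * b J)\<bar> > real N * \<delta>} \<omega>)"

definition ov_prob :: "nat set \<Rightarrow> real" where
  "ov_prob A = expectation (\<lambda>\<omega>. \<Sum>\<sigma>\<in>C. \<Sum>\<tau>\<in>C. G \<sigma> \<omega> * G \<tau> \<omega> * of_bool (ov \<sigma> \<tau> = A))"

lemma integrable_G_ind:
  assumes "\<sigma> \<in> C" "A \<in> events" shows "integrable M (\<lambda>\<omega>. G \<sigma> \<omega> * indicator A \<omega>)"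
proof (rule integrable_const_bound[where B = 1])
  show "AE x in M. norm (G \<sigma> x * indicator A x) \<le> 1"
    using G_le_1[OF assms(1)] G_nonneg by (auto split: split_indicator)
  show "(\<lambda>\<omega>. G \<sigma> \<omega> * indicator A \<omega>) \<in> borel_measurable M" using assms by measurable
qed

lemma integrable_GG:
  assumes "\<sigma> \<in> C" "\<tau> \<in> C" shows "integrable M (\<lambda>\<omega>. G \<sigma> \<omega> * G \<tau> \<omega>)"
proof (rule integrable_const_bound[where B = 1])
  show "AE x in M. norm (G \<sigma> x * G \<tau> x) \<le> 1"
    using G_le_1[OF assms(1)] G_le_1[OF assms(2)] G_nonneg by (intro AE_I2) (simp add: mult_le_one)
  show "(\<lambda>\<omega>. G \<sigma> \<omega> * G \<tau> \<omega>) \<in> borel_measurable M" using assms by measurable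
qed

lemma dev_meas:
  "J \<in> P \<Longrightarrow> \<sigma> \<in> C \<Longrightarrow> {\<omega>\<in>space M. \<bar>y J \<sigma> \<omega> - real N * (a J * b J)\<bar> > real N * \<delta>} \<in> events"
  using y_meas[of J \<sigma>] by measurable

text \<open>Outside \<open>bad\<close> the weight is bounded by the critical tilt, and a Chernoff
  bound in the single bond \<open>J\<close> is put on top of it, with one extra tilt for each sign.
  The critical tilt already moves the mean of that bond to \<open>N * (a J * b J)\<close>, and its
  total mass is compensated by the entropy. Inside \<open>bad\<close> the Gibbs mass is at most
  one.\<close>

lemma dev_bound:
  assumes J: "J \<in> P" and "\<epsilon> \<ge> 0" "\<delta> > 0"
  shows "dev J \<delta> \<le> prob (bad \<epsilon>) + 2 * exp (real N * (loss * \<epsilon> - \<delta>\<^sup>2 / (2 * a J)))"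
proof -
  \<comment> \<open>This maximizes \<open>s * \<delta> - s\<^sup>2 * a J / 2\<close>, with value
    \<open>\<delta>\<^sup>2 / (2 * a J)\<close>.\<close>
  define s where "s = \<delta> / a J"
  have aJ: "a J > 0" using J by (rule a_pos)
  define \<theta> where "\<theta> u J' = b J' + (if J' = J then u else 0)" for u J'
  define W where "W u \<sigma> \<omega> = exp (\<Sum>J'\<in>P. \<theta> u J' * y J' \<sigma> \<omega>)" for u \<sigma> \<omega>
  define c where "c u = exp (- (real N * (V I + u * (a J * b J) + s * \<delta>)))" for u
  have W_eq: "c u * W u \<sigma> \<omega> = exp (tilt \<sigma> \<omega> + u * (y J \<sigma> \<omega> - real N * (a J * b J)) - real N * (s * \<delta>))" for u \<sigma> \<omega>
  proof -
    have "(\<Sum>J'\<in>P. \<theta> u J' * y J' \<sigma> \<omega>) = (\<Sum>J'\<in>P. b J' * y J' \<sigma> \<omega> + (if J' = J then u * y J' \<sigma> \<omega> else 0))"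
      by (intro sum.cong refl) (simp add: \<theta>_def algebra_simps)
    also have "\<dots> = (\<Sum>J'\<in>P. b J' * y J' \<sigma> \<omega>) + u * y J \<sigma> \<omega>"
      using J by (simp add: sum.distrib)
    finally have "W u \<sigma> \<omega> = exp ((\<Sum>J'\<in>P. b J' * y J' \<sigma> \<omega>) + u * y J \<sigma> \<omega>)"
      unfolding W_def by (rule arg_cong)
    then show ?thesis
      unfolding c_def tilt_def by (simp add: algebra_simps flip: exp_add)
  qed
  have sq: "(\<Sum>J'\<in>P. (\<theta> u J')\<^sup>2 * a J' / 2) = V I / 2 + u * (a J * b J) + u\<^sup>2 * a J / 2" for u
  proof -
    have "(\<Sum>J'\<in>P. (\<theta> u J')\<^sup>2 * a J' / 2) = (\<Sum>J'\<in>P. a J' * (b J')\<^sup>2 / 2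
        + (if J' = J then u * (a J' * b J') + u\<^sup>2 * a J' / 2 else 0))"
      by (intro sum.cong refl) (simp add: \<theta>_def power2_eq_square field_simps)
    also have "\<dots> = V I / 2 + (u * (a J * b J) + u\<^sup>2 * a J / 2)"
      using J by (simp add: sum.distrib V_def sum_divide_distrib)
    finally show ?thesis by simp
  qed
  have W_int: "integrable M (W u \<sigma>)" if "\<sigma> \<in> C" for u \<sigma>
    unfolding W_def by (rule mgf_one(2)[OF order_refl that])
  have W_exp: "c u * expectation (W u \<sigma>) = exp (- (real N * (V I / 2 + \<delta>\<^sup>2 / (2 * a J))))"
    if "\<sigma> \<in> C" "u = s \<or> u = - s" for u \<sigma>
  proof -
    have "u\<^sup>2 = s\<^sup>2" using that(2) by auto
    have "expectation (W u \<sigma>) = exp (real N * (V I / 2 + u * (a J * b J) + u\<^sup>2 * a J / 2))"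
      unfolding W_def mgf_one(1)[OF order_refl that(1)] sq ..
    then have "c u * expectation (W u \<sigma>) = exp (- (real N * (V I / 2 + (s * \<delta> - s\<^sup>2 * a J / 2))))"
      unfolding c_def \<open>u\<^sup>2 = s\<^sup>2\<close> by (simp add: algebra_simps flip: exp_add)
    also have "s * \<delta> - s\<^sup>2 * a J / 2 = \<delta>\<^sup>2 / (2 * a J)"
      using aJ by (simp add: s_def power2_eq_square field_simps)
    finally show ?thesis .
  qed
  define D where "D \<sigma> = {\<omega>\<in>space M. \<bar>y J \<sigma> \<omega> - real N * (a J * b J)\<bar> > real N * \<delta>}" for \<sigma>
  have D_le: "indicator (D \<sigma>) \<omega> * exp (tilt \<sigma> \<omega>) \<le> c s * W s \<sigma> \<omega> + c (- s) * W (- s) \<sigma> \<omega>" for \<sigma> \<omega>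
  proof -
    define u where "u = y J \<sigma> \<omega> - real N * (a J * b J)"
    have s_pos: "s > 0" using aJ assms(3) by (simp add: s_def)
    show ?thesis
    proof (cases "\<omega> \<in> D \<sigma>")
      case True
      then have "u > real N * \<delta> \<or> - u > real N * \<delta>" by (auto simp: D_def u_def)
      then have "s * (real N * \<delta>) \<le> s * u \<or> s * (real N * \<delta>) \<le> s * - u"
        using s_pos mult_le_cancel_left_pos[OF s_pos] by (metis less_imp_le)
      then have "tilt \<sigma> \<omega> \<le> tilt \<sigma> \<omega> + s * u - real N * (s * \<delta>) \<or>
          tilt \<sigma> \<omega> \<le> tilt \<sigma> \<omega> + (- s) * u - real N * (s * \<delta>)" by (auto simp: mult_ac)
      then have "exp (tilt \<sigma> \<omega>) \<le> c s * W s \<sigma> \<omega> \<or> exp (tilt \<sigma> \<omega>) \<le> c (- s) * W (- s) \<sigma> \<omega>"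
        unfolding W_eq u_def[symmetric] by simp
      moreover have "c s * W s \<sigma> \<omega> \<ge> 0" "c (- s) * W (- s) \<sigma> \<omega> \<ge> 0" by (auto simp: W_def c_def)
      ultimately show ?thesis using True by auto
    qed (simp add: W_def c_def)
  qed
  have "dev J \<delta> \<le> expectation (\<lambda>\<omega>. indicator (bad \<epsilon>) \<omega>
      + exp (real N * (loss * \<epsilon>)) * (\<Sum>\<sigma>\<in>C. c s * W s \<sigma> \<omega> + c (- s) * W (- s) \<sigma> \<omega>))"
    unfolding dev_def D_def[symmetric]
  proof (rule integral_mono)
    show "integrable M (\<lambda>\<omega>. \<Sum>\<sigma>\<in>C. G \<sigma> \<omega> * indicator (D \<sigma>) \<omega>)"
      unfolding D_def by (intro Bochner_Integration.integrable_sum integrable_G_ind dev_meas J)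
    show "integrable M (\<lambda>\<omega>. indicator (bad \<epsilon>) \<omega>
      + exp (real N * (loss * \<epsilon>)) * (\<Sum>\<sigma>\<in>C. c s * W s \<sigma> \<omega> + c (- s) * W (- s) \<sigma> \<omega>))"
      using W_int by (auto intro!: Bochner_Integration.integrable_add integrable_mult_right
          Bochner_Integration.integrable_sum integrable_ind)
    fix \<omega> assume \<omega>: "\<omega> \<in> space M"
    have RHS: "(\<Sum>\<sigma>\<in>C. c s * W s \<sigma> \<omega> + c (- s) * W (- s) \<sigma> \<omega>) \<ge> 0"
      by (intro sum_nonneg) (auto simp: W_def c_def)
    show "(\<Sum>\<sigma>\<in>C. G \<sigma> \<omega> * indicator (D \<sigma>) \<omega>) \<le> indicator (bad \<epsilon>) \<omega>
      + exp (real N * (loss * \<epsilon>)) * (\<Sum>\<sigma>\<in>C. c s * W s \<sigma> \<omega> + c (- s) * W (- s) \<sigma> \<omega>)"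
    proof (cases "\<omega> \<in> bad \<epsilon>")
      case True
      have "(\<Sum>\<sigma>\<in>C. G \<sigma> \<omega> * indicator (D \<sigma>) \<omega>) \<le> (\<Sum>\<sigma>\<in>C. G \<sigma> \<omega>)"
        using G_nonneg by (intro sum_mono) (auto split: split_indicator)
      then show ?thesis using True RHS sum_G[of \<omega>] by (simp add: add_increasing2)
    next
      case False
      have "G \<sigma> \<omega> * indicator (D \<sigma>) \<omega>
          \<le> exp (real N * (loss * \<epsilon>)) * (c s * W s \<sigma> \<omega> + c (- s) * W (- s) \<sigma> \<omega>)" if "\<sigma> \<in> C" for \<sigma>
      proof -
        have "G \<sigma> \<omega> * indicator (D \<sigma>) \<omega>
            \<le> exp (real N * (loss * \<epsilon>)) * exp (tilt \<sigma> \<omega>) * indicator (D \<sigma>) \<omega>"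
          by (intro mult_right_mono G_upper assms \<omega> False that) auto
        also have "\<dots> = exp (real N * (loss * \<epsilon>)) * (indicator (D \<sigma>) \<omega> * exp (tilt \<sigma> \<omega>))" by simp
        also have "\<dots> \<le> exp (real N * (loss * \<epsilon>)) * (c s * W s \<sigma> \<omega> + c (- s) * W (- s) \<sigma> \<omega>)"
          by (intro mult_left_mono D_le) auto
        finally show ?thesis .
      qed
      then have "(\<Sum>\<sigma>\<in>C. G \<sigma> \<omega> * indicator (D \<sigma>) \<omega>)
          \<le> (\<Sum>\<sigma>\<in>C. exp (real N * (loss * \<epsilon>)) * (c s * W s \<sigma> \<omega> + c (- s) * W (- s) \<sigma> \<omega>))"
        by (rule sum_mono)
      then show ?thesis using False by (simp only: sum_distrib_left[symmetric]) simp
    qed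
  qed
  also have "\<dots> = prob (bad \<epsilon>) + exp (real N * (loss * \<epsilon>)) *
      (\<Sum>\<sigma>\<in>C. c s * expectation (W s \<sigma>) + c (- s) * expectation (W (- s) \<sigma>))"
    using W_int by (subst Bochner_Integration.integral_add) (auto simp: Bochner_Integration.integral_sum integrable_ind)
  also have "(\<Sum>\<sigma>\<in>C. c s * expectation (W s \<sigma>) + c (- s) * expectation (W (- s) \<sigma>))
      = real (card C) * (2 * exp (- (real N * (V I / 2 + \<delta>\<^sup>2 / (2 * a J)))))"
    using W_exp by simp
  also have "\<dots> \<le> exp (real N * (ln 2 * gam \<gamma> I)) * (2 * exp (- (real N * (V I / 2 + \<delta>\<^sup>2 / (2 * a J)))))"
    by (intro mult_right_mono card_cfg_upper) auto
  also have "\<dots> = 2 * exp (- (real N * (\<delta>\<^sup>2 / (2 * a J))))"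
    by (simp add: V_I algebra_simps flip: exp_add)
  finally show ?thesis by (simp add: algebra_simps flip: exp_add)
qed

text \<open>Multiplying two weight bounds would tilt the shared bonds twice, and their generating
  function would be too large. Away from deviations the shared energies are known, so the second
  tilt on them is replaced by a constant. The remaining mean is
  \<open>exp (N * (V I - V A / 2))\<close>, and counting pairs with overlap \<open>A\<close> turns
  it into the rate \<open>- h A / 2\<close>.\<close>

lemma ov_prob_bound:
  assumes A: "A \<subseteq> I" and "\<epsilon> \<ge> 0" "\<delta> > 0"
  shows "ov_prob A \<le> prob (bad \<epsilon>) + (\<Sum>J\<in>P. dev J \<delta>)
    + exp (real N * (2 * (loss * \<epsilon>) + \<delta> * (\<Sum>J\<in>P. b J) - h A / 2))"
proof -
  define D where "D J \<sigma> = {\<omega>\<in>space M. \<bar>y J \<sigma> \<omega> - real N * (a J * b J)\<bar> > real N * \<delta>}" for J \<sigma>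
  define off where "off \<sigma> \<tau> = {J\<in>P. \<not> J \<subseteq> ov \<sigma> \<tau>}" for \<sigma> \<tau>
  define W where "W \<sigma> \<tau> \<omega> = exp ((\<Sum>J\<in>P. b J * y J \<sigma> \<omega>) + (\<Sum>J\<in>off \<sigma> \<tau>. b J * y J \<tau> \<omega>))" for \<sigma> \<tau> \<omega>
  \<comment> \<open>\<open>- 2 * V I\<close> is the centring of the two tilts, the terms with
    \<open>V A\<close> and \<delta> bound the shared bonds of \<tau>, and
    \<open>2 * (loss * \<epsilon>)\<close> comes from the two weight bounds.\<close>
  define c where "c = exp (real N * (2 * (loss * \<epsilon>) + V A + \<delta> * (\<Sum>J\<in>P. b J) - 2 * V I))"
  define L where "L \<omega> = (\<Sum>J\<in>P. \<Sum>\<sigma>\<in>C. G \<sigma> \<omega> * indicator (D J \<sigma>) \<omega>)" for \<omega>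
  define R where "R \<omega> = (\<Sum>\<sigma>\<in>C. \<Sum>\<tau>\<in>C. of_bool (ov \<sigma> \<tau> = A) * (c * W \<sigma> \<tau> \<omega>))" for \<omega>
  have AP: "active a A \<subseteq> P" using A by (rule active_mono)
  have L_int: "integrable M L"
    unfolding L_def D_def
    by (intro Bochner_Integration.integrable_sum integrable_G_ind dev_meas)
  have L_exp: "expectation L = (\<Sum>J\<in>P. dev J \<delta>)"
    unfolding L_def dev_def D_def
    by (intro Bochner_Integration.integral_sum Bochner_Integration.integrable_sum
        integrable_G_ind dev_meas)
  have W_int: "integrable M (W \<sigma> \<tau>)" if "\<sigma> \<in> C" "\<tau> \<in> C" for \<sigma> \<tau>
    unfolding W_def off_def by (rule mgf_pair(2)[OF that])
  have R_int: "integrable M R"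
    unfolding R_def using W_int by (intro Bochner_Integration.integrable_sum integrable_mult_right) auto
  have W_exp: "c * expectation (W \<sigma> \<tau>) = exp (real N * (2 * (loss * \<epsilon>) + \<delta> * (\<Sum>J\<in>P. b J) + V A / 2 - V I))"
    if "\<sigma> \<in> C" "\<tau> \<in> C" "ov \<sigma> \<tau> = A" for \<sigma> \<tau>
  proof -
    have half_V: "(\<Sum>J\<in>active a B. (b J)\<^sup>2 * a J / 2) = V B / 2" for B
      by (simp add: V_def sum_divide_distrib mult_ac)
    have off: "off \<sigma> \<tau> = P - active a A"
      using that(3) by (auto simp: off_def active_def)
    have "(\<Sum>J\<in>off \<sigma> \<tau>. (b J)\<^sup>2 * a J / 2) = (\<Sum>J\<in>P. (b J)\<^sup>2 * a J / 2) - (\<Sum>J\<in>active a A. (b J)\<^sup>2 * a J / 2)"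
      unfolding off by (rule sum_diff) (use AP in auto)
    then have "(\<Sum>J\<in>P. (b J)\<^sup>2 * a J / 2) + (\<Sum>J\<in>off \<sigma> \<tau>. (b J)\<^sup>2 * a J / 2) = V I - V A / 2"
      unfolding half_V by simp
    then have "expectation (W \<sigma> \<tau>) = exp (real N * (V I - V A / 2))"
      unfolding W_def off_def mgf_pair(1)[OF that(1,2)] by simp
    then show ?thesis unfolding c_def by (simp add: algebra_simps flip: exp_add)
  qed
  have "ov_prob A \<le> expectation (\<lambda>\<omega>. indicator (bad \<epsilon>) \<omega> + L \<omega> + R \<omega>)"
    unfolding ov_prob_def
  proof (rule integral_mono)
    show "integrable M (\<lambda>\<omega>. \<Sum>\<sigma>\<in>C. \<Sum>\<tau>\<in>C. G \<sigma> \<omega> * G \<tau> \<omega> * of_bool (ov \<sigma> \<tau> = A))"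
      by (intro Bochner_Integration.integrable_sum integrable_mult_left integrable_GG)
    show "integrable M (\<lambda>\<omega>. indicator (bad \<epsilon>) \<omega> + L \<omega> + R \<omega>)"
      using L_int R_int integrable_ind[OF bad_meas] by auto
    fix \<omega> assume \<omega>: "\<omega> \<in> space M"
    have L0: "L \<omega> \<ge> 0" unfolding L_def using G_nonneg by (intro sum_nonneg mult_nonneg_nonneg) auto
    have R0: "R \<omega> \<ge> 0" unfolding R_def by (intro sum_nonneg mult_nonneg_nonneg) (auto simp: W_def c_def)
    show "(\<Sum>\<sigma>\<in>C. \<Sum>\<tau>\<in>C. G \<sigma> \<omega> * G \<tau> \<omega> * of_bool (ov \<sigma> \<tau> = A))
        \<le> indicator (bad \<epsilon>) \<omega> + L \<omega> + R \<omega>"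
    proof (cases "\<omega> \<in> bad \<epsilon>")
      case True
      have "(\<Sum>\<sigma>\<in>C. \<Sum>\<tau>\<in>C. G \<sigma> \<omega> * G \<tau> \<omega> * of_bool (ov \<sigma> \<tau> = A)) \<le> (\<Sum>\<sigma>\<in>C. \<Sum>\<tau>\<in>C. G \<sigma> \<omega> * G \<tau> \<omega>)"
        using G_nonneg by (intro sum_mono) auto
      also have "\<dots> = 1" by (simp add: sum_G flip: sum_product)
      finally show ?thesis using True L0 R0 by simp
    next
      case False
      have main: "G \<sigma> \<omega> * G \<tau> \<omega> * of_bool (ov \<sigma> \<tau> = A)
          \<le> (\<Sum>J\<in>P. G \<sigma> \<omega> * indicator (D J \<sigma>) \<omega>) * G \<tau> \<omega> + of_bool (ov \<sigma> \<tau> = A) * (c * W \<sigma> \<tau> \<omega>)"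
        if \<sigma>: "\<sigma> \<in> C" and \<tau>: "\<tau> \<in> C" for \<sigma> \<tau>
      proof (cases "ov \<sigma> \<tau> = A \<and> (\<forall>J\<in>P. \<omega> \<notin> D J \<sigma>)")
        case True
        \<comment> \<open>A shared bond of \<tau> carries the same variable as for \<sigma>, so the
          absence of deviations for \<sigma> controls it.\<close>
        have yA: "b J * y J \<tau> \<omega> \<le> real N * (a J * (b J)\<^sup>2 + \<delta> * b J)" if J: "J \<in> active a A" for J
        proof -
          have "J \<in> P" using J AP by auto
          then have "y J \<sigma> \<omega> \<le> real N * (a J * b J) + real N * \<delta>"
            using True \<omega> by (auto simp: D_def abs_le_iff not_less)
          moreover have "restrict \<sigma> J = restrict \<tau> J"
            using restrict_eq_iff[OF P_subset[OF \<open>J \<in> P\<close>]] True J by (auto simp: active_def)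
          ultimately have "b J * y J \<tau> \<omega> \<le> b J * (real N * (a J * b J) + real N * \<delta>)"
            using bcrit_pos[OF \<open>J \<in> P\<close>] by (intro mult_left_mono) auto
          then show ?thesis by (simp add: algebra_simps power2_eq_square)
        qed
        have "P - active a A = off \<sigma> \<tau>" using True by (auto simp: off_def active_def)
        then have "(\<Sum>J\<in>P. b J * y J \<tau> \<omega>)
            = (\<Sum>J\<in>off \<sigma> \<tau>. b J * y J \<tau> \<omega>) + (\<Sum>J\<in>active a A. b J * y J \<tau> \<omega>)"
          using sum.subset_diff[OF AP, of "\<lambda>J. b J * y J \<tau> \<omega>"] by simp
        also have "(\<Sum>J\<in>active a A. b J * y J \<tau> \<omega>) \<le> (\<Sum>J\<in>active a A. real N * (a J * (b J)\<^sup>2 + \<delta> * b J))"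
          by (intro sum_mono yA)
        also have "\<dots> = real N * (V A + \<delta> * (\<Sum>J\<in>active a A. b J))"
          by (simp add: V_def sum.distrib sum_distrib_left distrib_left)
        also have "\<dots> \<le> real N * (V A + \<delta> * (\<Sum>J\<in>P. b J))"
          using AP bcrit_pos assms(3)
          by (intro mult_left_mono add_left_mono sum_mono2) (auto intro: less_imp_le)
        finally have "tilt \<sigma> \<omega> + tilt \<tau> \<omega> \<le> (\<Sum>J\<in>P. b J * y J \<sigma> \<omega>) + (\<Sum>J\<in>off \<sigma> \<tau>. b J * y J \<tau> \<omega>)
            + real N * (V A + \<delta> * (\<Sum>J\<in>P. b J) - 2 * V I)"
          by (simp add: tilt_def algebra_simps del: restrict_apply)
        then have *: "real N * (loss * \<epsilon>) + tilt \<sigma> \<omega> + (real N * (loss * \<epsilon>) + tilt \<tau> \<omega>)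
            \<le> real N * (2 * (loss * \<epsilon>) + V A + \<delta> * (\<Sum>J\<in>P. b J) - 2 * V I)
              + ((\<Sum>J\<in>P. b J * y J \<sigma> \<omega>) + (\<Sum>J\<in>off \<sigma> \<tau>. b J * y J \<tau> \<omega>))"
          by (simp add: algebra_simps)
        have "G \<sigma> \<omega> * G \<tau> \<omega> \<le> exp (real N * (loss * \<epsilon>) + tilt \<sigma> \<omega>) * exp (real N * (loss * \<epsilon>) + tilt \<tau> \<omega>)"
          unfolding exp_add using G_upper[OF assms(2) \<omega> False] \<sigma> \<tau> G_nonneg
          by (intro mult_mono) auto
        also have "\<dots> \<le> c * W \<sigma> \<tau> \<omega>"
          unfolding c_def W_def exp_add[symmetric] using * by simp
        finally have "G \<sigma> \<omega> * G \<tau> \<omega> \<le> c * W \<sigma> \<tau> \<omega>" .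
        moreover have "(\<Sum>J\<in>P. G \<sigma> \<omega> * indicator (D J \<sigma>) \<omega>) * G \<tau> \<omega> \<ge> 0"
          using G_nonneg by (intro mult_nonneg_nonneg sum_nonneg) auto
        ultimately show ?thesis using True by simp
      next
        case False
        have cW: "of_bool (ov \<sigma> \<tau> = A) * (c * W \<sigma> \<tau> \<omega>) \<ge> 0" by (simp add: c_def W_def)
        have s0: "(\<Sum>J\<in>P. G \<sigma> \<omega> * indicator (D J \<sigma>) \<omega>) * G \<tau> \<omega> \<ge> 0"
          using G_nonneg by (intro mult_nonneg_nonneg sum_nonneg) auto
        show ?thesis
        proof (cases "ov \<sigma> \<tau> = A")
          case True
          then obtain J where J: "J \<in> P" "\<omega> \<in> D J \<sigma>" using \<open>\<not> (_ \<and> _)\<close> by auto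
          have "G \<sigma> \<omega> * indicator (D J \<sigma>) \<omega> \<le> (\<Sum>J\<in>P. G \<sigma> \<omega> * indicator (D J \<sigma>) \<omega>)"
            using G_nonneg J by (intro member_le_sum) auto
          then have "G \<sigma> \<omega> * G \<tau> \<omega> \<le> (\<Sum>J\<in>P. G \<sigma> \<omega> * indicator (D J \<sigma>) \<omega>) * G \<tau> \<omega>"
            using J G_nonneg by (intro mult_right_mono) auto
          then show ?thesis using True cW by simp
        next
          case False
          then show ?thesis using s0 by simp
        qed
      qed
      have "(\<Sum>\<sigma>\<in>C. \<Sum>\<tau>\<in>C. G \<sigma> \<omega> * G \<tau> \<omega> * of_bool (ov \<sigma> \<tau> = A))
          \<le> (\<Sum>\<sigma>\<in>C. \<Sum>\<tau>\<in>C. (\<Sum>J\<in>P. G \<sigma> \<omega> * indicator (D J \<sigma>) \<omega>) * G \<tau> \<omega>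
              + of_bool (ov \<sigma> \<tau> = A) * (c * W \<sigma> \<tau> \<omega>))"
        by (intro sum_mono main)
      also have "\<dots> = (\<Sum>\<sigma>\<in>C. \<Sum>J\<in>P. G \<sigma> \<omega> * indicator (D J \<sigma>) \<omega>) + R \<omega>"
        unfolding sum.distrib R_def sum_distrib_left[symmetric] sum_G by simp
      also have "(\<Sum>\<sigma>\<in>C. \<Sum>J\<in>P. G \<sigma> \<omega> * indicator (D J \<sigma>) \<omega>) = L \<omega>"
        unfolding L_def by (rule sum.swap)
      finally show ?thesis using False by simp
    qed
  qed
  also have "\<dots> = prob (bad \<epsilon>) + (\<Sum>J\<in>P. dev J \<delta>) + expectation R"
    using L_int R_int integrable_ind[OF bad_meas] by (simp add: L_exp)
  also have "expectation R = (\<Sum>\<sigma>\<in>C. \<Sum>\<tau>\<in>C. of_bool (ov \<sigma> \<tau> = A) * (c * expectation (W \<sigma> \<tau>)))"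
    unfolding R_def using W_int
    by (subst Bochner_Integration.integral_sum)
      (auto intro!: sum.cong Bochner_Integration.integrable_sum simp: Bochner_Integration.integral_sum)
  also have "\<dots> = (\<Sum>\<sigma>\<in>C. \<Sum>\<tau>\<in>C. (\<lambda>B. of_bool (B = A) *
      exp (real N * (2 * (loss * \<epsilon>) + \<delta> * (\<Sum>J\<in>P. b J) + V A / 2 - V I))) (ov \<sigma> \<tau>))"
    by (intro sum.cong refl) (use W_exp in auto)
  also have "\<dots> \<le> (\<Sum>\<sigma>\<in>C. \<Sum>B\<in>Pow I. real (card (cfg (I - B))) * (of_bool (B = A) *
      exp (real N * (2 * (loss * \<epsilon>) + \<delta> * (\<Sum>J\<in>P. b J) + V A / 2 - V I))))"
    by (intro sum_mono sum_ov_le) auto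
  also have "\<dots> = real (card C) * (real (card (cfg (I - A))) *
      exp (real N * (2 * (loss * \<epsilon>) + \<delta> * (\<Sum>J\<in>P. b J) + V A / 2 - V I)))"
  proof -
    have "(\<Sum>B\<in>Pow I. real (card (cfg (I - B))) * (of_bool (B = A) * x))
        = (\<Sum>B\<in>Pow I. if B = A then real (card (cfg (I - A))) * x else 0)" for x :: real
      by (intro sum.cong) auto
    then show ?thesis using A by simp
  qed
  also have "\<dots> \<le> exp (real N * (ln 2 * gam \<gamma> I)) * (exp (real N * (ln 2 * gam \<gamma> (I - A))) *
      exp (real N * (2 * (loss * \<epsilon>) + \<delta> * (\<Sum>J\<in>P. b J) + V A / 2 - V I)))"
    by (intro mult_mono card_cfg_upper mult_nonneg_nonneg) auto
  also have "\<dots> = exp (real N * (2 * (loss * \<epsilon>) + \<delta> * (\<Sum>J\<in>P. b J) - h A / 2))"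
  proof -
    have g: "gam \<gamma> (I - A) = gam \<gamma> I - gam \<gamma> A" unfolding gam_def using A by (subst sum_diff) auto
    have "ln 2 * gam \<gamma> I + (ln 2 * gam \<gamma> (I - A) + (2 * (loss * \<epsilon>) + \<delta> * (\<Sum>J\<in>P. b J) + V A / 2 - V I))
        = 2 * (loss * \<epsilon>) + \<delta> * (\<Sum>J\<in>P. b J) - h A / 2"
      unfolding g h_def V_I by (simp add: field_simps)
    then show ?thesis by (simp only: exp_add[symmetric] distrib_left[symmetric])
  qed
  finally show ?thesis by simp
qed

section \<open>Second moment lower bound for the partition function\<close>

definition tail :: "real \<Rightarrow> nat set \<Rightarrow> real" where
  "tail \<epsilon> J = measure (density lborel (\<lambda>x. ennreal (normal_density 0 (sqrt (a J * real N)) x)))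
     {(1 - \<epsilon>) * (a J * b J) * real N..}"

lemma tail_pos:
  assumes "J \<in> P" "\<epsilon> \<le> 1" shows "tail \<epsilon> J > 0"
proof -
  have v: "a J * real N > 0" using a_pos[OF assms(1)] N_pos by simp
  have x: "(1 - \<epsilon>) * (a J * b J) * real N \<ge> 0"
    using assms a_pos[OF assms(1)] bcrit_pos[OF assms(1)] by simp
  have "0 < normal_density 0 (sqrt (a J * real N)) ((1 - \<epsilon>) * (a J * b J) * real N + 1)"
    using v by (intro normal_density_pos) simp
  also note normal_tail_lower[OF v x]
  finally show ?thesis unfolding tail_def .
qed

text \<open>\<open>L\<close> counts the configurations whose bonds all reach the fraction
  \<open>1 - \<epsilon>\<close> of their target; a single one makes \<open>Z\<close> large. Asking
  this of each bond, rather than of the total energy, makes the indicator a product of independent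
  factors, so a pair with overlap \<open>A\<close> gains exactly the factor \<open>1 / q A\<close>
  over independence. Chebyshev's inequality for \<open>L\<close> leaves the sum over nonempty
  overlaps.\<close>

lemma prob_small_Z:
  assumes "0 \<le> \<epsilon>" "\<epsilon> \<le> 1"
  shows "prob (small_Z \<epsilon>)
    \<le> (\<Sum>A\<in>Pow I - {{}}. 1 / (real (card (cfg A)) * (\<Prod>J\<in>active a A. tail \<epsilon> J)))"
proof -
  define x where "x J = (1 - \<epsilon>) * (a J * b J) * real N" for J
  define f :: "nat set \<Rightarrow> real \<Rightarrow> real" where "f J = indicator {x J..}" for J
  define ind where "ind \<sigma> \<omega> = (\<Prod>J\<in>P. f J (y J \<sigma> \<omega>))" for \<sigma> \<omega>
  define L where "L \<omega> = (\<Sum>\<sigma>\<in>C. ind \<sigma> \<omega>)" for \<omega>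
  define q where "q A = (\<Prod>J\<in>active a A. tail \<epsilon> J)" for A
  define m where "m = real (card C) * q I"
  have q_pos: "q A > 0" if "A \<subseteq> I" for A
    unfolding q_def using tail_pos assms active_mono[OF that] by (intro prod_pos) auto
  have m_pos: "m > 0" unfolding m_def using q_pos[of I] card_cfg_pos[of I] by simp
  have f_int: "integrable M (\<lambda>\<omega>. f J (X J \<tau> \<omega>))"
    and f_exp: "expectation (\<lambda>\<omega>. f J (X J \<tau> \<omega>)) = tail \<epsilon> J" if "J \<in> P" "\<tau> \<in> cfg J" for J \<tau>
  proof -
    note [measurable] = X_meas[OF that]
    show "integrable M (\<lambda>\<omega>. f J (X J \<tau> \<omega>))"
      by (rule integrable_const_bound[where B = 1]) (auto simp: f_def split: split_indicator)
    have "distr M borel (X J \<tau>) = density lborel (\<lambda>x. ennreal (normal_density 0 (sqrt (a J * real N)) x))"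
      using normal_X[OF that] by (simp add: distributed_def cong: distr_cong)
    then have "tail \<epsilon> J = (\<integral>z. f J z \<partial>distr M borel (X J \<tau>))"
      by (simp add: tail_def f_def x_def)
    also have "\<dots> = expectation (\<lambda>\<omega>. f J (X J \<tau> \<omega>))"
      by (rule integral_distr) (auto simp: f_def)
    finally show "expectation (\<lambda>\<omega>. f J (X J \<tau> \<omega>)) = tail \<epsilon> J" by simp
  qed
  have pair: "integrable M (\<lambda>\<omega>. ind \<sigma> \<omega> * ind \<tau> \<omega>)"
    "expectation (\<lambda>\<omega>. ind \<sigma> \<omega> * ind \<tau> \<omega>) = q I * q I / q (ov \<sigma> \<tau>)"
    if \<sigma>: "\<sigma> \<in> C" and \<tau>: "\<tau> \<in> C" for \<sigma> \<tau>
  proof -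
    define D where "D = {J\<in>P. \<not> J \<subseteq> ov \<sigma> \<tau>}"
    define S where "S = (\<lambda>J. (J, restrict \<sigma> J)) ` P \<union> (\<lambda>J. (J, restrict \<tau> J)) ` D"
    note PI = pair_index[OF \<sigma> \<tau>, folded D_def, folded S_def]
    \<comment> \<open>A shared bond produces the square of one indicator, so its second factor may
      be dropped.\<close>
    have "f J (y J \<sigma> \<omega>) * f J (y J \<tau> \<omega>) = f J (y J \<sigma> \<omega>) * (if J \<in> D then f J (y J \<tau> \<omega>) else 1)"
      if "J \<in> P" for J \<omega>
      using that restrict_eq_iff[OF P_subset[OF that], of \<sigma> \<tau>] by (auto simp: D_def f_def split: split_indicator)
    then have "ind \<sigma> \<omega> * ind \<tau> \<omega> = (\<Prod>J\<in>P. f J (y J \<sigma> \<omega>)) * (\<Prod>J\<in>P. if J \<in> D then f J (y J \<tau> \<omega>) else 1)" for \<omega>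
      unfolding ind_def prod.distrib[symmetric] by (intro prod.cong refl)
    also have "(\<Prod>J\<in>P. if J \<in> D then f J (y J \<tau> \<omega>) else 1) = (\<Prod>J\<in>D. f J (y J \<tau> \<omega>))" for \<omega>
      by (simp add: prod.If_cases D_def Int_def)
    finally have eq: "ind \<sigma> \<omega> * ind \<tau> \<omega> = (\<Prod>(J, \<rho>)\<in>S. f J (X J \<rho> \<omega>))" for \<omega>
      unfolding PI(4) .
    have prod_eq: "(\<Prod>t\<in>S. (case t of (J, \<rho>) \<Rightarrow> f J) ((case t of (J, \<rho>) \<Rightarrow> X J \<rho>) \<omega>))
        = (\<Prod>(J, \<rho>)\<in>S. f J (X J \<rho> \<omega>))" for \<omega>
      by (auto intro!: prod.cong)
    have fi: "\<And>t. t \<in> S \<Longrightarrow> (case t of (J, \<rho>) \<Rightarrow> f J) \<in> borel_measurable borel"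
      "\<And>t. t \<in> S \<Longrightarrow> integrable M (\<lambda>\<omega>. (case t of (J, \<rho>) \<Rightarrow> f J) ((case t of (J, \<rho>) \<Rightarrow> X J \<rho>) \<omega>))"
      using PI(1) f_int by (auto simp: f_def)
    show "integrable M (\<lambda>\<omega>. ind \<sigma> \<omega> * ind \<tau> \<omega>)"
      unfolding eq using F.expectation_prod(2)[OF PI(1), of "\<lambda>(J, \<rho>). f J", OF fi] unfolding prod_eq .
    have "expectation (\<lambda>\<omega>. ind \<sigma> \<omega> * ind \<tau> \<omega>)
        = (\<Prod>t\<in>S. expectation (\<lambda>\<omega>. (case t of (J, \<rho>) \<Rightarrow> f J) ((case t of (J, \<rho>) \<Rightarrow> X J \<rho>) \<omega>)))"
      unfolding eq using F.expectation_prod(1)[OF PI(1), of "\<lambda>(J, \<rho>). f J", OF fi] unfolding prod_eq .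
    also have "\<dots> = (\<Prod>(J, \<rho>)\<in>S. tail \<epsilon> J)"
      using PI(1) f_exp by (intro prod.cong) auto
    also have "\<dots> = q I * (\<Prod>J\<in>D. tail \<epsilon> J)"
      unfolding PI(4) q_def ..
    also have "(\<Prod>J\<in>D. tail \<epsilon> J) = q I / q (ov \<sigma> \<tau>)"
    proof -
      have sub: "active a (ov \<sigma> \<tau>) \<subseteq> P" by (rule active_mono[OF ov_subset])
      have "P - active a (ov \<sigma> \<tau>) = D" by (auto simp: D_def active_def)
      then have "q I = (\<Prod>J\<in>D. tail \<epsilon> J) * q (ov \<sigma> \<tau>)"
        unfolding q_def using prod.subset_diff[OF sub, of "tail \<epsilon>"] by simp
      then show ?thesis using q_pos[OF ov_subset, of \<sigma> \<tau>] by simp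
    qed
    finally show "expectation (\<lambda>\<omega>. ind \<sigma> \<omega> * ind \<tau> \<omega>) = q I * q I / q (ov \<sigma> \<tau>)" by simp
  qed
  have ind_sq: "ind \<sigma> \<omega> * ind \<sigma> \<omega> = ind \<sigma> \<omega>" for \<sigma> \<omega>
    unfolding ind_def prod.distrib[symmetric]
    by (intro prod.cong refl) (simp add: f_def split: split_indicator)
  have single: "integrable M (ind \<sigma>)" "expectation (ind \<sigma>) = q I" if "\<sigma> \<in> C" for \<sigma>
  proof -
    have "ov \<sigma> \<sigma> = I" by (auto simp: ov_def)
    then show "integrable M (ind \<sigma>)" "expectation (ind \<sigma>) = q I"
      using pair[OF that that] q_pos[of I] by (simp_all add: ind_sq)
  qed
  have L_int: "integrable M L" and L_exp: "expectation L = m"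
    unfolding L_def[abs_def] m_def using single by (auto simp: Bochner_Integration.integral_sum)
  have L2: "(L \<omega>)\<^sup>2 = (\<Sum>\<sigma>\<in>C. \<Sum>\<tau>\<in>C. ind \<sigma> \<omega> * ind \<tau> \<omega>)" for \<omega>
    by (simp add: L_def power2_eq_square sum_product)
  have L2_int: "integrable M (\<lambda>\<omega>. (L \<omega>)\<^sup>2)" unfolding L2 using pair by auto
  have "expectation (\<lambda>\<omega>. (L \<omega>)\<^sup>2) = (\<Sum>\<sigma>\<in>C. \<Sum>\<tau>\<in>C. q I * q I / q (ov \<sigma> \<tau>))"
    unfolding L2 using pair
    by (subst Bochner_Integration.integral_sum)
      (auto intro!: sum.cong Bochner_Integration.integrable_sum simp: Bochner_Integration.integral_sum)
  also have "\<dots> \<le> (\<Sum>\<sigma>\<in>C. \<Sum>A\<in>Pow I. real (card (cfg (I - A))) * (q I * q I / q A))"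
    using q_pos by (intro sum_mono sum_ov_le[of _ "\<lambda>A. q I * q I / q A"])
      (auto intro!: divide_nonneg_pos)
  also have "\<dots> = (\<Sum>A\<in>Pow I. real (card C) * (real (card (cfg (I - A))) * (q I * q I / q A)))"
    by (simp add: sum_distrib_left)
  also have "\<dots> = (\<Sum>A\<in>Pow I. m\<^sup>2 * (1 / (real (card (cfg A)) * q A)))"
  proof (intro sum.cong refl)
    fix A assume "A \<in> Pow I"
    then have "real (card C) = real (card (cfg A)) * real (card (cfg (I - A)))" "real (card (cfg A)) > 0"
      using cfg_split card_cfg_pos by auto
    then have "real (card (cfg (I - A))) = real (card C) / real (card (cfg A))" by simp
    then show "real (card C) * (real (card (cfg (I - A))) * (q I * q I / q A))
        = m\<^sup>2 * (1 / (real (card (cfg A)) * q A))"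
      by (simp add: m_def power2_eq_square)
  qed
  \<comment> \<open>The empty overlap contributes exactly one, which the squared mean cancels in the
    variance.\<close>
  also have "\<dots> = m\<^sup>2 * (1 + (\<Sum>A\<in>Pow I - {{}}. 1 / (real (card (cfg A)) * q A)))"
  proof -
    have "active a {} = {}" using a_empty by (auto simp: active_def)
    then have "1 / (real (card (cfg {})) * q {}) = 1" by (simp add: q_def configs_def)
    then have "(\<Sum>A\<in>Pow I. 1 / (real (card (cfg A)) * q A))
        = 1 + (\<Sum>A\<in>Pow I - {{}}. 1 / (real (card (cfg A)) * q A))"
      by (subst sum.remove[of _ "{}"]) auto
    then show ?thesis by (simp only: sum_distrib_left[symmetric])
  qed
  finally have E2: "expectation (\<lambda>\<omega>. (L \<omega>)\<^sup>2) \<le> m\<^sup>2 * (1 + (\<Sum>A\<in>Pow I - {{}}. 1 / (real (card (cfg A)) * q A)))" .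
  have L_zero: "L \<omega> = 0" if "\<omega> \<in> small_Z \<epsilon>" for \<omega>
  proof -
    have "ind \<sigma> \<omega> = 0" if \<sigma>: "\<sigma> \<in> C" for \<sigma>
    proof (rule ccontr)
      assume "ind \<sigma> \<omega> \<noteq> 0"
      then have "y J \<sigma> \<omega> \<ge> x J" if "J \<in> P" for J
        using that by (auto simp: ind_def f_def split: split_indicator_asm)
      then have "(\<Sum>J\<in>P. x J) \<le> H \<sigma> \<omega>" unfolding hamiltonian_def by (rule sum_mono)
      then have "real N * ((1 - \<epsilon>) * E0) \<le> H \<sigma> \<omega>"
        by (simp add: x_def E0_def sum_distrib_left mult_ac)
      then have "exp (\<beta> * (real N * ((1 - \<epsilon>) * E0))) \<le> exp (\<beta> * H \<sigma> \<omega>)"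
        using \<beta>_pos by simp
      also have "\<dots> \<le> Z \<omega>" unfolding Z_def using \<sigma> by (intro member_le_sum) auto
      finally show False using \<open>\<omega> \<in> small_Z \<epsilon>\<close> by (simp add: small_Z_def)
    qed
    then show ?thesis by (simp add: L_def)
  qed
  have "prob (small_Z \<epsilon>) = expectation (indicator (small_Z \<epsilon>))" by simp
  also have "\<dots> \<le> expectation (\<lambda>\<omega>. (L \<omega>)\<^sup>2 / m\<^sup>2 - 2 * L \<omega> / m + 1)"
  proof (rule integral_mono)
    \<comment> \<open>The right side is \<open>(L \<omega> / m - 1)\<^sup>2\<close>: nonnegative,
      and one where \<open>L\<close> vanishes, in particular on
      \<open>small_Z \<epsilon>\<close>.\<close>
    show "indicator (small_Z \<epsilon>) \<omega> \<le> (L \<omega>)\<^sup>2 / m\<^sup>2 - 2 * L \<omega> / m + 1" for \<omega>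
    proof -
      have "(L \<omega>)\<^sup>2 / m\<^sup>2 - 2 * L \<omega> / m + 1 = (L \<omega> / m - 1)\<^sup>2"
        unfolding power2_diff by (simp add: power_divide)
      then show ?thesis using L_zero by (auto split: split_indicator)
    qed
  qed (use L_int L2_int in \<open>auto intro: integrable_ind\<close>)
  also have "\<dots> = expectation (\<lambda>\<omega>. (L \<omega>)\<^sup>2) / m\<^sup>2 - 1"
    using L_int L2_int m_pos by (simp add: L_exp prob_space)
  also have "\<dots> \<le> (\<Sum>A\<in>Pow I - {{}}. 1 / (real (card (cfg A)) * q A))"
  proof -
    have "expectation (\<lambda>\<omega>. (L \<omega>)\<^sup>2) / m\<^sup>2 \<le> 1 + (\<Sum>A\<in>Pow I - {{}}. 1 / (real (card (cfg A)) * q A))"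
      using E2[unfolded mult.commute[of "m\<^sup>2"]] m_pos by (subst pos_divide_le_eq) auto
    then show ?thesis by linarith
  qed
  finally show ?thesis by (simp add: q_def)
qed

section \<open>Integration by parts and the mean energy of a bond\<close>

definition mean_energy :: "nat set \<Rightarrow> real" where
  "mean_energy J = expectation (\<lambda>\<omega>. \<Sum>\<sigma>\<in>C. G \<sigma> \<omega> * y J \<sigma> \<omega>)"

lemma G_y_integrable:
  assumes "\<sigma> \<in> C" "J \<in> P" "\<tau> \<in> cfg J"
  shows "integrable M (\<lambda>\<omega>. G \<sigma> \<omega> * X J \<tau> \<omega>)"
proof (rule Bochner_Integration.integrable_bound)
  show "integrable M (X J \<tau>)" using F.integrable_moments(1)[of "(J, \<tau>)"] assms by simp
  show "(\<lambda>\<omega>. G \<sigma> \<omega> * X J \<tau> \<omega>) \<in> borel_measurable M" using assms by measurable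
  show "AE \<omega> in M. norm (G \<sigma> \<omega> * X J \<tau> \<omega>) \<le> norm (X J \<tau> \<omega>)"
    using G_le_1[OF assms(1)] G_nonneg by (intro AE_I2) (simp add: abs_mult mult_left_le_one_le)
qed

lemma cfg_extension:
  assumes "J \<subseteq> I" "\<tau> \<in> cfg J" obtains \<sigma> where "\<sigma> \<in> C" "restrict \<sigma> J = \<tau>"
proof
  let ?\<sigma> = "\<lambda>i. if i \<in> J then \<tau> i else if i \<in> I then 1 else undefined"
  show "?\<sigma> \<in> C" using assms card_spins(3) by (auto simp: configs_def PiE_def Pi_def extensional_def)
  show "restrict ?\<sigma> J = \<tau>" using assms(2) by (auto simp: configs_def PiE_def extensional_def restrict_def)
qed

text \<open>As a function of one Gaussian variable, the mass of the configurations using it is logistic.\<close>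

lemma stein_weight:
  assumes J: "J \<in> P" and \<tau>: "\<tau> \<in> cfg J"
  defines "q \<equiv> \<lambda>\<omega>. \<Sum>\<sigma> | \<sigma> \<in> C \<and> restrict \<sigma> J = \<tau>. G \<sigma> \<omega>"
  shows "expectation (\<lambda>\<omega>. X J \<tau> \<omega> * q \<omega>) = a J * real N * \<beta> * expectation (\<lambda>\<omega>. q \<omega> * (1 - q \<omega>))"
proof -
  let ?t = "(J, \<tau>)"
  define inn where "inn = {\<sigma>\<in>C. restrict \<sigma> J = \<tau>}"
  define out where "out = {\<sigma>\<in>C. restrict \<sigma> J \<noteq> \<tau>}"
  \<comment> \<open>\<open>num\<close> collects the configurations that avoid the variable
    \<open>X J \<tau>\<close>; \<open>den\<close> collects those that use it, with its factor
    removed. Both depend on the other variables only, and so does their ratio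
    \<open>R\<close>.\<close>
  define num where "num z = (\<Sum>\<sigma>\<in>out. exp (\<beta> * (\<Sum>J'\<in>P. z (J', restrict \<sigma> J'))))"
    for z :: "nat set \<times> (nat \<Rightarrow> nat) \<Rightarrow> real"
  define den where "den z = (\<Sum>\<sigma>\<in>inn. exp (\<beta> * (\<Sum>J'\<in>P - {J}. z (J', restrict \<sigma> J'))))"
    for z :: "nat set \<times> (nat \<Rightarrow> nat) \<Rightarrow> real"
  define R where "R z = num z / den z" for z
  define Y where "Y \<omega> = (\<lambda>s\<in>T - {?t}. (case s of (J, \<tau>) \<Rightarrow> X J \<tau>) \<omega>)" for \<omega>
  have t: "?t \<in> T" using J \<tau> by auto
  have fin: "finite inn" "finite out" by (auto simp: inn_def out_def)
  have ne: "inn \<noteq> {}" using cfg_extension[OF P_subset[OF J] \<tau>] by (auto simp: inn_def)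
  have in_T: "(J', restrict \<sigma> J') \<in> T - {?t}"
    if "\<sigma> \<in> inn \<and> J' \<in> P - {J} \<or> \<sigma> \<in> out \<and> J' \<in> P" for \<sigma> J'
    using that y_in_T[of J' \<sigma>] by (auto simp: inn_def out_def)
  have comp: "(\<lambda>z. z (J', restrict \<sigma> J')) \<in> borel_measurable (PiM (T - {?t}) (\<lambda>_. borel))"
    if "\<sigma> \<in> inn \<and> J' \<in> P - {J} \<or> \<sigma> \<in> out \<and> J' \<in> P" for \<sigma> J'
    using in_T[OF that] by (rule measurable_component_singleton)
  have R_meas: "R \<in> borel_measurable (PiM (T - {?t}) (\<lambda>_. borel))"
    unfolding R_def num_def den_def
    by (intro borel_measurable_divide borel_measurable_sum borel_measurable_exp
        measurable_compose[OF _ borel_measurable_exp] borel_measurable_times borel_measurable_const comp)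
      auto
  have R_nonneg: "R z \<ge> 0" for z
    unfolding R_def num_def den_def by (intro divide_nonneg_nonneg sum_nonneg) auto
  have q: "q \<omega> = 1 / (1 + R (Y \<omega>) * exp (- \<beta> * X J \<tau> \<omega>))" for \<omega>
  proof -
    have Y_eq: "Y \<omega> (J', restrict \<sigma> J') = y J' \<sigma> \<omega>"
      if "\<sigma> \<in> inn \<and> J' \<in> P - {J} \<or> \<sigma> \<in> out \<and> J' \<in> P" for \<sigma> J'
      using in_T[OF that] by (simp add: Y_def)
    have num: "num (Y \<omega>) = (\<Sum>\<sigma>\<in>out. exp (\<beta> * H \<sigma> \<omega>))"
      unfolding num_def hamiltonian_def using Y_eq by (intro sum.cong arg_cong[where f = exp] arg_cong2[where f = "(*)"] refl) auto
    have den_term: "exp (\<beta> * X J \<tau> \<omega>) * exp (\<beta> * (\<Sum>J'\<in>P - {J}. Y \<omega> (J', restrict \<sigma> J'))) = exp (\<beta> * H \<sigma> \<omega>)"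
      if \<sigma>: "\<sigma> \<in> inn" for \<sigma>
    proof -
      have "H \<sigma> \<omega> = X J \<tau> \<omega> + (\<Sum>J'\<in>P - {J}. y J' \<sigma> \<omega>)"
        unfolding hamiltonian_def using J \<sigma> by (subst sum.remove[of _ J]) (auto simp: inn_def)
      also have "(\<Sum>J'\<in>P - {J}. y J' \<sigma> \<omega>) = (\<Sum>J'\<in>P - {J}. Y \<omega> (J', restrict \<sigma> J'))"
        using Y_eq \<sigma> by (intro sum.cong refl) auto
      finally show "exp (\<beta> * X J \<tau> \<omega>) * exp (\<beta> * (\<Sum>J'\<in>P - {J}. Y \<omega> (J', restrict \<sigma> J'))) = exp (\<beta> * H \<sigma> \<omega>)"
        by (simp add: distrib_left exp_add)
    qed
    have den: "exp (\<beta> * X J \<tau> \<omega>) * den (Y \<omega>) = (\<Sum>\<sigma>\<in>inn. exp (\<beta> * H \<sigma> \<omega>))"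
      unfolding den_def by (subst sum_distrib_left) (intro sum.cong refl den_term)
    have pos: "den (Y \<omega>) > 0" unfolding den_def using fin ne by (intro sum_pos) auto
    have nn: "num (Y \<omega>) \<ge> 0" unfolding num_def by (intro sum_nonneg) auto
    have "C = inn \<union> out" "inn \<inter> out = {}" by (auto simp: inn_def out_def)
    then have Z: "Z \<omega> = exp (\<beta> * X J \<tau> \<omega>) * den (Y \<omega>) + num (Y \<omega>)"
      unfolding Z_def den num using fin by (simp add: sum.union_disjoint)
    have "q \<omega> = (\<Sum>\<sigma>\<in>inn. exp (\<beta> * H \<sigma> \<omega>)) / Z \<omega>"
      unfolding q_def inn_def G_eq by (simp add: sum_divide_distrib)
    also have "\<dots> = exp (\<beta> * X J \<tau> \<omega>) * den (Y \<omega>) / (exp (\<beta> * X J \<tau> \<omega>) * den (Y \<omega>) + num (Y \<omega>))"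
      unfolding Z den ..
    also have "\<dots> = 1 / (1 + R (Y \<omega>) * exp (- \<beta> * X J \<tau> \<omega>))"
    proof -
      define e where "e = exp (\<beta> * X J \<tau> \<omega>)"
      have e: "e > 0" "exp (- \<beta> * X J \<tau> \<omega>) = 1 / e" by (simp_all add: e_def exp_minus field_simps)
      have "e * den (Y \<omega>) + num (Y \<omega>) > 0" using e(1) pos nn by (simp add: add_pos_nonneg)
      then show ?thesis
        unfolding e(2) R_def e_def[symmetric] using e(1) pos nn
        by (simp add: divide_simps add_pos_nonneg) (simp add: algebra_simps)
    qed
    finally show ?thesis .
  qed
  show ?thesis
    using F.stein_field[OF t R_meas R_nonneg, of \<beta>] unfolding Y_def[symmetric] by (simp add: q)
qed

text \<open>Grouping configurations by their restriction to \<open>J\<close> produces the masses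
  \<open>q \<tau>\<close>, to which integration by parts applies. The sum of
  \<open>q \<tau> \<omega> * (1 - q \<tau> \<omega>)\<close> is the chance that two replicas differ
  somewhere on \<open>J\<close>, that is, that their overlap set does not contain
  \<open>J\<close>.\<close>

lemma mean_energy_eq:
  assumes J: "J \<in> P"
  shows "mean_energy J = a J * real N * \<beta> * (1 - (\<Sum>A | A \<subseteq> I \<and> J \<subseteq> A. ov_prob A))"
proof -
  define q where "q \<tau> \<omega> = (\<Sum>\<sigma> | \<sigma> \<in> C \<and> restrict \<sigma> J = \<tau>. G \<sigma> \<omega>)" for \<tau> \<omega>
  have JI: "J \<subseteq> I" using J by (rule P_subset)
  have img: "(\<lambda>\<sigma>. restrict \<sigma> J) ` C \<subseteq> cfg J" using restrict_cfg JI by auto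
  have group: "(\<Sum>\<sigma>\<in>C. G \<sigma> \<omega> * f (restrict \<sigma> J)) = (\<Sum>\<tau>\<in>cfg J. q \<tau> \<omega> * f \<tau>)" for f :: "_ \<Rightarrow> real" and \<omega>
  proof -
    have "(\<Sum>\<sigma>\<in>C. G \<sigma> \<omega> * f (restrict \<sigma> J))
        = (\<Sum>\<tau>\<in>cfg J. \<Sum>\<sigma>\<in>{\<sigma>\<in>C. restrict \<sigma> J = \<tau>}. G \<sigma> \<omega> * f (restrict \<sigma> J))"
      using sum.group[OF finite_C finite_cfg[OF JI] img, of "\<lambda>\<sigma>. G \<sigma> \<omega> * f (restrict \<sigma> J)"] by simp
    also have "\<dots> = (\<Sum>\<tau>\<in>cfg J. q \<tau> \<omega> * f \<tau>)"
      by (intro sum.cong refl) (auto simp: q_def sum_distrib_right intro!: sum.cong)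
    finally show ?thesis .
  qed
  have q_sum: "(\<Sum>\<tau>\<in>cfg J. q \<tau> \<omega>) = 1" for \<omega>
    using group[of \<omega> "\<lambda>_. 1"] sum_G by simp
  have q_meas: "q \<tau> \<in> borel_measurable M" for \<tau>
    unfolding q_def by (intro borel_measurable_sum G_meas) auto
  have q01: "0 \<le> q \<tau> \<omega>" "q \<tau> \<omega> \<le> 1" for \<tau> \<omega>
  proof -
    show "0 \<le> q \<tau> \<omega>" unfolding q_def using G_nonneg by (intro sum_nonneg) auto
    have "q \<tau> \<omega> \<le> (\<Sum>\<sigma>\<in>C. G \<sigma> \<omega>)" unfolding q_def using G_nonneg by (intro sum_mono2) auto
    then show "q \<tau> \<omega> \<le> 1" by (simp add: sum_G)
  qed
  have qq_int: "integrable M (\<lambda>\<omega>. q \<tau> \<omega> * (1 - q \<tau> \<omega>))" for \<tau>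
  proof (rule integrable_const_bound[where B = 1])
    show "AE \<omega> in M. norm (q \<tau> \<omega> * (1 - q \<tau> \<omega>)) \<le> 1"
      using q01 by (intro AE_I2) (auto simp: abs_mult intro!: mult_le_one)
    show "(\<lambda>\<omega>. q \<tau> \<omega> * (1 - q \<tau> \<omega>)) \<in> borel_measurable M" using q_meas by measurable
  qed
  have Xq_int: "integrable M (\<lambda>\<omega>. X J \<tau> \<omega> * q \<tau> \<omega>)" if "\<tau> \<in> cfg J" for \<tau>
    unfolding q_def sum_distrib_left using G_y_integrable[OF _ J that]
    by (intro Bochner_Integration.integrable_sum) (auto simp: mult.commute)
  have "mean_energy J = expectation (\<lambda>\<omega>. \<Sum>\<tau>\<in>cfg J. X J \<tau> \<omega> * q \<tau> \<omega>)"
    unfolding mean_energy_def using group[of _ "\<lambda>\<tau>. X J \<tau> _"] by (simp add: mult.commute)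
  also have "\<dots> = (\<Sum>\<tau>\<in>cfg J. expectation (\<lambda>\<omega>. X J \<tau> \<omega> * q \<tau> \<omega>))"
    by (rule Bochner_Integration.integral_sum) (rule Xq_int)
  also have "\<dots> = (\<Sum>\<tau>\<in>cfg J. a J * real N * \<beta> * expectation (\<lambda>\<omega>. q \<tau> \<omega> * (1 - q \<tau> \<omega>)))"
    unfolding q_def by (intro sum.cong refl stein_weight J)
  also have "\<dots> = a J * real N * \<beta> * expectation (\<lambda>\<omega>. \<Sum>\<tau>\<in>cfg J. q \<tau> \<omega> * (1 - q \<tau> \<omega>))"
    by (subst Bochner_Integration.integral_sum) (auto simp: qq_int sum_distrib_left)
  also have "(\<lambda>\<omega>. \<Sum>\<tau>\<in>cfg J. q \<tau> \<omega> * (1 - q \<tau> \<omega>))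
      = (\<lambda>\<omega>. 1 - (\<Sum>A | A \<subseteq> I \<and> J \<subseteq> A. \<Sum>\<sigma>\<in>C. \<Sum>\<tau>\<in>C. G \<sigma> \<omega> * G \<tau> \<omega> * of_bool (ov \<sigma> \<tau> = A)))"
  proof
    fix \<omega>
    have "(\<Sum>A | A \<subseteq> I \<and> J \<subseteq> A. \<Sum>\<sigma>\<in>C. \<Sum>\<tau>\<in>C. G \<sigma> \<omega> * G \<tau> \<omega> * of_bool (ov \<sigma> \<tau> = A))
        = (\<Sum>\<sigma>\<in>C. \<Sum>\<tau>\<in>C. \<Sum>A | A \<subseteq> I \<and> J \<subseteq> A. G \<sigma> \<omega> * G \<tau> \<omega> * of_bool (ov \<sigma> \<tau> = A))"
      by (subst sum.swap, intro sum.cong refl, rule sum.swap)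
    also have "\<dots> = (\<Sum>\<sigma>\<in>C. \<Sum>\<tau>\<in>C. G \<sigma> \<omega> * G \<tau> \<omega> * of_bool (restrict \<sigma> J = restrict \<tau> J))"
    proof (intro sum.cong refl)
      fix \<sigma> \<tau>
      have "finite {A. A \<subseteq> I \<and> J \<subseteq> A}" by (rule finite_subset[of _ "Pow I"]) auto
      then have "(\<Sum>A | A \<subseteq> I \<and> J \<subseteq> A. of_bool (ov \<sigma> \<tau> = A)) = (of_bool (J \<subseteq> ov \<sigma> \<tau>) :: real)"
        using ov_subset[of \<sigma> \<tau>] by (simp add: of_bool_def)
      then show "(\<Sum>A | A \<subseteq> I \<and> J \<subseteq> A. G \<sigma> \<omega> * G \<tau> \<omega> * of_bool (ov \<sigma> \<tau> = A))
          = G \<sigma> \<omega> * G \<tau> \<omega> * of_bool (restrict \<sigma> J = restrict \<tau> J)"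
        unfolding sum_distrib_left[symmetric] restrict_eq_iff[OF JI] by simp
    qed
    also have "\<dots> = (\<Sum>\<sigma>\<in>C. G \<sigma> \<omega> * q (restrict \<sigma> J) \<omega>)"
    proof (rule sum.cong[OF refl])
      fix \<sigma>
      have "q (restrict \<sigma> J) \<omega> = (\<Sum>\<tau>\<in>C. if restrict \<tau> J = restrict \<sigma> J then G \<tau> \<omega> else 0)"
        unfolding q_def by (rule sum.inter_filter) simp
      then show "(\<Sum>\<tau>\<in>C. G \<sigma> \<omega> * G \<tau> \<omega> * of_bool (restrict \<sigma> J = restrict \<tau> J))
          = G \<sigma> \<omega> * q (restrict \<sigma> J) \<omega>"
        by (simp only: sum_distrib_left, intro sum.cong refl) auto
    qed
    also have "\<dots> = (\<Sum>\<tau>\<in>cfg J. q \<tau> \<omega> * q \<tau> \<omega>)" by (rule group)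
    finally show "(\<Sum>\<tau>\<in>cfg J. q \<tau> \<omega> * (1 - q \<tau> \<omega>))
        = 1 - (\<Sum>A | A \<subseteq> I \<and> J \<subseteq> A. \<Sum>\<sigma>\<in>C. \<Sum>\<tau>\<in>C. G \<sigma> \<omega> * G \<tau> \<omega> * of_bool (ov \<sigma> \<tau> = A))"
      by (simp add: right_diff_distrib sum_subtractf q_sum)
  qed
  also have "expectation \<dots> = 1 - (\<Sum>A | A \<subseteq> I \<and> J \<subseteq> A. ov_prob A)"
  proof -
    have int: "integrable M (\<lambda>\<omega>. \<Sum>\<sigma>\<in>C. \<Sum>\<tau>\<in>C. G \<sigma> \<omega> * G \<tau> \<omega> * of_bool (ov \<sigma> \<tau> = A))" for A
      by (intro Bochner_Integration.integrable_sum integrable_mult_left integrable_GG)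
    show ?thesis
      unfolding ov_prob_def
      by (subst Bochner_Integration.integral_diff)
        (use int in \<open>auto intro!: Bochner_Integration.integrable_sum simp: prob_space Bochner_Integration.integral_sum\<close>)
  qed
  finally show ?thesis .
qed

text \<open>Concentration in Gibbs probability does not control the mean of an unbounded variable.
  Deviations up to \<open>R\<close> are charged to \<open>dev\<close>; larger ones are dominated by
  exponential moments summed over \<open>cfg J\<close>. The constant \<open>R\<close> adds up the
  entropy, the rate \<open>a J / 2\<close> of these moments, the centre \<open>a J * b J\<close>,
  and one unit that leaves the factor \<open>exp (- real N)\<close>.\<close>

lemma mean_energy_close:
  assumes J: "J \<in> P" and "\<delta> > 0"
  defines "R \<equiv> ln 2 * gam \<gamma> I + a J / 2 + a J * b J + 1"
  shows "\<bar>mean_energy J / real N - a J * b J\<bar> \<le> \<delta> + R * dev J \<delta> + 2 * R * exp (- real N)"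
proof -
  define m where "m = real N * (a J * b J)"
  define D where "D \<sigma> = {\<omega>\<in>space M. \<bar>y J \<sigma> \<omega> - m\<bar> > real N * \<delta>}" for \<sigma>
  define W where "W \<tau> \<omega> = exp (- m - real N * R) * exp (X J \<tau> \<omega>) + exp (m - real N * R) * exp (- X J \<tau> \<omega>)" for \<tau> \<omega>
  have JI: "J \<subseteq> I" using J by (rule P_subset)
  have N: "real N \<ge> 1" using N_pos by simp
  have gam0: "gam \<gamma> A \<ge> 0" if "A \<subseteq> I" for A
    unfolding gam_def using \<gamma>_pos that by (intro sum_nonneg less_imp_le) auto
  have R1: "R \<ge> 1"
    using a_pos[OF J] bcrit_pos[OF J] gam0[of I] by (simp add: R_def)
  have m0: "m \<ge> 0" using a_pos[OF J] bcrit_pos[OF J] by (simp add: m_def)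
  \<comment> \<open>There are three ranges: up to \<delta>, up to \<open>R\<close>, and beyond. In
    the last one, with \<open>d\<close> the excess over \<open>R\<close>, the estimate is
    \<open>R + d \<le> R * (1 + d) \<le> R * exp (real N * d)\<close>, which uses
    \<open>R \<ge> 1\<close> and \<open>N \<ge> 1\<close>.\<close>
  have pointwise: "\<bar>x - m\<bar> / real N \<le> \<delta> + R * (if \<bar>x - m\<bar> > real N * \<delta> then 1 else 0)
      + R * (exp (- m - real N * R) * exp x + exp (m - real N * R) * exp (- x))" for x
  proof -
    have W0: "exp (- m - real N * R) * exp x + exp (m - real N * R) * exp (- x) \<ge> 0" by simp
    consider "\<bar>x - m\<bar> \<le> real N * \<delta>" | "\<bar>x - m\<bar> > real N * \<delta>" "\<bar>x - m\<bar> \<le> real N * R" | "\<bar>x - m\<bar> > real N * R"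
      by linarith
    then show ?thesis
    proof cases
      case 1
      then have "\<bar>x - m\<bar> / real N \<le> \<delta>" using N by (simp add: divide_le_eq mult.commute)
      then show ?thesis using W0 R1 1 by (simp add: add_increasing2)
    next
      case 2
      then have "\<bar>x - m\<bar> / real N \<le> R" using N by (simp add: divide_le_eq mult.commute)
      moreover have "R * (exp (- m - real N * R) * exp x + exp (m - real N * R) * exp (- x)) \<ge> 0"
        using W0 R1 by (intro mult_nonneg_nonneg) auto
      ultimately show ?thesis using 2 assms(2) by simp
    next
      case 3
      define d where "d = \<bar>x - m\<bar> / real N - R"
      have d: "d > 0" "\<bar>x - m\<bar> = real N * (d + R)" using 3 N by (auto simp: d_def field_simps)
      have "\<bar>x - m\<bar> / real N = R + d" by (simp add: d_def)
      also have "\<dots> \<le> R * (1 + d)" using R1 d(1) by (simp add: distrib_left)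
      also have "\<dots> \<le> R * exp (real N * d)"
      proof -
        have "1 + d \<le> exp d" by (rule exp_ge_add_one_self)
        also have "exp d \<le> exp (real N * d)" using N d(1) by simp
        finally show ?thesis using R1 by (intro mult_left_mono) auto
      qed
      also have "exp (real N * d) = exp (\<bar>x - m\<bar> - real N * R)" unfolding d(2) by (simp add: algebra_simps)
      also have "\<dots> \<le> exp (- m - real N * R) * exp x + exp (m - real N * R) * exp (- x)"
        by (cases "x \<ge> m") (auto simp: algebra_simps abs_if simp flip: exp_add)
      finally have "\<bar>x - m\<bar> / real N \<le> R * (exp (- m - real N * R) * exp x + exp (m - real N * R) * exp (- x))"
        using R1 by simp
      then show ?thesis using assms(2) R1 by (simp add: add_increasing)
    qed
  qed
  have W_int: "integrable M (W \<tau>)" and W_exp: "expectation (W \<tau>) \<le> 2 * exp (- (real N * (ln 2 * gam \<gamma> J + 1)))"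
    if \<tau>: "\<tau> \<in> cfg J" for \<tau>
  proof -
    have t: "(J, \<tau>) \<in> T" using J \<tau> by auto
    have i: "integrable M (\<lambda>\<omega>. exp (X J \<tau> \<omega>))" "integrable M (\<lambda>\<omega>. exp (- X J \<tau> \<omega>))"
      using F.mgf_single(2)[OF t, of 1] F.mgf_single(2)[OF t, of "- 1"] by auto
    then show "integrable M (W \<tau>)" unfolding W_def by auto
    have "expectation (W \<tau>) = exp (- m - real N * R) * exp (a J * real N / 2) + exp (m - real N * R) * exp (a J * real N / 2)"
      unfolding W_def using i F.mgf_single(1)[OF t, of 1] F.mgf_single(1)[OF t, of "- 1"] by simp
    also have "\<dots> \<le> exp (m - real N * R) * exp (a J * real N / 2) + exp (m - real N * R) * exp (a J * real N / 2)"
      using m0 by (intro add_mono mult_right_mono) auto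
    also have "\<dots> = 2 * exp (- (real N * (ln 2 * gam \<gamma> I + 1)))"
      by (simp add: m_def R_def algebra_simps flip: exp_add)
    also have "\<dots> \<le> 2 * exp (- (real N * (ln 2 * gam \<gamma> J + 1)))"
    proof -
      have "gam \<gamma> J \<le> gam \<gamma> I" unfolding gam_def using JI \<gamma>_pos by (intro sum_mono2) (auto intro: less_imp_le)
      then show ?thesis by (simp add: mult_left_mono)
    qed
    finally show "expectation (W \<tau>) \<le> 2 * exp (- (real N * (ln 2 * gam \<gamma> J + 1)))" .
  qed
  have Gy_int: "integrable M (\<lambda>\<omega>. G \<sigma> \<omega> * y J \<sigma> \<omega>)" if "\<sigma> \<in> C" for \<sigma>
    using G_y_integrable[OF that J restrict_cfg[OF that JI]] .
  have D_ev: "D \<sigma> \<in> events" if "\<sigma> \<in> C" for \<sigma>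
    unfolding D_def m_def by (rule dev_meas[OF J that])
  define U where "U \<omega> = (\<Sum>\<sigma>\<in>C. G \<sigma> \<omega> * ((y J \<sigma> \<omega> - m) / real N))" for \<omega>
  have U_alt: "U \<omega> = ((\<Sum>\<sigma>\<in>C. G \<sigma> \<omega> * y J \<sigma> \<omega>) - m) / real N" for \<omega>
  proof -
    have "U \<omega> = (\<Sum>\<sigma>\<in>C. G \<sigma> \<omega> * y J \<sigma> \<omega> - G \<sigma> \<omega> * m) / real N"
      unfolding U_def sum_divide_distrib by (intro sum.cong refl) (simp add: right_diff_distrib)
    then show ?thesis by (simp add: sum_subtractf sum_G flip: sum_distrib_right)
  qed
  have S_int: "integrable M (\<lambda>\<omega>. \<Sum>\<sigma>\<in>C. G \<sigma> \<omega> * y J \<sigma> \<omega>)"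
    using Gy_int by (intro Bochner_Integration.integrable_sum) auto
  have U_int: "integrable M U" unfolding U_alt using S_int by simp
  have "expectation U = (mean_energy J - m) / real N"
    unfolding U_alt mean_energy_def using S_int by (simp add: prob_space)
  then have "mean_energy J / real N - a J * b J = expectation U"
    using N_pos by (simp add: m_def field_simps)
  then have "\<bar>mean_energy J / real N - a J * b J\<bar> \<le> expectation (\<lambda>\<omega>. \<bar>U \<omega>\<bar>)"
    using integral_abs_bound[of M U] by simp
  also have "\<dots> \<le> expectation (\<lambda>\<omega>. \<delta> + R * (\<Sum>\<sigma>\<in>C. G \<sigma> \<omega> * indicator (D \<sigma>) \<omega>) + R * (\<Sum>\<tau>\<in>cfg J. W \<tau> \<omega>))"
  proof (rule integral_mono)
    show "integrable M (\<lambda>\<omega>. \<bar>U \<omega>\<bar>)" using U_int by simp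
    show "integrable M (\<lambda>\<omega>. \<delta> + R * (\<Sum>\<sigma>\<in>C. G \<sigma> \<omega> * indicator (D \<sigma>) \<omega>) + R * (\<Sum>\<tau>\<in>cfg J. W \<tau> \<omega>))"
      by (intro Bochner_Integration.integrable_add integrable_mult_right
          Bochner_Integration.integrable_sum integrable_const integrable_G_ind D_ev W_int)
    fix \<omega> assume \<omega>: "\<omega> \<in> space M"
    have W0: "W \<tau> \<omega> \<ge> 0" for \<tau> by (simp add: W_def)
    have "\<bar>U \<omega>\<bar> \<le> (\<Sum>\<sigma>\<in>C. \<bar>G \<sigma> \<omega> * ((y J \<sigma> \<omega> - m) / real N)\<bar>)"
      unfolding U_def by (rule sum_abs)
    also have "\<dots> \<le> (\<Sum>\<sigma>\<in>C. G \<sigma> \<omega> * (\<delta> + R * indicator (D \<sigma>) \<omega> + R * (\<Sum>\<tau>\<in>cfg J. W \<tau> \<omega>)))"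
    proof (rule sum_mono)
      fix \<sigma> assume \<sigma>: "\<sigma> \<in> C"
      have "\<bar>y J \<sigma> \<omega> - m\<bar> / real N \<le> \<delta> + R * indicator (D \<sigma>) \<omega> + R * W (restrict \<sigma> J) \<omega>"
        using pointwise[of "y J \<sigma> \<omega>"] \<omega> unfolding W_def D_def by (auto split: if_splits)
      \<comment> \<open>Enlarging to the sum over \<open>cfg J\<close> removes the dependence on
        \<sigma>, so the Gibbs weights sum to one and are no longer correlated with this
        term.\<close>
      also have "W (restrict \<sigma> J) \<omega> \<le> (\<Sum>\<tau>\<in>cfg J. W \<tau> \<omega>)"
        by (intro member_le_sum restrict_cfg[OF \<sigma> JI] W0 finite_cfg[OF JI])
      finally have "\<bar>y J \<sigma> \<omega> - m\<bar> / real N \<le> \<delta> + R * indicator (D \<sigma>) \<omega> + R * (\<Sum>\<tau>\<in>cfg J. W \<tau> \<omega>)"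
        using R1 by simp
      then have "G \<sigma> \<omega> * (\<bar>y J \<sigma> \<omega> - m\<bar> / real N)
          \<le> G \<sigma> \<omega> * (\<delta> + R * indicator (D \<sigma>) \<omega> + R * (\<Sum>\<tau>\<in>cfg J. W \<tau> \<omega>))"
        using G_nonneg[of \<sigma> \<omega>] by (rule mult_left_mono)
      then show "\<bar>G \<sigma> \<omega> * ((y J \<sigma> \<omega> - m) / real N)\<bar>
          \<le> G \<sigma> \<omega> * (\<delta> + R * indicator (D \<sigma>) \<omega> + R * (\<Sum>\<tau>\<in>cfg J. W \<tau> \<omega>))"
        using G_nonneg[of \<sigma> \<omega>] by (simp add: abs_mult)
    qed
    also have "\<dots> = \<delta> + R * (\<Sum>\<sigma>\<in>C. G \<sigma> \<omega> * indicator (D \<sigma>) \<omega>) + R * (\<Sum>\<tau>\<in>cfg J. W \<tau> \<omega>)"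
    proof -
      have "(\<Sum>\<sigma>\<in>C. G \<sigma> \<omega> * (\<delta> + R * indicator (D \<sigma>) \<omega> + w))
          = (\<Sum>\<sigma>\<in>C. G \<sigma> \<omega> * \<delta> + R * (G \<sigma> \<omega> * indicator (D \<sigma>) \<omega>) + G \<sigma> \<omega> * w)" for w
        by (intro sum.cong refl) (simp add: algebra_simps)
      then show ?thesis
        unfolding sum.distrib sum_distrib_right[symmetric] sum_distrib_left[symmetric] sum_G by simp
    qed
    finally show "\<bar>U \<omega>\<bar> \<le> \<delta> + R * (\<Sum>\<sigma>\<in>C. G \<sigma> \<omega> * indicator (D \<sigma>) \<omega>) + R * (\<Sum>\<tau>\<in>cfg J. W \<tau> \<omega>)" .
  qed
  also have "\<dots> = \<delta> + R * dev J \<delta> + R * (\<Sum>\<tau>\<in>cfg J. expectation (W \<tau>))"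
  proof -
    have i1: "integrable M (\<lambda>\<omega>. \<Sum>\<sigma>\<in>C. G \<sigma> \<omega> * indicator (D \<sigma>) \<omega>)"
      using integrable_G_ind D_ev by (intro Bochner_Integration.integrable_sum) auto
    have i2: "integrable M (\<lambda>\<omega>. \<Sum>\<tau>\<in>cfg J. W \<tau> \<omega>)"
      using W_int by (intro Bochner_Integration.integrable_sum) auto
    have d: "dev J \<delta> = expectation (\<lambda>\<omega>. \<Sum>\<sigma>\<in>C. G \<sigma> \<omega> * indicator (D \<sigma>) \<omega>)"
      by (simp add: dev_def D_def m_def)
    show ?thesis
      unfolding d using i1 i2 W_int by (simp add: prob_space Bochner_Integration.integral_sum)
  qed
  also have "(\<Sum>\<tau>\<in>cfg J. expectation (W \<tau>)) \<le> (\<Sum>\<tau>\<in>cfg J. 2 * exp (- (real N * (ln 2 * gam \<gamma> J + 1))))"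
    by (intro sum_mono W_exp)
  also have "\<dots> = real (card (cfg J)) * (2 * exp (- (real N * (ln 2 * gam \<gamma> J + 1))))" by simp
  also have "\<dots> \<le> exp (real N * (ln 2 * gam \<gamma> J)) * (2 * exp (- (real N * (ln 2 * gam \<gamma> J + 1))))"
    by (intro mult_right_mono card_cfg_upper JI) auto
  also have "\<dots> = 2 * exp (- real N)" by (simp add: algebra_simps flip: exp_add)
  finally show ?thesis using R1 by (simp add: mult_ac)
qed

lemma ov_prob_nonneg: "ov_prob A \<ge> 0"
  unfolding ov_prob_def using G_nonneg
  by (intro Bochner_Integration.integral_nonneg sum_nonneg mult_nonneg_nonneg) auto

lemma dev_nonneg: "dev J \<delta> \<ge> 0"
  unfolding dev_def using G_nonneg
  by (intro Bochner_Integration.integral_nonneg sum_nonneg mult_nonneg_nonneg) auto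

section \<open>Overlaps in the chain and ultrametric triples\<close>

definition ultra :: "(nat \<Rightarrow> nat) \<Rightarrow> (nat \<Rightarrow> nat) \<Rightarrow> (nat \<Rightarrow> nat) \<Rightarrow> real" where
  "ultra \<sigma> \<sigma>' \<sigma>'' = of_bool (cdist n a M X \<sigma> \<sigma>' \<le>
     max (cdist n a M X \<sigma> \<sigma>'') (cdist n a M X \<sigma>' \<sigma>''))"

text \<open>Two sites sets of the chain are nested, so the smaller of the two overlaps with
  \<open>\<sigma>''\<close> equals their intersection and is contained in the overlap of \<sigma>
  and \<open>\<sigma>'\<close>. Distances decrease as overlaps grow.\<close>

lemma ultra_chain:
  assumes "\<sigma> \<in> C" "\<sigma>' \<in> C" "\<sigma>'' \<in> C"
    and "ov \<sigma> \<sigma>'' \<in> Ch ` {0..K}" "ov \<sigma>' \<sigma>'' \<in> Ch ` {0..K}"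
  shows "ultra \<sigma> \<sigma>' \<sigma>'' = 1"
proof -
  have mono: "cdist n a M X \<sigma> \<sigma>' \<le> cdist n a M X \<rho> \<sigma>''"
    if "\<rho> \<in> C" "ov \<rho> \<sigma>'' \<subseteq> ov \<sigma> \<sigma>'" for \<rho>
  proof -
    have "(\<Sum>J | J \<in> P \<and> \<not> J \<subseteq> ov \<sigma> \<sigma>'. a J) \<le> (\<Sum>J | J \<in> P \<and> \<not> J \<subseteq> ov \<rho> \<sigma>''. a J)"
      using that(2) a_pos by (intro sum_mono2) (auto intro: less_imp_le)
    then show ?thesis
      unfolding cdist_eq[OF assms(1,2)] cdist_eq[OF that(1) assms(3)] by (simp add: mult_left_mono)
  qed
  have "ov \<sigma> \<sigma>'' \<inter> ov \<sigma>' \<sigma>'' \<subseteq> ov \<sigma> \<sigma>'" by (auto simp: ov_def)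
  moreover have "ov \<sigma> \<sigma>'' \<subseteq> ov \<sigma>' \<sigma>'' \<or> ov \<sigma>' \<sigma>'' \<subseteq> ov \<sigma> \<sigma>''"
  proof -
    obtain k l where "ov \<sigma> \<sigma>'' = Ch k" "ov \<sigma>' \<sigma>'' = Ch l" using assms(4,5) by auto
    then show ?thesis using Ch_mono[of k l] Ch_mono[of l k] by (metis nat_le_linear)
  qed
  ultimately have "ov \<sigma> \<sigma>'' \<subseteq> ov \<sigma> \<sigma>' \<or> ov \<sigma>' \<sigma>'' \<subseteq> ov \<sigma> \<sigma>'" by blast
  then show ?thesis using mono[of \<sigma>] mono[of \<sigma>'] assms by (auto simp: ultra_def)
qed

text \<open>A triple can fail only if \<open>\<sigma>''\<close> has an overlap outside the chain
  with \<sigma> or with \<open>\<sigma>'\<close>. The remaining replica sums out, and each of the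
  two cases has Gibbs mass \<open>A2\<close>.\<close>

lemma ultra_avg_bounds:
  defines "E \<equiv> expectation (\<lambda>\<omega>. gibbs_avg3 n a \<gamma> N X \<beta> \<omega> ultra)"
  shows "E \<le> 1" "E \<ge> 1 - 3 * (\<Sum>A | A \<subseteq> I \<and> A \<notin> Ch ` {0..K}. ov_prob A)"
proof -
  define \<N> where "\<N> = {A. A \<subseteq> I \<and> A \<notin> Ch ` {0..K}}"
  have fin: "finite \<N>" by (rule finite_subset[of _ "Pow I"]) (auto simp: \<N>_def)
  define off where "off \<sigma> \<tau> = (of_bool (ov \<sigma> \<tau> \<in> \<N>) :: real)" for \<sigma> \<tau>
  define A3 where "A3 \<omega> = gibbs_avg3 n a \<gamma> N X \<beta> \<omega> ultra" for \<omega>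
  define A2 where "A2 \<omega> = (\<Sum>\<sigma>\<in>C. \<Sum>\<tau>\<in>C. G \<sigma> \<omega> * G \<tau> \<omega> * off \<sigma> \<tau>)" for \<omega>
  have A3: "A3 \<omega> = (\<Sum>\<sigma>\<in>C. \<Sum>\<sigma>'\<in>C. \<Sum>\<sigma>''\<in>C. G \<sigma> \<omega> * G \<sigma>' \<omega> * G \<sigma>'' \<omega> * ultra \<sigma> \<sigma>' \<sigma>'')" for \<omega>
    by (simp add: A3_def gibbs_avg3_def G_def)
  have one: "(\<Sum>\<sigma>\<in>C. \<Sum>\<sigma>'\<in>C. \<Sum>\<sigma>''\<in>C. G \<sigma> \<omega> * G \<sigma>' \<omega> * G \<sigma>'' \<omega>) = 1" for \<omega>
    by (simp add: sum_G flip: sum_distrib_left)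
  have le1: "A3 \<omega> \<le> 1" for \<omega>
  proof -
    have "A3 \<omega> \<le> (\<Sum>\<sigma>\<in>C. \<Sum>\<sigma>'\<in>C. \<Sum>\<sigma>''\<in>C. G \<sigma> \<omega> * G \<sigma>' \<omega> * G \<sigma>'' \<omega>)"
      unfolding A3 using G_nonneg by (intro sum_mono) (simp add: ultra_def)
    then show ?thesis by (simp add: one)
  qed
  have ge0: "A3 \<omega> \<ge> 0" for \<omega>
    unfolding A3 using G_nonneg by (intro sum_nonneg mult_nonneg_nonneg) (auto simp: ultra_def)
  have A3_int: "integrable M A3"
  proof (rule integrable_const_bound[where B = 1])
    show "AE \<omega> in M. norm (A3 \<omega>) \<le> 1" using le1 ge0 by simp
    show "A3 \<in> borel_measurable M"
      unfolding A3 by (intro borel_measurable_sum borel_measurable_times G_meas borel_measurable_const)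
  qed
  have int: "integrable M (\<lambda>\<omega>. \<Sum>\<sigma>\<in>C. \<Sum>\<tau>\<in>C. G \<sigma> \<omega> * G \<tau> \<omega> * f \<sigma> \<tau>)" for f :: "_ \<Rightarrow> _ \<Rightarrow> real"
    by (intro Bochner_Integration.integrable_sum integrable_mult_left integrable_GG)
  have A2_int: "integrable M A2" unfolding A2_def by (rule int)
  have "off \<sigma> \<tau> = (\<Sum>A\<in>\<N>. of_bool (ov \<sigma> \<tau> = A))" for \<sigma> \<tau>
    using fin by (simp add: off_def of_bool_def)
  then have A2_eq: "A2 \<omega> = (\<Sum>\<sigma>\<in>C. \<Sum>\<tau>\<in>C. \<Sum>A\<in>\<N>. G \<sigma> \<omega> * G \<tau> \<omega> * of_bool (ov \<sigma> \<tau> = A))" for \<omega>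
    unfolding A2_def by (simp add: sum_distrib_left)
  have swap: "(\<Sum>\<sigma>\<in>C. \<Sum>\<tau>\<in>C. \<Sum>A\<in>\<N>. G \<sigma> \<omega> * G \<tau> \<omega> * of_bool (ov \<sigma> \<tau> = A))
      = (\<Sum>A\<in>\<N>. \<Sum>\<sigma>\<in>C. \<Sum>\<tau>\<in>C. G \<sigma> \<omega> * G \<tau> \<omega> * of_bool (ov \<sigma> \<tau> = A))" for \<omega>
    by (subst (2) sum.swap, rule sum.cong[OF refl], rule sum.swap)
  have "expectation A2 = (\<Sum>A\<in>\<N>. ov_prob A)"
    unfolding A2_eq[abs_def] swap ov_prob_def by (rule Bochner_Integration.integral_sum) (rule int)
  have "1 - 3 * A2 \<omega> \<le> A3 \<omega>" for \<omega>
  proof -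
    have "G \<sigma> \<omega> * G \<sigma>' \<omega> * G \<sigma>'' \<omega> \<le> G \<sigma> \<omega> * G \<sigma>' \<omega> * G \<sigma>'' \<omega> * ultra \<sigma> \<sigma>' \<sigma>''
        + (G \<sigma> \<omega> * (G \<sigma>' \<omega> * (G \<sigma>'' \<omega> * off \<sigma> \<sigma>'')) + G \<sigma> \<omega> * (G \<sigma>' \<omega> * (G \<sigma>'' \<omega> * off \<sigma>' \<sigma>'')))"
      if "\<sigma> \<in> C" "\<sigma>' \<in> C" "\<sigma>'' \<in> C" for \<sigma> \<sigma>' \<sigma>''
    proof -
      have "1 \<le> ultra \<sigma> \<sigma>' \<sigma>'' + (off \<sigma> \<sigma>'' + off \<sigma>' \<sigma>'')"
        using ultra_chain[OF that] ov_subset by (auto simp: off_def \<N>_def ultra_def)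
      then have "G \<sigma> \<omega> * G \<sigma>' \<omega> * G \<sigma>'' \<omega> * 1
          \<le> G \<sigma> \<omega> * G \<sigma>' \<omega> * G \<sigma>'' \<omega> * (ultra \<sigma> \<sigma>' \<sigma>'' + (off \<sigma> \<sigma>'' + off \<sigma>' \<sigma>''))"
        using G_nonneg by (intro mult_left_mono) auto
      then show ?thesis by (simp add: algebra_simps)
    qed
    then have "(\<Sum>\<sigma>\<in>C. \<Sum>\<sigma>'\<in>C. \<Sum>\<sigma>''\<in>C. G \<sigma> \<omega> * G \<sigma>' \<omega> * G \<sigma>'' \<omega>)
      \<le> (\<Sum>\<sigma>\<in>C. \<Sum>\<sigma>'\<in>C. \<Sum>\<sigma>''\<in>C. G \<sigma> \<omega> * G \<sigma>' \<omega> * G \<sigma>'' \<omega> * ultra \<sigma> \<sigma>' \<sigma>''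
        + (G \<sigma> \<omega> * (G \<sigma>' \<omega> * (G \<sigma>'' \<omega> * off \<sigma> \<sigma>'')) + G \<sigma> \<omega> * (G \<sigma>' \<omega> * (G \<sigma>'' \<omega> * off \<sigma>' \<sigma>''))))"
      by (intro sum_mono) auto
    also have "\<dots> = A3 \<omega> + ((\<Sum>\<sigma>\<in>C. G \<sigma> \<omega> * (\<Sum>\<sigma>'\<in>C. G \<sigma>' \<omega> * (\<Sum>\<sigma>''\<in>C. G \<sigma>'' \<omega> * off \<sigma> \<sigma>'')))
        + (\<Sum>\<sigma>\<in>C. G \<sigma> \<omega> * (\<Sum>\<sigma>'\<in>C. G \<sigma>' \<omega> * (\<Sum>\<sigma>''\<in>C. G \<sigma>'' \<omega> * off \<sigma>' \<sigma>''))))"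
      unfolding sum.distrib A3 sum_distrib_left ..
    also have "(\<Sum>\<sigma>\<in>C. G \<sigma> \<omega> * (\<Sum>\<sigma>'\<in>C. G \<sigma>' \<omega> * (\<Sum>\<sigma>''\<in>C. G \<sigma>'' \<omega> * off \<sigma> \<sigma>''))) = A2 \<omega>"
      unfolding A2_def sum_distrib_right[symmetric] sum_G by (simp add: sum_distrib_left mult_ac)
    also have "(\<Sum>\<sigma>\<in>C. G \<sigma> \<omega> * (\<Sum>\<sigma>'\<in>C. G \<sigma>' \<omega> * (\<Sum>\<sigma>''\<in>C. G \<sigma>'' \<omega> * off \<sigma>' \<sigma>''))) = A2 \<omega>"
      unfolding A2_def sum_distrib_right[symmetric] sum_G by (simp add: sum_distrib_left mult_ac)
    finally have "1 \<le> A3 \<omega> + 2 * A2 \<omega>" by (simp add: one)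
    \<comment> \<open>Two pairs were counted; nonnegativity relaxes the factor two to three.\<close>
    moreover have "A2 \<omega> \<ge> 0" unfolding A2_def using G_nonneg
      by (intro sum_nonneg mult_nonneg_nonneg) (auto simp: off_def)
    ultimately show ?thesis by simp
  qed
  then have "expectation (\<lambda>\<omega>. 1 - 3 * A2 \<omega>) \<le> expectation A3"
    using A2_int A3_int by (intro integral_mono) auto
  then show "E \<ge> 1 - 3 * (\<Sum>A | A \<subseteq> I \<and> A \<notin> Ch ` {0..K}. ov_prob A)"
    unfolding E_def A3_def[symmetric] \<N>_def[symmetric] \<open>expectation A2 = _\<close>[symmetric]
    using A2_int by (simp add: prob_space)
  have "expectation A3 \<le> expectation (\<lambda>_. 1)"
    using A3_int le1 by (intro integral_mono) auto
  then show "E \<le> 1" unfolding E_def A3_def[symmetric] by (simp add: prob_space)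
qed

end

section \<open>The limit of large size\<close>

locale gibbs_sequence = weights n a \<gamma> for n a \<gamma> +
  fixes M :: "nat \<Rightarrow> 'w measure" and X :: "nat \<Rightarrow> nat set \<Rightarrow> (nat \<Rightarrow> nat) \<Rightarrow> 'w \<Rightarrow> real" and \<beta> :: real
  assumes model: "\<And>N. N > 0 \<Longrightarrow> gibbs_model n a \<gamma> (M N) N (X N) \<beta>"
begin

abbreviation bad where "bad N \<equiv> gibbs_model.bad n a \<gamma> (M N) N (X N) \<beta>"
abbreviation dev where "dev N \<equiv> gibbs_model.dev n a \<gamma> (M N) N (X N) \<beta>"
abbreviation ov_prob where "ov_prob N \<equiv> gibbs_model.ov_prob n a \<gamma> (M N) N (X N) \<beta>"
abbreviation mean_energy where "mean_energy N \<equiv> gibbs_model.mean_energy n a \<gamma> (M N) N (X N) \<beta>"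
abbreviation loss where "loss \<equiv> gibbs_model.loss n a \<gamma> \<beta>"

lemma finite_P [simp]: "finite (active a I)" by (simp add: finite_active)

text \<open>Nonnegativity of \<open>h\<close> is what makes the second moment work: it bounds the
  Gaussian cost \<open>V A / 2\<close> by the entropy of \<open>A\<close>, so lowering the targets
  by the fraction \<epsilon> leaves the surplus \<open>\<epsilon> * (ln 2 * gam \<gamma> A)\<close>.
  The factor \<open>2 ^ n\<close> pays for rounding the numbers of spins.\<close>

lemma small_Z_term_bound:
  assumes N: "N > 0" and \<epsilon>: "0 < \<epsilon>" "\<epsilon> < 1" and A: "A \<subseteq> I"
    and tails: "\<forall>J\<in>active a I. exp (- (real N * ((1 - \<epsilon>) * (a J * (bcrit J)\<^sup>2) / 2)))
      \<le> normal_density 0 (sqrt (a J * real N)) ((1 - \<epsilon>) * (a J * bcrit J) * real N + 1)"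
  shows "1 / (real (card (configs \<gamma> N A)) * prod (gibbs_model.tail n a \<gamma> N \<epsilon>) (active a A))
    \<le> 2 ^ n * exp (- (real N * (\<epsilon> * (ln 2 * gam \<gamma> A))))"
proof -
  interpret m: gibbs_model n a \<gamma> "M N" N "X N" \<beta> by (rule model[OF N])
  have AP: "active a A \<subseteq> active a I" by (rule active_mono[OF A])
  have fin: "finite (active a A)" by (rule finite_subset[OF AP finite_P])
  have tail: "m.tail \<epsilon> J \<ge> exp (- (real N * ((1 - \<epsilon>) * (a J * (bcrit J)\<^sup>2) / 2)))" if J: "J \<in> active a A" for J
  proof -
    have JP: "J \<in> active a I" using J AP by auto
    have v: "a J * real N > 0" using m.a_pos[OF JP] N by simp
    have x: "(1 - \<epsilon>) * (a J * bcrit J) * real N \<ge> 0"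
      using m.a_pos[OF JP] bcrit_pos[OF JP] \<epsilon> by simp
    show ?thesis using tails JP normal_tail_lower[OF v x] unfolding m.tail_def by force
  qed
  have "exp (- (real N * ((1 - \<epsilon>) * V A / 2))) = (\<Prod>J\<in>active a A. exp (- (real N * ((1 - \<epsilon>) * (a J * (bcrit J)\<^sup>2) / 2))))"
    unfolding exp_sum[OF fin, symmetric] V_def
    by (simp add: sum_distrib_left sum_negf sum_divide_distrib)
  also have "\<dots> \<le> prod (m.tail \<epsilon>) (active a A)"
    using tail by (intro prod_mono) auto
  finally have p: "exp (- (real N * ((1 - \<epsilon>) * V A / 2))) \<le> prod (m.tail \<epsilon>) (active a A)" .
  have "(1 - \<epsilon>) * V A \<le> (1 - \<epsilon>) * (2 * ln 2 * gam \<gamma> A)"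
    using h_nonneg[OF A] \<epsilon> by (intro mult_left_mono) (auto simp: h_def)
  then have "2 * (\<epsilon> * (ln 2 * gam \<gamma> A)) \<le> 2 * (ln 2 * gam \<gamma> A) - (1 - \<epsilon>) * V A"
    by (simp add: algebra_simps)
  then have "\<epsilon> * (ln 2 * gam \<gamma> A) \<le> ln 2 * gam \<gamma> A - (1 - \<epsilon>) * V A / 2" by linarith
  then have "real N * (\<epsilon> * (ln 2 * gam \<gamma> A)) \<le> real N * (ln 2 * gam \<gamma> A - (1 - \<epsilon>) * V A / 2)"
    by (intro mult_left_mono) auto
  then have "exp (real N * (\<epsilon> * (ln 2 * gam \<gamma> A))) / 2 ^ n
      \<le> exp (real N * (ln 2 * gam \<gamma> A)) / 2 ^ n * exp (- (real N * ((1 - \<epsilon>) * V A / 2)))"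
    by (simp add: divide_right_mono right_diff_distrib flip: exp_add)
  also have "\<dots> \<le> real (card (configs \<gamma> N A)) * prod (m.tail \<epsilon>) (active a A)"
    by (intro mult_mono m.card_cfg_lower[OF A] p) auto
  finally have le: "exp (real N * (\<epsilon> * (ln 2 * gam \<gamma> A))) / 2 ^ n
      \<le> real (card (configs \<gamma> N A)) * prod (m.tail \<epsilon>) (active a A)" .
  have pos: "0 < exp (real N * (\<epsilon> * (ln 2 * gam \<gamma> A))) / 2 ^ n" by simp
  have "1 / (real (card (configs \<gamma> N A)) * prod (m.tail \<epsilon>) (active a A))
      \<le> 1 / (exp (real N * (\<epsilon> * (ln 2 * gam \<gamma> A))) / 2 ^ n)"
    by (rule divide_left_mono[OF le _ mult_pos_pos[OF less_le_trans[OF pos le] pos]]) simp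
  also have "\<dots> = 2 ^ n * exp (- (real N * (\<epsilon> * (ln 2 * gam \<gamma> A))))"
    by (simp add: exp_minus field_simps)
  finally show ?thesis .
qed

lemma bad_tendsto:
  assumes \<epsilon>: "0 < \<epsilon>" "\<epsilon> < 1"
  shows "(\<lambda>N. measure (M N) (bad N \<epsilon>)) \<longlonglongrightarrow> 0"
proof (rule tendsto_sandwich)
  let ?U = "\<lambda>N. real K * exp (- (real N * \<epsilon>))
    + (\<Sum>A\<in>Pow I - {{}}. 2 ^ n * exp (- (real N * (\<epsilon> * (ln 2 * gam \<gamma> A)))))"
  show "\<forall>\<^sub>F N in sequentially. 0 \<le> measure (M N) (bad N \<epsilon>)" by simp
  have "\<forall>\<^sub>F N in sequentially. \<forall>J\<in>active a I. exp (- (real N * ((1 - \<epsilon>) * (a J * (bcrit J)\<^sup>2) / 2)))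
      \<le> normal_density 0 (sqrt (a J * real N)) ((1 - \<epsilon>) * (a J * bcrit J) * real N + 1)"
    by (intro eventually_ball_finite ballI eventually_normal_density_ge)
      (use \<epsilon> bcrit_pos in \<open>auto simp: active_def\<close>)
  with eventually_gt_at_top[of 0] show "\<forall>\<^sub>F N in sequentially. measure (M N) (bad N \<epsilon>) \<le> ?U N"
  proof eventually_elim
    case (elim N)
    interpret m: gibbs_model n a \<gamma> "M N" N "X N" \<beta> by (rule model[OF elim(1)])
    have "measure (M N) (bad N \<epsilon>) \<le> measure (M N) (m.overshoot \<epsilon>) + measure (M N) (m.small_Z \<epsilon>)"
      unfolding m.bad_def by (rule measure_Un_le) auto
    also have "\<dots> \<le> ?U N"
    proof (intro add_mono m.prob_overshoot order_trans[OF m.prob_small_Z] sum_mono)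
      fix A assume "A \<in> Pow I - {{}}"
      then show "1 / (real (card (configs \<gamma> N A)) * prod (m.tail \<epsilon>) (active a A))
          \<le> 2 ^ n * exp (- (real N * (\<epsilon> * (ln 2 * gam \<gamma> A))))"
        by (intro small_Z_term_bound elim \<epsilon>) auto
    qed (use \<epsilon> in auto)
    finally show ?case .
  qed
  have "gam \<gamma> A > 0" if "A \<in> Pow I - {{}}" for A
    using gam_strict_mono[of "{}" A] that by (auto simp: gam_def)
  then have "?U \<longlonglongrightarrow> real K * 0 + (\<Sum>A\<in>Pow I - {{}}. 2 ^ n * 0)"
    using \<epsilon> by (intro tendsto_add tendsto_mult tendsto_sum tendsto_const exp_decay_tendsto mult_pos_pos) auto
  then show "?U \<longlonglongrightarrow> 0" by simp
qed simp

lemma loss_nonneg: "loss \<ge> 0"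
proof -
  \<comment> \<open>\<open>loss\<close> does not depend on the size, so size one serves to import
    the signs of its ingredients.\<close>
  interpret m: gibbs_model n a \<gamma> "M 1" 1 "X 1" \<beta> by (rule model) simp
  show ?thesis unfolding m.loss_def using m.\<beta>_pos m.E0_nonneg wt_nonneg
    by (intro add_nonneg_nonneg mult_nonneg_nonneg sum_nonneg) auto
qed

lemma small_loss:
  assumes "c > 0" obtains \<epsilon> where "0 < \<epsilon>" "\<epsilon> < 1" "loss * \<epsilon> \<le> c"
proof
  let ?\<epsilon> = "min (1 / 2) (c / (loss + 1))"
  show "0 < ?\<epsilon>" "?\<epsilon> < 1" using assms loss_nonneg by auto
  have "loss * ?\<epsilon> \<le> (loss + 1) * (c / (loss + 1))"
    using loss_nonneg assms by (intro mult_mono) auto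
  then show "loss * ?\<epsilon> \<le> c" using loss_nonneg by simp
qed

lemma dev_tendsto:
  assumes J: "J \<in> active a I" and "\<delta> > 0"
  shows "(\<lambda>N. dev N J \<delta>) \<longlonglongrightarrow> 0"
proof -
  have aJ: "a J > 0" using J by (simp add: active_def)
  \<comment> \<open>Half of the rate in \<open>dev_bound\<close>: \<epsilon> is chosen to spend at
    most one half, and the other half remains as decay.\<close>
  define c where "c = \<delta>\<^sup>2 / (4 * a J)"
  have c: "c > 0" using aJ assms by (simp add: c_def)
  have c2: "\<delta>\<^sup>2 / (2 * a J) = 2 * c" by (simp add: c_def)
  obtain \<epsilon> where \<epsilon>: "0 < \<epsilon>" "\<epsilon> < 1" "loss * \<epsilon> \<le> c" using small_loss[OF c] .
  show ?thesis
  proof (rule tendsto_sandwich)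
    show "\<forall>\<^sub>F N in sequentially. 0 \<le> dev N J \<delta>"
      using eventually_gt_at_top[of 0]
      by eventually_elim (rule gibbs_model.dev_nonneg[OF model])
    show "\<forall>\<^sub>F N in sequentially. dev N J \<delta> \<le> measure (M N) (bad N \<epsilon>) + 2 * exp (- (real N * c))"
      using eventually_gt_at_top[of 0]
    proof eventually_elim
      case (elim N)
      interpret m: gibbs_model n a \<gamma> "M N" N "X N" \<beta> by (rule model[OF elim])
      have "dev N J \<delta> \<le> measure (M N) (bad N \<epsilon>) + 2 * exp (real N * (loss * \<epsilon> - \<delta>\<^sup>2 / (2 * a J)))"
        using m.dev_bound[OF J _ assms(2)] \<epsilon> by simp
      also have "real N * (loss * \<epsilon> - \<delta>\<^sup>2 / (2 * a J)) \<le> real N * - c"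
        using \<epsilon>(3) unfolding c2 by (intro mult_left_mono) auto
      finally show ?case by simp
    qed
    have "(\<lambda>N. measure (M N) (bad N \<epsilon>) + 2 * exp (- (real N * c))) \<longlonglongrightarrow> 0 + 2 * 0"
      by (intro tendsto_intros bad_tendsto exp_decay_tendsto \<epsilon> c)
    then show "(\<lambda>N. measure (M N) (bad N \<epsilon>) + 2 * exp (- (real N * c))) \<longlonglongrightarrow> 0" by simp
  qed simp
qed

lemma ov_prob_tendsto_0:
  assumes A: "A \<subseteq> I" "h A \<noteq> 0"
  shows "(\<lambda>N. ov_prob N A) \<longlonglongrightarrow> 0"
proof -
  define B where "B = (\<Sum>J\<in>active a I. bcrit J)"
  have B: "B \<ge> 0" unfolding B_def using bcrit_pos by (intro sum_nonneg) (auto intro: less_imp_le)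
  \<comment> \<open>The available rate \<open>h A / 2\<close> is \<open>4 * c\<close>. The two
    weight bounds spend at most \<open>2 * c\<close> and the deviations at most \<open>c\<close>, so
    the decay rate \<open>c\<close> remains.\<close>
  define c where "c = h A / 8"
  have c: "c > 0" using A h_nonneg[OF A(1)] by (simp add: c_def)
  define \<delta> where "\<delta> = c / (B + 1)"
  have \<delta>: "\<delta> > 0" using B c by (simp add: \<delta>_def)
  have \<delta>B: "\<delta> * B \<le> c"
  proof -
    have "\<delta> * B \<le> \<delta> * (B + 1)" using \<delta> by simp
    also have "\<dots> = c" using B by (simp add: \<delta>_def)
    finally show ?thesis .
  qed
  obtain \<epsilon> where \<epsilon>: "0 < \<epsilon>" "\<epsilon> < 1" "loss * \<epsilon> \<le> c" using small_loss[OF c] .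
  let ?U = "\<lambda>N. measure (M N) (bad N \<epsilon>) + (\<Sum>J\<in>active a I. dev N J \<delta>) + exp (- (real N * c))"
  show ?thesis
  proof (rule tendsto_sandwich)
    show "\<forall>\<^sub>F N in sequentially. 0 \<le> ov_prob N A"
      using eventually_gt_at_top[of 0]
      by eventually_elim (rule gibbs_model.ov_prob_nonneg[OF model])
    show "\<forall>\<^sub>F N in sequentially. ov_prob N A \<le> ?U N"
      using eventually_gt_at_top[of 0]
    proof eventually_elim
      case (elim N)
      interpret m: gibbs_model n a \<gamma> "M N" N "X N" \<beta> by (rule model[OF elim])
      have "ov_prob N A \<le> measure (M N) (bad N \<epsilon>) + (\<Sum>J\<in>active a I. dev N J \<delta>)
          + exp (real N * (2 * (loss * \<epsilon>) + \<delta> * B - h A / 2))"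
        using m.ov_prob_bound[OF A(1) _ \<delta>] \<epsilon> unfolding B_def by simp
      also have "real N * (2 * (loss * \<epsilon>) + \<delta> * B - h A / 2) \<le> real N * - c"
        using \<epsilon>(3) \<delta>B by (intro mult_left_mono) (auto simp: c_def)
      finally show ?case by simp
    qed
    have "?U \<longlonglongrightarrow> 0 + (\<Sum>J\<in>active a I. 0) + 0"
      by (intro tendsto_intros bad_tendsto exp_decay_tendsto dev_tendsto \<epsilon> c \<delta>)
    then show "?U \<longlonglongrightarrow> 0" by simp
  qed simp
qed

lemma mean_energy_tendsto:
  assumes J: "J \<in> active a I"
  shows "(\<lambda>N. mean_energy N J / real N) \<longlonglongrightarrow> a J * bcrit J"
proof (rule tendstoI)
  fix e :: real assume e: "e > 0"
  define R where "R = ln 2 * gam \<gamma> I + a J / 2 + a J * bcrit J + 1"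
  have "(\<lambda>N. e / 2 + R * dev N J (e / 2) + 2 * R * exp (- (real N * 1))) \<longlonglongrightarrow> e / 2 + R * 0 + 2 * R * 0"
    using e by (intro tendsto_intros exp_decay_tendsto dev_tendsto J) auto
  then have "\<forall>\<^sub>F N in sequentially. e / 2 + R * dev N J (e / 2) + 2 * R * exp (- (real N * 1)) < e"
    by (rule order_tendstoD(2)) (use e in simp)
  with eventually_gt_at_top[of 0]
  show "\<forall>\<^sub>F N in sequentially. dist (mean_energy N J / real N) (a J * bcrit J) < e"
  proof eventually_elim
    case (elim N)
    have "\<bar>mean_energy N J / real N - a J * bcrit J\<bar> \<le> e / 2 + R * dev N J (e / 2) + 2 * R * exp (- real N)"
      unfolding R_def using gibbs_model.mean_energy_close[OF model[OF elim(1)] J, of "e / 2"] e by simp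
    then show ?case using elim(2) by (simp add: dist_real_def)
  qed
qed

section \<open>Asymptotic overlap probabilities of bonds and sites\<close>

lemma bond_overlap_tendsto:
  assumes J: "J \<in> active a I"
  shows "(\<lambda>N. \<Sum>A | A \<subseteq> I \<and> J \<subseteq> A. ov_prob N A) \<longlonglongrightarrow> 1 - bcrit J / \<beta>"
proof -
  have aJ: "a J > 0" using J by (simp add: active_def)
  have \<beta>: "\<beta> > 0" using gibbs_model.\<beta>_pos[OF model[of 1]] by simp
  have "(\<lambda>N. 1 - mean_energy N J / real N / (a J * \<beta>)) \<longlonglongrightarrow> 1 - a J * bcrit J / (a J * \<beta>)"
    using aJ \<beta> by (intro tendsto_intros mean_energy_tendsto J) auto
  moreover have "\<forall>\<^sub>F N in sequentially. 1 - mean_energy N J / real N / (a J * \<beta>)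
      = (\<Sum>A | A \<subseteq> I \<and> J \<subseteq> A. ov_prob N A)"
    using eventually_gt_at_top[of 0]
  proof eventually_elim
    case (elim N)
    show ?case
      unfolding gibbs_model.mean_energy_eq[OF model[OF elim] J] using elim aJ \<beta> by simp
  qed
  ultimately have "(\<lambda>N. \<Sum>A | A \<subseteq> I \<and> J \<subseteq> A. ov_prob N A) \<longlonglongrightarrow> 1 - a J * bcrit J / (a J * \<beta>)"
    by (rule Lim_transform_eventually)
  then show ?thesis using aJ by simp
qed

lemma finite_sub [simp]: "finite {A. A \<subseteq> I \<and> Q A}"
  by (rule finite_subset[of _ "Pow I"]) auto

text \<open>
  Since the overlap set is asymptotically a zero of \<open>h\<close>, it contains the site \<open>i\<close> exactly when it
  contains a bond of the same level lying in the smallest zero around \<open>i\<close>.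
\<close>

lemma site_overlap_tendsto:
  assumes i: "i \<in> I" and J: "J \<in> active a I" "level J = level {i}"
  shows "(\<lambda>N. \<Sum>A | A \<subseteq> I \<and> i \<in> A. ov_prob N A) \<longlonglongrightarrow> 1 - bcrit J / \<beta>"
proof -
  obtain J1 where J1: "J1 \<in> active a I" "i \<in> J1" "level J1 = level {i}"
      "\<And>A. A \<subseteq> I \<Longrightarrow> h A = 0 \<Longrightarrow> i \<in> A \<Longrightarrow> J1 \<subseteq> A"
    using active_within_minimal_zero[OF i] by blast
  have split: "(\<Sum>A | A \<subseteq> I \<and> i \<in> A. ov_prob N A)
      = (\<Sum>A | A \<subseteq> I \<and> J1 \<subseteq> A. ov_prob N A) + (\<Sum>A | A \<subseteq> I \<and> i \<in> A \<and> \<not> J1 \<subseteq> A. ov_prob N A)" for N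
  proof -
    have "{A. A \<subseteq> I \<and> i \<in> A} = {A. A \<subseteq> I \<and> J1 \<subseteq> A} \<union> {A. A \<subseteq> I \<and> i \<in> A \<and> \<not> J1 \<subseteq> A}"
      using J1(2) by auto
    then show ?thesis by (simp add: sum.union_disjoint disjoint_iff)
  qed
  have "(\<lambda>N. \<Sum>A | A \<subseteq> I \<and> i \<in> A. ov_prob N A)
      \<longlonglongrightarrow> 1 - bcrit J1 / \<beta> + (\<Sum>A | A \<subseteq> I \<and> i \<in> A \<and> \<not> J1 \<subseteq> A. 0)"
    unfolding split
    by (intro tendsto_add bond_overlap_tendsto J1(1) tendsto_sum ov_prob_tendsto_0) (use J1(4) in auto)
  \<comment> \<open>\<open>bcrit\<close> depends on the level only, so any bond of the site's level
    yields the same limit.\<close>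
  then show ?thesis using J J1(3) by (simp add: bcrit_def)
qed

text \<open>If \<open>h A = 0\<close>, some bond \<open>J\<close> leaves \<open>A\<close> although
  it passes through a site \<open>i\<close> of \<open>A\<close> of the same level. An overlap set
  containing \<open>J\<close> contains \<open>i\<close>, and both events have the same limiting
  probability, so their difference vanishes; the overlap set \<open>A\<close> belongs to that
  difference.\<close>

lemma ov_prob_outside_chain:
  assumes irr: "irreducible_hamiltonian n a \<gamma>" and A: "A \<subseteq> I" "A \<notin> Ch ` {0..K}"
  shows "(\<lambda>N. ov_prob N A) \<longlonglongrightarrow> 0"
proof (cases "h A = 0")
  case False
  then show ?thesis by (rule ov_prob_tendsto_0[OF A(1)])
next
  case True
  obtain J i where J: "J \<in> active a I" "i \<in> J" "level J = level {i}" "i \<in> A" "\<not> J \<subseteq> A"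
    using zero_outside_chain[OF irr A(1) True A(2)] .
  have i: "i \<in> I" using J A by auto
  let ?U = "\<lambda>N. (\<Sum>A | A \<subseteq> I \<and> i \<in> A. ov_prob N A) - (\<Sum>A | A \<subseteq> I \<and> J \<subseteq> A. ov_prob N A)"
  show ?thesis
  proof (rule tendsto_sandwich)
    show "\<forall>\<^sub>F N in sequentially. 0 \<le> ov_prob N A"
      using eventually_gt_at_top[of 0]
      by eventually_elim (rule gibbs_model.ov_prob_nonneg[OF model])
    show "\<forall>\<^sub>F N in sequentially. ov_prob N A \<le> ?U N"
      using eventually_gt_at_top[of 0]
    proof eventually_elim
      case (elim N)
      have "{A. A \<subseteq> I \<and> J \<subseteq> A} \<subseteq> {A. A \<subseteq> I \<and> i \<in> A}" using J(2) by auto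
      then have "?U N = (\<Sum>A\<in>{A. A \<subseteq> I \<and> i \<in> A} - {A. A \<subseteq> I \<and> J \<subseteq> A}. ov_prob N A)"
        by (simp add: sum_diff)
      moreover have "ov_prob N A \<le> (\<Sum>A\<in>{A. A \<subseteq> I \<and> i \<in> A} - {A. A \<subseteq> I \<and> J \<subseteq> A}. ov_prob N A)"
        using J A gibbs_model.ov_prob_nonneg[OF model[OF elim]] by (intro member_le_sum) auto
      ultimately show ?case by simp
    qed
    have "?U \<longlonglongrightarrow> (1 - bcrit J / \<beta>) - (1 - bcrit J / \<beta>)"
      by (intro tendsto_diff site_overlap_tendsto bond_overlap_tendsto i J)
    then show "?U \<longlonglongrightarrow> 0" by simp
  qed simp
qed

lemma ultra_avg_tendsto:
  assumes "irreducible_hamiltonian n a \<gamma>"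
  shows "(\<lambda>N. \<integral>\<omega>. gibbs_avg3 n a \<gamma> N (X N) \<beta> \<omega> (gibbs_model.ultra n a (M N) (X N)) \<partial>M N) \<longlonglongrightarrow> 1"
proof (rule tendsto_sandwich)
  let ?L = "\<lambda>N. 1 - 3 * (\<Sum>A | A \<subseteq> I \<and> A \<notin> Ch ` {0..K}. ov_prob N A)"
  show "\<forall>\<^sub>F N in sequentially. ?L N \<le>
      (\<integral>\<omega>. gibbs_avg3 n a \<gamma> N (X N) \<beta> \<omega> (gibbs_model.ultra n a (M N) (X N)) \<partial>M N)"
    using eventually_gt_at_top[of 0]
    by eventually_elim (rule gibbs_model.ultra_avg_bounds(2)[OF model])
  show "\<forall>\<^sub>F N in sequentially.
      (\<integral>\<omega>. gibbs_avg3 n a \<gamma> N (X N) \<beta> \<omega> (gibbs_model.ultra n a (M N) (X N)) \<partial>M N) \<le> 1"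
    using eventually_gt_at_top[of 0]
    by eventually_elim (rule gibbs_model.ultra_avg_bounds(1)[OF model])
  have "?L \<longlonglongrightarrow> 1 - 3 * (\<Sum>A | A \<subseteq> I \<and> A \<notin> Ch ` {0..K}. 0)"
    by (intro tendsto_intros ov_prob_outside_chain assms) auto
  then show "?L \<longlonglongrightarrow> 1" by simp
qed simp

end

theorem theorem2:
  fixes n :: nat
    and a :: "nat set \<Rightarrow> real"
    and \<gamma> :: "nat \<Rightarrow> real"
    and M :: "nat \<Rightarrow> 'w measure"
    and X :: "nat \<Rightarrow> nat set \<Rightarrow> (nat \<Rightarrow> nat) \<Rightarrow> 'w \<Rightarrow> real"
  assumes a_nonneg: "\<And>J. J \<subseteq> {1..n} \<Longrightarrow> a J \<ge> 0"
    and a_empty: "a {} = 0"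
    and a_sum: "(\<Sum>J\<in>Pow {1..n}. a J) = 1"
    and \<gamma>_pos: "\<And>i. i \<in> {1..n} \<Longrightarrow> \<gamma> i > 0"
    and \<gamma>_sum: "(\<Sum>i\<in>{1..n}. \<gamma> i) = 1"
    and covered: "\<And>i. i \<in> {1..n} \<Longrightarrow> \<exists>J\<in>active a {1..n}. i \<in> J"
    and disorder: "gaussian_disorder n a \<gamma> M X"
    and irreducible: "irreducible_hamiltonian n a \<gamma>"
  shows "\<exists>\<beta>\<^sub>0::real. \<forall>\<beta>>\<beta>\<^sub>0.
    (\<lambda>N. \<integral>\<omega>. gibbs_avg3 n a \<gamma> N (X N) \<beta> \<omega>
       (\<lambda>\<sigma> \<sigma>' \<sigma>''. of_bool (cdist n a (M N) (X N) \<sigma> \<sigma>' \<le>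
          max (cdist n a (M N) (X N) \<sigma> \<sigma>'') (cdist n a (M N) (X N) \<sigma>' \<sigma>''))) \<partial>M N)
      \<longlonglongrightarrow> 1"
proof -
  interpret W: weights n a \<gamma> by unfold_locales fact+
  \<comment> \<open>The entropy weights have total one, so the index set is not empty and the chain
    has at least one step.\<close>
  have n: "n > 0" using \<gamma>_sum by (cases n) auto
  have "W.K \<noteq> 0" using W.Ch_K n by (metis atLeastatMost_empty_iff2 chain.simps(1) not_one_le_zero
        Suc_leI One_nat_def)
  then have "W.sl W.K > 0" by (intro W.sl_pos) auto
  then have wt: "W.wt W.K > 0" by (simp add: W.wt_def)
  show ?thesis
  proof (intro exI allI impI)
    \<comment> \<open>This threshold is the last critical inverse temperature,
      \<open>sqrt (2 * ln 2 * W.sl W.K)\<close>.\<close>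
    fix \<beta> :: real assume \<beta>: "\<beta> > 1 / W.wt W.K"
    have model: "gibbs_model n a \<gamma> (M N) N (X N) \<beta>" if N: "N > 0" for N
    proof -
      have P: "prob_space (M N)" using disorder N by (simp add: gaussian_disorder_def)
      show ?thesis
        unfolding gibbs_model_def gibbs_model_axioms_def
        using disorder N n P \<beta> wt W.weights_axioms
        by (auto simp: gaussian_disorder_def divide_less_eq)
    qed
    interpret S: gibbs_sequence n a \<gamma> M X \<beta>
      by (intro gibbs_sequence.intro gibbs_sequence_axioms.intro W.weights_axioms model)
    have ultra: "gibbs_model.ultra n a (M N) (X N) = (\<lambda>\<sigma> \<sigma>' \<sigma>''. of_bool (cdist n a (M N) (X N) \<sigma> \<sigma>' \<le>
          max (cdist n a (M N) (X N) \<sigma> \<sigma>'') (cdist n a (M N) (X N) \<sigma>' \<sigma>'')))" if "N > 0" for N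
      by (intro ext) (rule gibbs_model.ultra_def[OF model[OF that]])
    show "(\<lambda>N. \<integral>\<omega>. gibbs_avg3 n a \<gamma> N (X N) \<beta> \<omega>
       (\<lambda>\<sigma> \<sigma>' \<sigma>''. of_bool (cdist n a (M N) (X N) \<sigma> \<sigma>' \<le>
          max (cdist n a (M N) (X N) \<sigma> \<sigma>'') (cdist n a (M N) (X N) \<sigma>' \<sigma>''))) \<partial>M N) \<longlonglongrightarrow> 1"
    \<comment> \<open>The definition of \<open>ultra\<close> unfolds only inside a model, and models
      exist for positive sizes only, so the two sequences are compared eventually.\<close>
    proof (rule Lim_transform_eventually[OF S.ultra_avg_tendsto[OF irreducible]])
      show "\<forall>\<^sub>F N in sequentially.
          (\<integral>\<omega>. gibbs_avg3 n a \<gamma> N (X N) \<beta> \<omega> (gibbs_model.ultra n a (M N) (X N)) \<partial>M N)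
        = (\<integral>\<omega>. gibbs_avg3 n a \<gamma> N (X N) \<beta> \<omega>
            (\<lambda>\<sigma> \<sigma>' \<sigma>''. of_bool (cdist n a (M N) (X N) \<sigma> \<sigma>' \<le>
              max (cdist n a (M N) (X N) \<sigma> \<sigma>'') (cdist n a (M N) (X N) \<sigma>' \<sigma>''))) \<partial>M N)"
        using eventually_gt_at_top[of 0] by eventually_elim (simp add: ultra)
    qed
  qed
qed

end
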